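(* A co-Brouwerian semilattice $L$ is existentially closed if and only if for every finite sub-CBS $L_0\subseteq L$: (1) every signature $(h,G)$ of the first kind in $L_0$ is induced by some element $x\in L$ primitive of the first kind over $L_0$; and (2) every signature $(h_1,h_2,g)$ of the second kind in $L_0$ is induced by some primitive couple $(x_1,x_2)\in L^2$ of the second kind over $L_0$.
   Context: A co-Brouwerian semilattice (CBS) is a poset with least element $0$, binary joins $\vee$ and a difference $-$ characterized by $a-b\le c$ iff $a\le b\vee c$ (a variety in signature $(0,\vee,-)$). $L$ is existentially closed if for every CBS $B\supseteq L$, every existential sentence with parameters in $L$ true in $B$ is true in $L$. An element $g$ is join-irreducible if for all $n\ge0$, $g\le b_1\vee\dots\vee b_n$ implies $g\le b_i$ for some $i$; in a finite CBS each join-irreducible $g$ has a unique predecessor $g^-$ (the largest element strictly below $g$). For a finite CBS $L_0$: a signature of the first kind is a pair $(h,G)$ with $h\in L_0$ and $G$ a (possibly empty) set of pairwise incomparable join-irreducibles of $L_0$ with $h<g$ for all $g\in G$; a signature of the second kind is a triple $(h_1,h_2,g)$ with $h_1,h_2\in L_0$, $g$ join-irreducible in $L_0$ and $h_1\vee h_2=g^-$. For an extension $L\supseteq L_0$: $x\in L$ is primitive of the first kind over $L_0$ if $x\notin L_0$ and for every join-irreducible $a$ of $L_0$, $a-x\in L_0$ and ($x-a=x$ or $x-a=0$); it induces $(h,G)$ if for every join-irreducible $a$ of $L_0$: $a<x$ iff $a\le h$, and $x<a$ iff $g\le a$ for some $g\in G$. A pair $(x_1,x_2)\in L^2$ is a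 primitive couple of the second kind over $L_0$ if $x_1,x_2\notin L_0$, $x_1\ne x_2$, and there is a join-irreducible $g$ of $L_0$ with $g-x_1=x_2$, $g-x_2=x_1$, and $a-x_i\in L_0$ ($i=1,2$) for all join-irreducible $a<g$ of $L_0$; it induces $(h_1,h_2,g)$ if $g=x_1\vee x_2$ and for every join-irreducible $a$ of $L_0$ and $i=1,2$: $a<x_i$ iff $a\le h_i$. *)

theory Defs
  imports Main
begin

section \<open>Co-Brouwerian semilattices\<close>

record 'a cbs_sig =
  carrier :: "'a set"
  le :: "'a \<Rightarrow> 'a \<Rightarrow> bool"  (infix \<open>\<sqsubseteq>\<index>\<close> 50)
  zero :: 'a  (\<open>\<zero>\<index>\<close>)
  join :: "'a \<Rightarrow> 'a \<Rightarrow> 'a"  (infixl \<open>\<squnion>\<index>\<close> 65)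
  diff :: "'a \<Rightarrow> 'a \<Rightarrow> 'a"  (infixl \<open>\<ominus>\<index>\<close> 65)

locale cbs =
  fixes L :: "'a cbs_sig" (structure)
  assumes zero_closed: "\<zero> \<in> carrier L"
    and join_closed: "\<lbrakk>a \<in> carrier L; b \<in> carrier L\<rbrakk> \<Longrightarrow> a \<squnion> b \<in> carrier L"
    and diff_closed: "\<lbrakk>a \<in> carrier L; b \<in> carrier L\<rbrakk> \<Longrightarrow> a \<ominus> b \<in> carrier L"
    and le_refl: "a \<in> carrier L \<Longrightarrow> a \<sqsubseteq> a"
    and le_antisym: "\<lbrakk>a \<in> carrier L; b \<in> carrier L; a \<sqsubseteq> b; b \<sqsubseteq> a\<rbrakk> \<Longrightarrow> a = b"
    and le_trans:
      "\<lbrakk>a \<in> carrier L; b \<in> carrier L; c \<in> carrier L; a \<sqsubseteq> b; b \<sqsubseteq> c\<rbrakk> \<Longrightarrow> a \<sqsubseteq> c"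
    and zero_least: "a \<in> carrier L \<Longrightarrow> \<zero> \<sqsubseteq> a"
    and join_le_iff:
      "\<lbrakk>a \<in> carrier L; b \<in> carrier L; c \<in> carrier L\<rbrakk> \<Longrightarrow> a \<squnion> b \<sqsubseteq> c \<longleftrightarrow> a \<sqsubseteq> c \<and> b \<sqsubseteq> c"
    and diff_le_iff:
      "\<lbrakk>a \<in> carrier L; b \<in> carrier L; c \<in> carrier L\<rbrakk> \<Longrightarrow> a \<ominus> b \<sqsubseteq> c \<longleftrightarrow> a \<sqsubseteq> b \<squnion> c"

definition less :: "'a cbs_sig \<Rightarrow> 'a \<Rightarrow> 'a \<Rightarrow> bool"  (infix \<open>\<sqsubset>\<index>\<close> 50) where
  "x \<sqsubset>\<^bsub>L\<^esub> y \<longleftrightarrow> x \<sqsubseteq>\<^bsub>L\<^esub> y \<and> x \<noteq> y"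

definition sub_cbs :: "'a set \<Rightarrow> 'a cbs_sig \<Rightarrow> bool" where
  "sub_cbs S L \<longleftrightarrow> S \<subseteq> carrier L \<and> \<zero>\<^bsub>L\<^esub> \<in> S \<and>
     (\<forall>a\<in>S. \<forall>b\<in>S. a \<squnion>\<^bsub>L\<^esub> b \<in> S \<and> a \<ominus>\<^bsub>L\<^esub> b \<in> S)"

abbreviation restrict_to :: "'a cbs_sig \<Rightarrow> 'a set \<Rightarrow> 'a cbs_sig" where
  "restrict_to L S \<equiv> L\<lparr>carrier := S\<rparr>"

definition cbs_embedding :: "('a \<Rightarrow> 'b) \<Rightarrow> 'a cbs_sig \<Rightarrow> 'b cbs_sig \<Rightarrow> bool" where
  "cbs_embedding e L B \<longleftrightarrow> e ` carrier L \<subseteq> carrier B \<and> inj_on e (carrier L) \<and>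
     e \<zero>\<^bsub>L\<^esub> = \<zero>\<^bsub>B\<^esub> \<and>
     (\<forall>a\<in>carrier L. \<forall>b\<in>carrier L.
        e (a \<squnion>\<^bsub>L\<^esub> b) = e a \<squnion>\<^bsub>B\<^esub> e b \<and> e (a \<ominus>\<^bsub>L\<^esub> b) = e a \<ominus>\<^bsub>B\<^esub> e b)"


section \<open>Existential sentences with parameters and existential closedness\<close>

text \<open>Terms and quantifier-free formulas in the signature (0, join, difference). Variables are
  natural numbers; \<open>Param\<close> is the constant naming an element of the structure.\<close>

datatype (term_params: 'a) cbs_term =
    Var nat
  | Param 'a
  | Zero
  | Join "'a cbs_term" "'a cbs_term"
  | Diff "'a cbs_term" "'a cbs_term"

datatype (form_params: 'a) qf_form =
    Eq "'a cbs_term" "'a cbs_term"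
  | Neg "'a qf_form"
  | And "'a qf_form" "'a qf_form"
  | Or "'a qf_form" "'a qf_form"

primrec term_val :: "'a cbs_sig \<Rightarrow> (nat \<Rightarrow> 'a) \<Rightarrow> 'a cbs_term \<Rightarrow> 'a" where
  "term_val M v (Var n) = v n"
| "term_val M v (Param a) = a"
| "term_val M v Zero = \<zero>\<^bsub>M\<^esub>"
| "term_val M v (Join s t) = term_val M v s \<squnion>\<^bsub>M\<^esub> term_val M v t"
| "term_val M v (Diff s t) = term_val M v s \<ominus>\<^bsub>M\<^esub> term_val M v t"

primrec qf_sat :: "'a cbs_sig \<Rightarrow> (nat \<Rightarrow> 'a) \<Rightarrow> 'a qf_form \<Rightarrow> bool" where
  "qf_sat M v (Eq s t) \<longleftrightarrow> term_val M v s = term_val M v t"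
| "qf_sat M v (Neg \<phi>) \<longleftrightarrow> \<not> qf_sat M v \<phi>"
| "qf_sat M v (And \<phi> \<psi>) \<longleftrightarrow> qf_sat M v \<phi> \<and> qf_sat M v \<psi>"
| "qf_sat M v (Or \<phi> \<psi>) \<longleftrightarrow> qf_sat M v \<phi> \<or> qf_sat M v \<psi>"

text \<open>Truth in \<open>M\<close> of the existential sentence obtained from a quantifier-free formula by
  existentially quantifying all of its (finitely many) variables; variables not occurring in the
  formula are irrelevant.\<close>

definition ex_true :: "'a cbs_sig \<Rightarrow> 'a qf_form \<Rightarrow> bool" where
  "ex_true M \<phi> \<longleftrightarrow> (\<exists>v. range v \<subseteq> carrier M \<and> qf_sat M v \<phi>)"

text \<open>Extensions of \<open>L\<close> are given by embeddings \<open>e\<close> into a structure \<open>B\<close>, the parameters of a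
  sentence being transported along \<open>e\<close>. HOL cannot quantify over types inside a formula, so the
  type \<open>'b\<close> in which the extensions live is an argument; an extension may use any subset of it as
  its carrier. If \<open>'b\<close> is infinite and at least as large as \<open>L\<close>, the notion does not depend on
  \<open>'b\<close>: the substructure of \<open>B\<close> generated by the image of \<open>L\<close> and finitely many witnesses already
  satisfies the sentence. For smaller \<open>'b\<close> it may be too weak, up to being vacuously true.\<close>

definition existentially_closed :: "'b itself \<Rightarrow> 'a cbs_sig \<Rightarrow> bool" where
  "existentially_closed (_ :: 'b itself) L \<longleftrightarrow>
     (\<forall>(B :: 'b cbs_sig) e \<phi>.
        cbs B \<longrightarrow> cbs_embedding e L B \<longrightarrow> form_params \<phi> \<subseteq> carrier L \<longrightarrow>
        ex_true B (map_qf_form e \<phi>) \<longrightarrow> ex_true L \<phi>)"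


section \<open>Join-irreducible elements and signatures\<close>

text \<open>The empty list gives the case \<open>n = 0\<close>, so that 0 is not join-irreducible.\<close>

definition join_irreducible :: "'a cbs_sig \<Rightarrow> 'a \<Rightarrow> bool" where
  "join_irreducible L g \<longleftrightarrow> g \<in> carrier L \<and>
     (\<forall>bs. set bs \<subseteq> carrier L \<longrightarrow> g \<sqsubseteq>\<^bsub>L\<^esub> foldr (join L) bs \<zero>\<^bsub>L\<^esub> \<longrightarrow> (\<exists>b\<in>set bs. g \<sqsubseteq>\<^bsub>L\<^esub> b))"

text \<open>Meaningful for \<open>g\<close> join-irreducible in a finite \<open>L\<close>.\<close>

definition predecessor :: "'a cbs_sig \<Rightarrow> 'a \<Rightarrow> 'a" where
  "predecessor L g =
     (THE p. p \<in> carrier L \<and> p \<sqsubset>\<^bsub>L\<^esub> g \<and> (\<forall>c\<in>carrier L. c \<sqsubset>\<^bsub>L\<^esub> g \<longrightarrow> c \<sqsubseteq>\<^bsub>L\<^esub> p))"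

definition signature1 :: "'a cbs_sig \<Rightarrow> 'a \<Rightarrow> 'a set \<Rightarrow> bool" where
  "signature1 L0 h G \<longleftrightarrow> h \<in> carrier L0 \<and> (\<forall>g\<in>G. join_irreducible L0 g) \<and>
     (\<forall>g\<in>G. \<forall>g'\<in>G. g \<noteq> g' \<longrightarrow> \<not> g \<sqsubseteq>\<^bsub>L0\<^esub> g') \<and> (\<forall>g\<in>G. h \<sqsubset>\<^bsub>L0\<^esub> g)"

definition signature2 :: "'a cbs_sig \<Rightarrow> 'a \<Rightarrow> 'a \<Rightarrow> 'a \<Rightarrow> bool" where
  "signature2 L0 h1 h2 g \<longleftrightarrow> h1 \<in> carrier L0 \<and> h2 \<in> carrier L0 \<and> join_irreducible L0 g \<and>
     h1 \<squnion>\<^bsub>L0\<^esub> h2 = predecessor L0 g"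


section \<open>Primitive elements and couples over a sub-CBS \<open>S\<close> of \<open>L\<close>\<close>

definition primitive1 :: "'a cbs_sig \<Rightarrow> 'a set \<Rightarrow> 'a \<Rightarrow> bool" where
  "primitive1 L S x \<longleftrightarrow> x \<in> carrier L \<and> x \<notin> S \<and>
     (\<forall>a. join_irreducible (restrict_to L S) a \<longrightarrow>
        a \<ominus>\<^bsub>L\<^esub> x \<in> S \<and> (x \<ominus>\<^bsub>L\<^esub> a = x \<or> x \<ominus>\<^bsub>L\<^esub> a = \<zero>\<^bsub>L\<^esub>))"

definition induces1 :: "'a cbs_sig \<Rightarrow> 'a set \<Rightarrow> 'a \<Rightarrow> 'a \<Rightarrow> 'a set \<Rightarrow> bool" where
  "induces1 L S x h G \<longleftrightarrow>
     (\<forall>a. join_irreducible (restrict_to L S) a \<longrightarrow>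
        (a \<sqsubset>\<^bsub>L\<^esub> x \<longleftrightarrow> a \<sqsubseteq>\<^bsub>L\<^esub> h) \<and> (x \<sqsubset>\<^bsub>L\<^esub> a \<longleftrightarrow> (\<exists>g\<in>G. g \<sqsubseteq>\<^bsub>L\<^esub> a)))"

definition primitive2 :: "'a cbs_sig \<Rightarrow> 'a set \<Rightarrow> 'a \<Rightarrow> 'a \<Rightarrow> bool" where
  "primitive2 L S x1 x2 \<longleftrightarrow> x1 \<in> carrier L \<and> x2 \<in> carrier L \<and> x1 \<notin> S \<and> x2 \<notin> S \<and> x1 \<noteq> x2 \<and>
     (\<exists>g. join_irreducible (restrict_to L S) g \<and> g \<ominus>\<^bsub>L\<^esub> x1 = x2 \<and> g \<ominus>\<^bsub>L\<^esub> x2 = x1 \<and>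
        (\<forall>a. join_irreducible (restrict_to L S) a \<and> a \<sqsubset>\<^bsub>L\<^esub> g \<longrightarrow>
           a \<ominus>\<^bsub>L\<^esub> x1 \<in> S \<and> a \<ominus>\<^bsub>L\<^esub> x2 \<in> S))"

definition induces2 :: "'a cbs_sig \<Rightarrow> 'a set \<Rightarrow> 'a \<Rightarrow> 'a \<Rightarrow> 'a \<Rightarrow> 'a \<Rightarrow> 'a \<Rightarrow> bool" where
  "induces2 L S x1 x2 h1 h2 g \<longleftrightarrow> g = x1 \<squnion>\<^bsub>L\<^esub> x2 \<and>
     (\<forall>a. join_irreducible (restrict_to L S) a \<longrightarrow>
        (a \<sqsubset>\<^bsub>L\<^esub> x1 \<longleftrightarrow> a \<sqsubseteq>\<^bsub>L\<^esub> h1) \<and> (a \<sqsubset>\<^bsub>L\<^esub> x2 \<longleftrightarrow> a \<sqsubseteq>\<^bsub>L\<^esub> h2))"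

end

theory Submission
  imports Defs
begin

text \<open>
  Both sides are equivalent to the following extension property: for a finite subalgebra \<open>S\<close> of \<open>L\<close>,
  every finite extension of \<open>S\<close> embeds into \<open>L\<close> over \<open>S\<close>.

  If \<open>L\<close> is existentially closed, the extension property follows by applying existential closedness
  to the diagram of the finite extension \<open>M\<close> in an amalgam of \<open>L\<close> and \<open>M\<close> over \<open>S\<close>. The amalgam
  consists of down-sets of pairs \<open>(c, d)\<close> in \<open>L \<times> M\<close> having the same elements of \<open>S\<close> below
  them, with \<open>a\<close> in \<open>L\<close> represented by the pairs with \<open>\<not> a \<sqsubseteq> c\<close>. Signatures are then realized by
  adding one point to, or by splitting one point of, the poset of join-irreducible elements of \<open>S\<close>.

  Conversely, a minimal element outside a subalgebra of a finite algebra yields a primitive element or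
  couple, and its signature determines the algebra generated by it; so finite extensions can be
  embedded step by step. Existential closedness follows since finitely generated algebras are finite.
\<close>

text \<open>The signature lacks meets, and this is why arbitrary elements, rather than prime ideals,
  can serve as points of the amalgam: for any fixed \<open>c\<close>, the condition that
  \<open>a\<close> is not below \<open>c\<close> turns joins into unions. What has to be secured is
  the difference. It requires that one coordinate of a point can be raised at will while the other
  follows, and this works because the finite \<open>S\<close> has a largest element below any given
  element.

  A second obstacle is size. \<open>existentially_closed\<close> tests only extensions carried by
  the type \<open>'b\<close>, whereas the amalgam consists of sets of pairs and may be too large.
  Hence only the subalgebra generated by the two images is used; it injects into \<open>'b\<close>
  because \<open>'b\<close> is infinite, \<open>L\<close> injects into it and \<open>M\<close> is
  finite.

  The two kinds of signature come from minimality: if \<open>q\<close> is minimal outside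
  \<open>S\<close>, subtracting \<open>q\<close> from an irreducible \<open>p\<close> of
  \<open>S\<close> leaves \<open>S\<close> only when \<open>q\<close> and the difference are
  complementary parts of \<open>p\<close>.\<close>

context cbs
begin

section \<open>Order, joins and differences in a co-Brouwerian semilattice\<close>

declare zero_closed [simp] join_closed [simp] diff_closed [simp] le_refl [simp]
  zero_least [simp] join_le_iff [simp] diff_le_iff [simp]

lemma eq_by_upper_bounds:
  assumes "a \<in> carrier L" "b \<in> carrier L" "\<And>c. c \<in> carrier L \<Longrightarrow> a \<sqsubseteq> c \<longleftrightarrow> b \<sqsubseteq> c"
  shows "a = b"
  using assms by (meson le_antisym le_refl)

lemma join_upper1 [simp]: "\<lbrakk>a \<in> carrier L; b \<in> carrier L\<rbrakk> \<Longrightarrow> a \<sqsubseteq> a \<squnion> b"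
  using join_le_iff[of a b "a \<squnion> b"] by simp

lemma join_upper2 [simp]: "\<lbrakk>a \<in> carrier L; b \<in> carrier L\<rbrakk> \<Longrightarrow> b \<sqsubseteq> a \<squnion> b"
  using join_le_iff[of a b "a \<squnion> b"] by simp

lemma le_joinI1: "\<lbrakk>a \<sqsubseteq> b; a \<in> carrier L; b \<in> carrier L; c \<in> carrier L\<rbrakk> \<Longrightarrow> a \<sqsubseteq> b \<squnion> c"
  by (meson join_closed join_upper1 le_trans)

lemma le_joinI2: "\<lbrakk>a \<sqsubseteq> c; a \<in> carrier L; b \<in> carrier L; c \<in> carrier L\<rbrakk> \<Longrightarrow> a \<sqsubseteq> b \<squnion> c"
  by (meson join_closed join_upper2 le_trans)

lemma join_assoc: "\<lbrakk>a \<in> carrier L; b \<in> carrier L; c \<in> carrier L\<rbrakk> \<Longrightarrow> a \<squnion> b \<squnion> c = a \<squnion> (b \<squnion> c)"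
  by (rule eq_by_upper_bounds) auto

lemma join_comm: "\<lbrakk>a \<in> carrier L; b \<in> carrier L\<rbrakk> \<Longrightarrow> a \<squnion> b = b \<squnion> a"
  by (rule eq_by_upper_bounds) auto

lemma join_left_comm: "\<lbrakk>a \<in> carrier L; b \<in> carrier L; c \<in> carrier L\<rbrakk> \<Longrightarrow> a \<squnion> (b \<squnion> c) = b \<squnion> (a \<squnion> c)"
  by (rule eq_by_upper_bounds) auto

lemma join_idem [simp]: "a \<in> carrier L \<Longrightarrow> a \<squnion> a = a"
  by (rule eq_by_upper_bounds) auto

lemma join_zero [simp]: "a \<in> carrier L \<Longrightarrow> a \<squnion> \<zero> = a" "a \<in> carrier L \<Longrightarrow> \<zero> \<squnion> a = a"
  by (rule eq_by_upper_bounds; auto)+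

lemma join_absorb: "\<lbrakk>a \<sqsubseteq> b; a \<in> carrier L; b \<in> carrier L\<rbrakk> \<Longrightarrow> a \<squnion> b = b"
  "\<lbrakk>a \<sqsubseteq> b; a \<in> carrier L; b \<in> carrier L\<rbrakk> \<Longrightarrow> b \<squnion> a = b"
  by (rule le_antisym; simp)+

lemma le_zero_iff [simp]: "a \<in> carrier L \<Longrightarrow> a \<sqsubseteq> \<zero> \<longleftrightarrow> a = \<zero>"
  by (auto intro: le_antisym)

lemma diff_eq_zero_iff [simp]: "\<lbrakk>a \<in> carrier L; b \<in> carrier L\<rbrakk> \<Longrightarrow> a \<ominus> b = \<zero> \<longleftrightarrow> a \<sqsubseteq> b"
  using diff_le_iff[of a b \<zero>] by (simp del: diff_le_iff)

lemma diff_le [simp]: "\<lbrakk>a \<in> carrier L; b \<in> carrier L\<rbrakk> \<Longrightarrow> a \<ominus> b \<sqsubseteq> a"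
  by simp

lemma le_join_diff: "\<lbrakk>a \<in> carrier L; b \<in> carrier L\<rbrakk> \<Longrightarrow> a \<sqsubseteq> b \<squnion> (a \<ominus> b)"
  using diff_le_iff[of a b "a \<ominus> b"] by simp

lemma diff_zero [simp]: "a \<in> carrier L \<Longrightarrow> a \<ominus> \<zero> = a" "a \<in> carrier L \<Longrightarrow> \<zero> \<ominus> a = \<zero>"
  by (rule eq_by_upper_bounds; auto)+

lemma diff_self [simp]: "a \<in> carrier L \<Longrightarrow> a \<ominus> a = \<zero>"
  by simp

lemma join_diff_distrib:
  "\<lbrakk>a \<in> carrier L; b \<in> carrier L; c \<in> carrier L\<rbrakk> \<Longrightarrow> (a \<squnion> b) \<ominus> c = (a \<ominus> c) \<squnion> (b \<ominus> c)"
  by (rule eq_by_upper_bounds) auto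

lemma diff_join:
  "\<lbrakk>a \<in> carrier L; b \<in> carrier L; c \<in> carrier L\<rbrakk> \<Longrightarrow> a \<ominus> (b \<squnion> c) = a \<ominus> b \<ominus> c"
  by (rule eq_by_upper_bounds) (auto simp: join_assoc)

lemma diff_diff_comm:
  "\<lbrakk>a \<in> carrier L; b \<in> carrier L; c \<in> carrier L\<rbrakk> \<Longrightarrow> a \<ominus> b \<ominus> c = a \<ominus> c \<ominus> b"
  by (rule eq_by_upper_bounds) (auto simp: join_left_comm)

lemma diff_mono:
  assumes "a \<sqsubseteq> b" "a \<in> carrier L" "b \<in> carrier L" "c \<in> carrier L"
  shows "a \<ominus> c \<sqsubseteq> b \<ominus> c"
proof -
  have "a \<sqsubseteq> c \<squnion> (b \<ominus> c)"
    by (rule le_trans[of _ b]) (simp_all add: assms le_join_diff)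
  then show ?thesis using assms by simp
qed

lemma diff_antimono:
  assumes "b \<sqsubseteq> c" "a \<in> carrier L" "b \<in> carrier L" "c \<in> carrier L"
  shows "a \<ominus> c \<sqsubseteq> a \<ominus> b"
proof -
  have "b \<sqsubseteq> c \<squnion> (a \<ominus> b)"
    by (rule le_joinI1) (simp_all add: assms)
  moreover have "a \<ominus> b \<sqsubseteq> c \<squnion> (a \<ominus> b)"
    by (rule join_upper2) (simp_all add: assms)
  ultimately have "b \<squnion> (a \<ominus> b) \<sqsubseteq> c \<squnion> (a \<ominus> b)"
    using assms by (subst join_le_iff) auto
  then have "a \<sqsubseteq> c \<squnion> (a \<ominus> b)"
    by (rule le_trans[rotated 4]) (simp_all add: assms le_join_diff)
  then show ?thesis using assms by simp
qed

text \<open>Residuated form of the triangle inequality: \<open>b\<close> is below \<open>a\<close>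
  joined with \<open>b \<ominus> a\<close>, and \<open>a\<close> is below \<open>c\<close> joined
  with \<open>a \<ominus> c\<close>. It serves to compute with congruence modulo an ideal.\<close>

lemma diff_triangle:
  assumes "a \<in> carrier L" "b \<in> carrier L" "c \<in> carrier L"
  shows "(b \<ominus> c) \<ominus> (a \<ominus> c) \<sqsubseteq> b \<ominus> a"
proof -
  have "a \<sqsubseteq> c \<squnion> (a \<ominus> c) \<squnion> (b \<ominus> a)" "b \<ominus> a \<sqsubseteq> c \<squnion> (a \<ominus> c) \<squnion> (b \<ominus> a)"
    by (rule le_joinI1 join_upper2; simp add: assms le_join_diff)+
  then have "a \<squnion> (b \<ominus> a) \<sqsubseteq> c \<squnion> (a \<ominus> c) \<squnion> (b \<ominus> a)"
    using assms by (subst join_le_iff) auto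
  then have "b \<sqsubseteq> c \<squnion> (a \<ominus> c) \<squnion> (b \<ominus> a)"
    by (rule le_trans[rotated 4]) (simp_all add: assms le_join_diff)
  then show ?thesis using assms by (simp add: join_assoc)
qed

lemma diff_diff_same: "\<lbrakk>a \<in> carrier L; b \<in> carrier L\<rbrakk> \<Longrightarrow> a \<ominus> b \<ominus> b = a \<ominus> b"
  by (simp add: diff_join[symmetric])

section \<open>Join-irreducible elements and subalgebras\<close>

lemma join_irreducible_iff:
  "join_irreducible L g \<longleftrightarrow> g \<in> carrier L \<and> g \<noteq> \<zero> \<and>
     (\<forall>a\<in>carrier L. \<forall>b\<in>carrier L. g \<sqsubseteq> a \<squnion> b \<longrightarrow> g \<sqsubseteq> a \<or> g \<sqsubseteq> b)"
  (is "_ \<longleftrightarrow> ?R")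
proof
  assume g: "join_irreducible L g"
  then have gc: "g \<in> carrier L" by (simp add: join_irreducible_def)
  have *: "\<exists>b\<in>set bs. g \<sqsubseteq> b" if "set bs \<subseteq> carrier L" "g \<sqsubseteq> foldr (join L) bs \<zero>" for bs
    using g that by (simp add: join_irreducible_def)
  have "g \<noteq> \<zero>" using *[of "[]"] gc by auto
  moreover have "g \<sqsubseteq> a \<or> g \<sqsubseteq> b" if "a \<in> carrier L" "b \<in> carrier L" "g \<sqsubseteq> a \<squnion> b" for a b
    using *[of "[a, b]"] that by auto
  ultimately show ?R using gc by blast
next
  assume R: ?R
  have fold_closed: "set bs \<subseteq> carrier L \<Longrightarrow> foldr (join L) bs \<zero> \<in> carrier L" for bs
    by (induction bs) auto
  have "\<exists>b\<in>set bs. g \<sqsubseteq> b" if "set bs \<subseteq> carrier L" "g \<sqsubseteq> foldr (join L) bs \<zero>" for bs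
    using that
  proof (induction bs)
    case (Cons a bs)
    then have "g \<sqsubseteq> a \<or> g \<sqsubseteq> foldr (join L) bs \<zero>"
      using R fold_closed[of bs] by auto
    then show ?case using Cons by auto
  qed (use R in auto)
  then show "join_irreducible L g" using R by (simp add: join_irreducible_def)
qed

lemma join_irreducible_closed: "join_irreducible L g \<Longrightarrow> g \<in> carrier L"
  by (simp add: join_irreducible_iff)

lemma join_irreducible_nonzero: "join_irreducible L g \<Longrightarrow> g \<noteq> \<zero>"
  by (simp add: join_irreducible_iff)

lemma join_irreducible_le_join:
  "\<lbrakk>join_irreducible L g; a \<in> carrier L; b \<in> carrier L\<rbrakk> \<Longrightarrow> g \<sqsubseteq> a \<squnion> b \<longleftrightarrow> g \<sqsubseteq> a \<or> g \<sqsubseteq> b"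
  by (meson join_irreducible_iff le_joinI1 le_joinI2)

text \<open>Since \<open>g\<close> is below \<open>a\<close> joined with
  \<open>g \<ominus> a\<close>, it must lie below the second part. So subtraction from a
  join-irreducible element leaves all of it or nothing, a dichotomy used throughout.\<close>

lemma join_irreducible_diff:
  assumes "join_irreducible L g" "a \<in> carrier L" "\<not> g \<sqsubseteq> a"
  shows "g \<ominus> a = g"
proof (rule le_antisym)
  show "g \<sqsubseteq> g \<ominus> a"
    using join_irreducible_le_join[OF assms(1,2), of "g \<ominus> a"] assms
      le_join_diff join_irreducible_closed by auto
qed (use assms join_irreducible_closed in auto)

lemma restrict_cbs:
  assumes "sub_cbs S L" shows "cbs (restrict_to L S)"
proof -
  have sub: "a \<in> S \<Longrightarrow> a \<in> carrier L" for a
    using assms by (auto simp: sub_cbs_def)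
  show ?thesis
    by unfold_locales
      (use assms in \<open>simp_all add: sub_cbs_def sub le_antisym, blast intro: sub le_trans\<close>)
qed

lemma sub_carrier: "sub_cbs (carrier L) L"
  by (simp add: sub_cbs_def)

end

lemma sub_cbsD:
  assumes "sub_cbs S L"
  shows "S \<subseteq> carrier L" "\<zero>\<^bsub>L\<^esub> \<in> S"
    "\<And>a b. \<lbrakk>a \<in> S; b \<in> S\<rbrakk> \<Longrightarrow> a \<squnion>\<^bsub>L\<^esub> b \<in> S" "\<And>a b. \<lbrakk>a \<in> S; b \<in> S\<rbrakk> \<Longrightarrow> a \<ominus>\<^bsub>L\<^esub> b \<in> S"
  using assms by (auto simp: sub_cbs_def)

subsection \<open>Finite co-Brouwerian semilattices\<close>

lemma finite_minimal:
  fixes L (structure)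
  assumes "cbs L" "finite A" "A \<subseteq> carrier L" "A \<noteq> {}"
  obtains m where "m \<in> A" "\<And>x. x \<in> A \<Longrightarrow> x \<sqsubseteq> m \<Longrightarrow> x = m"
proof -
  interpret cbs L by fact
  have "\<exists>m\<in>A. \<forall>x\<in>A. x \<noteq> m \<longrightarrow> \<not> x \<sqsubset> m"
  proof (rule Finite_Set.bex_min_element[OF assms(2) _ _ assms(4)])
    show "asymp_on A (less L)"
      unfolding less_def using assms(3) le_antisym by (intro asymp_onI) blast
    show "transp_on A (less L)"
      unfolding less_def using assms(3) le_antisym le_trans by (intro transp_onI) (meson subsetD)
  qed
  then show ?thesis using that by (auto simp: less_def)
qed

context cbs
begin

text \<open>Take \<open>p\<close> minimal among the elements below \<open>b\<close> but not below
  \<open>c\<close>; everything strictly below \<open>p\<close> is then below \<open>c\<close>. If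
  \<open>p \<sqsubseteq> a1 \<squnion> a2\<close> and \<open>p \<ominus> a1\<close> is smaller than
  \<open>p\<close>, the complementary part \<open>p \<ominus> (p \<ominus> a1)\<close> cannot be
  below \<open>c\<close>, hence is all of \<open>p\<close>, and it lies below
  \<open>a1\<close>.\<close>

lemma join_irreducible_below:
  assumes fin: "finite (carrier L)" and b: "b \<in> carrier L" and c: "c \<in> carrier L"
    and "\<not> b \<sqsubseteq> c"
  obtains p where "join_irreducible L p" "p \<sqsubseteq> b" "\<not> p \<sqsubseteq> c"
proof -
  let ?A = "{p \<in> carrier L. p \<sqsubseteq> b \<and> \<not> p \<sqsubseteq> c}"
  obtain p where p: "p \<in> ?A" and min: "\<And>x. x \<in> ?A \<Longrightarrow> x \<sqsubseteq> p \<Longrightarrow> x = p"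
  proof (rule finite_minimal[OF cbs_axioms, of ?A])
    show "?A \<noteq> {}" using assms le_refl by blast
  qed (use fin in auto)
  have pc: "p \<in> carrier L" using p by simp
  have below: "u \<sqsubseteq> c \<or> u = p" if "u \<in> carrier L" "u \<sqsubseteq> p" for u
    using min[of u] that le_trans[of u p b] p b by auto
  have "p \<sqsubseteq> a1 \<or> p \<sqsubseteq> a2" if a: "a1 \<in> carrier L" "a2 \<in> carrier L" "p \<sqsubseteq> a1 \<squnion> a2" for a1 a2
  proof -
    consider "p \<ominus> a1 = p" | "p \<ominus> a1 \<sqsubseteq> c"
      using below[of "p \<ominus> a1"] a pc by auto
    then show ?thesis
    proof cases
      case 1
      then show ?thesis using a pc diff_le_iff[of p a1 a2] by simp
    next
      case 2
      have "\<not> p \<ominus> (p \<ominus> a1) \<sqsubseteq> c"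
      proof
        assume "p \<ominus> (p \<ominus> a1) \<sqsubseteq> c"
        then have "(p \<ominus> a1) \<squnion> (p \<ominus> (p \<ominus> a1)) \<sqsubseteq> c"
          using 2 pc a c by (subst join_le_iff) auto
        then have "p \<sqsubseteq> c"
          by (rule le_trans[rotated 4]) (use pc a c le_join_diff[of p "p \<ominus> a1"] in auto)
        then show False using p by simp
      qed
      then have "p \<ominus> (p \<ominus> a1) = p"
        using below[of "p \<ominus> (p \<ominus> a1)"] pc a by auto
      moreover have "p \<ominus> (p \<ominus> a1) \<sqsubseteq> a1"
        using pc a le_join_diff[of p a1] by (simp add: join_comm)
      ultimately show ?thesis by simp
    qed
  qed
  then have "join_irreducible L p"
    using p c by (auto simp: join_irreducible_iff)
  then show ?thesis using that p by auto
qed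

text \<open>Joining the members of \<open>A\<close> one at a time stays inside \<open>A\<close>.
  This supplies predecessors, the largest element of a subalgebra below a given element, and
  decompositions into join-irreducible elements.\<close>

lemma finite_greatest:
  assumes "finite A" "A \<subseteq> carrier L" "\<zero> \<in> A"
    and closed: "\<And>a b. \<lbrakk>a \<in> A; b \<in> A\<rbrakk> \<Longrightarrow> a \<squnion> b \<in> A"
  obtains m where "m \<in> A" "\<And>a. a \<in> A \<Longrightarrow> a \<sqsubseteq> m"
proof -
  have "\<exists>m\<in>A. \<forall>a\<in>F. a \<sqsubseteq> m" if "finite F" "F \<subseteq> A" for F
    using that
  proof induction
    case (insert x F)
    then obtain m where m: "m \<in> A" "\<forall>a\<in>F. a \<sqsubseteq> m" by auto
    have "a \<sqsubseteq> x \<squnion> m" if "a \<in> insert x F" for a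
    proof -
      have "x \<in> carrier L" "m \<in> carrier L" "a \<in> carrier L"
        using that m insert.prems assms(2) by blast+
      then show ?thesis using that m le_joinI2 by auto
    qed
    then show ?case using closed[of x m] m insert.prems by blast
  qed (use assms in auto)
  from this[of A] that show ?thesis using assms by auto
qed

text \<open>Join-irreducibility closes the set of elements strictly below \<open>g\<close> under
  joins, and \<open>g \<noteq> \<zero>\<close> puts zero into it; so the definite description
  denotes its largest element.\<close>

lemma predecessor_greatest:
  assumes fin: "finite (carrier L)" and g: "join_irreducible L g"
  shows "predecessor L g \<in> carrier L" "predecessor L g \<sqsubset> g"
    "\<And>c. \<lbrakk>c \<in> carrier L; c \<sqsubset> g\<rbrakk> \<Longrightarrow> c \<sqsubseteq> predecessor L g"
proof -
  have gc: "g \<in> carrier L" "g \<noteq> \<zero>"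
    using g by (auto simp: join_irreducible_iff)
  let ?A = "{c \<in> carrier L. c \<sqsubset> g}"
  have "a \<squnion> b \<in> ?A" if "a \<in> ?A" "b \<in> ?A" for a b
    using join_irreducible_le_join[OF g, of a b] that gc le_antisym[of g]
    unfolding less_def by (metis (mono_tags, lifting) join_closed join_le_iff le_refl mem_Collect_eq)
  then obtain m where "m \<in> ?A" "\<And>c. c \<in> ?A \<Longrightarrow> c \<sqsubseteq> m"
    using finite_greatest[of ?A] fin gc by (auto simp: less_def)
  then have m: "m \<in> carrier L" "m \<sqsubset> g" "\<And>c. \<lbrakk>c \<in> carrier L; c \<sqsubset> g\<rbrakk> \<Longrightarrow> c \<sqsubseteq> m"
    by auto
  have "predecessor L g = m"
    unfolding predecessor_def by (rule the_equality) (use m in \<open>auto intro: le_antisym\<close>)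
  then show "predecessor L g \<in> carrier L" "predecessor L g \<sqsubset> g"
    "\<And>c. \<lbrakk>c \<in> carrier L; c \<sqsubset> g\<rbrakk> \<Longrightarrow> c \<sqsubseteq> predecessor L g"
    using m by auto
qed

end

subsection \<open>Local finiteness\<close>

inductive_set span :: "'a cbs_sig \<Rightarrow> 'a set \<Rightarrow> 'a set" for L A where
  span_zero: "\<zero>\<^bsub>L\<^esub> \<in> span L A"
| span_base: "a \<in> A \<Longrightarrow> a \<in> span L A"
| span_join: "\<lbrakk>a \<in> span L A; b \<in> span L A\<rbrakk> \<Longrightarrow> a \<squnion>\<^bsub>L\<^esub> b \<in> span L A"
| span_diff: "\<lbrakk>a \<in> span L A; b \<in> span L A\<rbrakk> \<Longrightarrow> a \<ominus>\<^bsub>L\<^esub> b \<in> span L A"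

lemma span_restrict: "span (restrict_to L S) A = span L A"
proof -
  have "x \<in> span L A" if "x \<in> span (restrict_to L S) A" for x
    using that by induction (auto intro: span.intros)
  moreover have "x \<in> span (restrict_to L S) A" if "x \<in> span L A" for x
    using that
    by induction
      (use span_zero[of "restrict_to L S" A] span_base[of _ A "restrict_to L S"]
        span_join[of _ "restrict_to L S" A] span_diff[of _ "restrict_to L S" A] in auto)
  ultimately show ?thesis by blast
qed

context cbs
begin

lemma span_sub:
  assumes "A \<subseteq> carrier L" shows "sub_cbs (span L A) L"
proof -
  have "x \<in> carrier L" if "x \<in> span L A" for x
    using that by induction (use assms in auto)
  then show ?thesis by (auto simp: sub_cbs_def intro: span.intros)
qed

section \<open>Ideals maximal without a given element\<close>

definition ideal :: "'a set \<Rightarrow> bool" where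
  "ideal I \<longleftrightarrow> I \<subseteq> carrier L \<and> \<zero> \<in> I \<and> (\<forall>a\<in>I. \<forall>b\<in>I. a \<squnion> b \<in> I) \<and>
     (\<forall>a\<in>I. \<forall>b\<in>carrier L. b \<sqsubseteq> a \<longrightarrow> b \<in> I)"

text \<open>\<open>I\<close> is maximal among the ideals omitting \<open>a\<close>: the last clause
  says that \<open>a\<close> belongs to the ideal generated by \<open>I\<close> and any
  \<open>c\<close> outside \<open>I\<close>. The ideals admitting such an \<open>a\<close> are the
  completely meet-irreducible ones.\<close>

definition critical :: "'a set \<Rightarrow> 'a \<Rightarrow> bool" where
  "critical I a \<longleftrightarrow> ideal I \<and> a \<in> carrier L \<and> a \<notin> I \<and> (\<forall>c\<in>carrier L. c \<notin> I \<longrightarrow> a \<ominus> c \<in> I)"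

definition irreducible_ideals :: "'a set set" where
  "irreducible_ideals = {I. \<exists>a. critical I a}"

lemma ideal_join: "\<lbrakk>ideal I; a \<in> I; b \<in> I\<rbrakk> \<Longrightarrow> a \<squnion> b \<in> I"
  by (simp add: ideal_def)

lemma ideal_down: "\<lbrakk>ideal I; a \<in> I; b \<in> carrier L; b \<sqsubseteq> a\<rbrakk> \<Longrightarrow> b \<in> I"
  unfolding ideal_def by blast

lemma ideal_closed: "\<lbrakk>ideal I; a \<in> I\<rbrakk> \<Longrightarrow> a \<in> carrier L"
  by (auto simp: ideal_def)

lemma ideal_join_iff:
  "\<lbrakk>ideal I; a \<in> carrier L; b \<in> carrier L\<rbrakk> \<Longrightarrow> a \<squnion> b \<in> I \<longleftrightarrow> a \<in> I \<and> b \<in> I"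
  using ideal_join[of I a b] ideal_down[of I "a \<squnion> b" a] ideal_down[of I "a \<squnion> b" b]
    join_upper1 join_upper2 by blast

lemma ideal_of_diff:
  assumes "ideal I" "a \<ominus> b \<in> I" "b \<in> I" "a \<in> carrier L"
  shows "a \<in> I"
  using assms ideal_down[OF assms(1) ideal_join[OF assms(1,3,2)]] le_join_diff ideal_closed by blast

lemma ideal_diff: "\<lbrakk>ideal I; a \<in> I; b \<in> carrier L\<rbrakk> \<Longrightarrow> a \<ominus> b \<in> I"
  using ideal_down[of I a "a \<ominus> b"] ideal_closed[of I a] by simp

text \<open>This is the ideal generated by \<open>I\<close> and \<open>c\<close>, since
  \<open>d \<ominus> c \<in> I\<close> means that \<open>d\<close> lies below the join of
  \<open>c\<close> with a member of \<open>I\<close>.\<close>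

lemma ideal_adjoin:
  assumes "ideal I" "c \<in> carrier L"
  shows "ideal {d \<in> carrier L. d \<ominus> c \<in> I}"
proof -
  have "\<zero> \<in> I" using assms by (simp add: ideal_def)
  moreover have "b \<ominus> c \<in> I" if "a \<in> carrier L" "a \<ominus> c \<in> I" "b \<in> carrier L" "b \<sqsubseteq> a" for a b
    using that assms diff_mono[of b a c] by (blast intro: ideal_down diff_closed)
  ultimately show ?thesis
    using assms unfolding ideal_def by (auto simp: join_diff_distrib)
qed

lemma ideal_below: "b \<in> carrier L \<Longrightarrow> ideal {c \<in> carrier L. c \<sqsubseteq> b}"
  by (auto simp: ideal_def intro: le_trans[of _ _ b])

text \<open>Zorn's lemma gives an ideal \<open>J\<close> maximal among those containing
  \<open>I\<close> and omitting \<open>a\<close>. If \<open>a \<ominus> c\<close> were outside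
  \<open>J\<close>, adjoining \<open>c\<close> would give a larger ideal still omitting
  \<open>a\<close>.\<close>

lemma ex_critical:
  assumes "ideal I" "a \<in> carrier L" "a \<notin> I"
  obtains J where "I \<subseteq> J" "critical J a"
proof -
  define A where "A = {J. ideal J \<and> I \<subseteq> J \<and> a \<notin> J}"
  have "\<Union>C \<in> A" if C: "C \<noteq> {}" "subset.chain A C" for C
  proof -
    have CA: "\<And>J. J \<in> C \<Longrightarrow> J \<in> A" and lin: "\<And>J K. J \<in> C \<Longrightarrow> K \<in> C \<Longrightarrow> J \<subseteq> K \<or> K \<subseteq> J"
      using C by (auto simp: subset_chain_def)
    have "b \<squnion> c \<in> \<Union>C" if "b \<in> J" "J \<in> C" "c \<in> K" "K \<in> C" for b c J K
      using lin[OF that(2,4)] that CA ideal_join unfolding A_def by blast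
    moreover have "\<zero> \<in> \<Union>C"
      using CA C(1) by (auto simp: A_def ideal_def)
    moreover have "\<Union>C \<subseteq> carrier L"
      using CA ideal_closed unfolding A_def by blast
    moreover have "c \<in> \<Union>C" if "b \<in> \<Union>C" "c \<in> carrier L" "c \<sqsubseteq> b" for b c
      using that CA ideal_down unfolding A_def by blast
    ultimately have "ideal (\<Union>C)"
      unfolding ideal_def by (metis UnionE)
    then show ?thesis using CA C(1) by (auto simp: A_def)
  qed
  moreover have "A \<noteq> {}" using assms by (auto simp: A_def)
  ultimately have "\<exists>J\<in>A. \<forall>K\<in>A. J \<subseteq> K \<longrightarrow> K = J"
    by (intro subset_Zorn_nonempty)
  then obtain J where J: "J \<in> A" and max: "\<And>K. K \<in> A \<Longrightarrow> J \<subseteq> K \<Longrightarrow> K = J"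
    by blast
  have idl: "ideal J" and IJ: "I \<subseteq> J" and aJ: "a \<notin> J"
    using J by (auto simp: A_def)
  have "a \<ominus> c \<in> J" if c: "c \<in> carrier L" "c \<notin> J" for c
  proof (rule ccontr)
    define K where "K = {d \<in> carrier L. d \<ominus> c \<in> J}"
    assume "a \<ominus> c \<notin> J"
    then have "a \<notin> K" by (simp add: K_def)
    moreover have JK: "J \<subseteq> K"
      unfolding K_def using idl c(1) ideal_diff ideal_closed by blast
    moreover have "ideal K" using idl c ideal_adjoin by (simp add: K_def)
    ultimately have "K \<in> A" using IJ by (auto simp: A_def)
    then have "K = J" using max JK by blast
    moreover have "c \<in> K" using c idl by (auto simp: K_def ideal_def)
    ultimately show False using c by simp
  qed
  then have "critical J a" using idl aJ assms by (simp add: critical_def)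
  then show ?thesis using that IJ by blast
qed

text \<open>Modulo \<open>I\<close>, the element \<open>a\<close> is the least nonzero one, and such
  an element is neither a join nor a difference of elements not congruent to it. So if no generator
  were congruent to \<open>a\<close>, no element of the span would be, not even \<open>a\<close>.
  Being critical passes to congruent elements.\<close>

lemma critical_generator:
  assumes gen: "carrier L = span L A" and I: "critical I a"
  obtains g where "g \<in> A" "critical I g"
proof -
  have idl: "ideal I" and a: "a \<in> carrier L" "a \<notin> I"
    and crit: "\<And>c. c \<in> carrier L \<Longrightarrow> c \<notin> I \<Longrightarrow> a \<ominus> c \<in> I"
    using I by (auto simp: critical_def)
  have "\<exists>g\<in>A. a \<ominus> g \<in> I \<and> g \<ominus> a \<in> I"
  proof (rule ccontr)
    assume none: "\<not> ?thesis"
    have "\<not> (a \<ominus> b \<in> I \<and> b \<ominus> a \<in> I)" if "b \<in> span L A" for b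
      using that
    proof induction
      case span_zero
      then show ?case using a by simp
    next
      case (span_join b c)
      then have bc: "b \<in> carrier L" "c \<in> carrier L" using gen by auto
      show ?case
      proof
        assume H: "a \<ominus> (b \<squnion> c) \<in> I \<and> (b \<squnion> c) \<ominus> a \<in> I"
        then have "b \<ominus> a \<in> I" "c \<ominus> a \<in> I"
          using bc a idl by (auto simp: join_diff_distrib ideal_join_iff)
        then have "b \<in> I" "c \<in> I" using span_join crit bc by blast+
        then have "b \<squnion> c \<in> I" using idl ideal_join by blast
        then show False using H ideal_of_diff[OF idl, of a "b \<squnion> c"] a by blast
      qed
    next
      case (span_diff b c)
      then have bc: "b \<in> carrier L" "c \<in> carrier L" using gen by auto
      show ?case
      proof
        assume H: "a \<ominus> (b \<ominus> c) \<in> I \<and> (b \<ominus> c) \<ominus> a \<in> I"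
        have nI: "b \<ominus> c \<notin> I"
          using H ideal_of_diff[OF idl, of a "b \<ominus> c"] a by blast
        \<comment> \<open>If \<open>c\<close> is in \<open>I\<close>, the difference is congruent to
          \<open>b\<close>. Otherwise \<open>a\<close>, and with it \<open>b \<ominus> c\<close>,
          lies below \<open>c\<close> modulo \<open>I\<close>; as subtracting \<open>c\<close> a
          second time has no effect, \<open>b \<ominus> c\<close> is then in
          \<open>I\<close>.\<close>
        show False
        proof (cases "c \<in> I")
          case True
          have "b \<ominus> a \<ominus> c \<in> I"
            using H bc a by (simp add: diff_diff_comm)
          then have "b \<ominus> a \<in> I" using True ideal_of_diff[OF idl, of "b \<ominus> a" c] bc a by simp
          moreover have "b \<notin> I" using nI ideal_diff idl bc by blast
          ultimately show False using span_diff crit bc by blast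
        next
          case False
          have "(b \<ominus> c) \<ominus> (a \<ominus> c) \<sqsubseteq> (b \<ominus> c) \<ominus> a"
            using diff_triangle[of a "b \<ominus> c" c] bc a by (simp add: diff_diff_same)
          then have "(b \<ominus> c) \<ominus> (a \<ominus> c) \<in> I"
            using ideal_down[OF idl, of "(b \<ominus> c) \<ominus> a"] H bc a by (simp del: diff_le_iff)
          then show False
            using ideal_of_diff[OF idl, of "b \<ominus> c" "a \<ominus> c"] crit[OF bc(2) False] nI bc by simp
        qed
      qed
    qed (use none in blast)
    moreover have "\<zero> \<in> I" using idl by (simp add: ideal_def)
    ultimately show False using a gen diff_self by metis
  qed
  then obtain g where g: "g \<in> A" "a \<ominus> g \<in> I" "g \<ominus> a \<in> I" by blast
  then have gc: "g \<in> carrier L" using gen by (simp add: span_base)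
  have "g \<ominus> c \<in> I" if c: "c \<in> carrier L" "c \<notin> I" for c
  proof -
    have "(g \<ominus> c) \<ominus> (a \<ominus> c) \<in> I"
      using diff_triangle[of a g c] ideal_down[OF idl g(3)] a c gc by (simp del: diff_le_iff)
    then show ?thesis
      using ideal_of_diff[OF idl, of "g \<ominus> c" "a \<ominus> c"] crit[OF c] c gc by simp
  qed
  moreover have "g \<notin> I" using g(2) a ideal_of_diff[OF idl, of a g] by blast
  ultimately show ?thesis using that[of g] g gc idl by (auto simp: critical_def)
qed

lemma irreducible_ideal: "I \<in> irreducible_ideals \<Longrightarrow> ideal I"
  by (auto simp: irreducible_ideals_def critical_def)

text \<open>The difference lies in \<open>I\<close> iff every ideal above \<open>I\<close>
  containing \<open>c\<close> contains \<open>b\<close>, and by \<open>ex_critical\<close>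
  irreducible ideals suffice for the test. The ideal \<open>I\<close> is listed apart from those
  strictly above it to allow a recursion on \<open>b\<close> and \<open>c\<close>.\<close>

lemma diff_mem_ideal_iff:
  assumes "ideal I" "b \<in> carrier L" "c \<in> carrier L"
  shows "b \<ominus> c \<in> I \<longleftrightarrow> (c \<in> I \<longrightarrow> b \<in> I) \<and> (\<forall>J\<in>irreducible_ideals. I \<subset> J \<longrightarrow> c \<in> J \<longrightarrow> b \<in> J)"
    (is "_ \<longleftrightarrow> ?R")
proof
  assume "b \<ominus> c \<in> I"
  then have "b \<in> J" if "ideal J" "I \<subseteq> J" "c \<in> J" for J
    using ideal_of_diff[of J b c] assms that by blast
  then show ?R
    using assms(1) irreducible_ideal by blast
next
  assume R: ?R
  show "b \<ominus> c \<in> I"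
  proof (rule ccontr)
    let ?K = "{d \<in> carrier L. d \<ominus> c \<in> I}"
    assume "b \<ominus> c \<notin> I"
    then obtain J where J: "?K \<subseteq> J" "critical J b"
      using ex_critical[OF ideal_adjoin[OF assms(1,3)], of b] assms by auto
    moreover have "c \<in> ?K" using assms by (auto simp: ideal_def)
    moreover have "I \<subseteq> ?K" using assms ideal_diff ideal_closed by blast
    moreover have "J \<in> irreducible_ideals" "b \<notin> J"
      using J by (auto simp: irreducible_ideals_def critical_def)
    ultimately show False
      using R by blast
  qed
qed

text \<open>\<open>diff_mem_ideal_iff\<close> computes membership of a difference from that of its
  arguments in \<open>I\<close> and in the ideals strictly above, so membership is settled by
  recursion on terms over the generators.\<close>

lemma irreducible_ideal_determined:
  assumes gen: "carrier L = span L A" and "ideal I" "ideal I'" and "A \<inter> I = A \<inter> I'"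
    and above: "{J \<in> irreducible_ideals. I \<subset> J} = {J \<in> irreducible_ideals. I' \<subset> J}"
  shows "I = I'"
proof -
  have above': "J \<in> irreducible_ideals \<Longrightarrow> I \<subset> J \<longleftrightarrow> I' \<subset> J" for J
    using above by blast
  have "b \<in> I \<longleftrightarrow> b \<in> I'" if "b \<in> span L A" for b
    using that
  proof induction
    case (span_diff b c)
    then have bc: "b \<in> carrier L" "c \<in> carrier L" using gen by auto
    show ?case
      unfolding diff_mem_ideal_iff[OF assms(2) bc] diff_mem_ideal_iff[OF assms(3) bc]
      using span_diff.IH above' by (intro arg_cong2[where f = conj] ball_cong) auto
  next
    case (span_join b c)
    then show ?case using assms(2,3) ideal_join_iff[of _ b c] gen by simp
  qed (use assms in \<open>auto simp: ideal_def\<close>)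
  then show ?thesis using gen assms(2,3) by (auto simp: ideal_def)
qed

text \<open>Diego's theorem. The height of an irreducible ideal is bounded by the number of generators,
  since a critical generator is gained in each step upwards.\<close>

lemma finite_of_span:
  assumes gen: "carrier L = span L A" and A: "finite A"
  shows "finite (carrier L)"
proof -
  let ?X = "\<lambda>k. {I \<in> irreducible_ideals. card (A - I) < k}"
  have fin: "finite (?X k)" for k
  proof (induction k)
    case (Suc k)
    \<comment> \<open>An ideal is coded by the generators it contains and the irreducible ideals
      strictly above it. The latter omit fewer generators, so by the induction hypothesis only
      finitely many codes are available.\<close>
    let ?f = "\<lambda>I. (A \<inter> I, {J \<in> irreducible_ideals. I \<subset> J})"
    have "J \<in> ?X k" if IJ: "I \<in> ?X (Suc k)" "J \<in> irreducible_ideals" "I \<subset> J" for I J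
    proof -
      obtain a where "critical I a" using IJ unfolding irreducible_ideals_def by blast
      then obtain g where g: "g \<in> A" "critical I g"
        using critical_generator[OF gen] by blast
      obtain c where c: "c \<in> J" "c \<notin> I" using IJ by blast
      have J: "ideal J" using that irreducible_ideal by blast
      have gc: "g \<in> carrier L" "g \<notin> I" using g by (auto simp: critical_def)
      have "g \<ominus> c \<in> I" using g c ideal_closed[OF J] by (auto simp: critical_def)
      then have "g \<in> J" using c that gc ideal_of_diff[OF J, of g c] by blast
      then have "A - J \<subset> A - I" using g(1) gc that by blast
      then have "card (A - J) < card (A - I)" using A by (simp add: psubset_card_mono)
      then show ?thesis using that by auto
    qed
    then have "?f ` ?X (Suc k) \<subseteq> Pow A \<times> Pow (?X k)" by blast
    moreover have "finite (Pow A \<times> Pow (?X k))" using Suc A by simp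
    moreover have "inj_on ?f (?X (Suc k))"
    proof (rule inj_onI)
      fix I I' assume I: "I \<in> ?X (Suc k)" "I' \<in> ?X (Suc k)" and "?f I = ?f I'"
      then have "A \<inter> I = A \<inter> I'"
        "{J \<in> irreducible_ideals. I \<subset> J} = {J \<in> irreducible_ideals. I' \<subset> J}"
        by (simp_all only: prod.inject)
      moreover have "ideal I" "ideal I'" using I irreducible_ideal by blast+
      ultimately show "I = I'" using irreducible_ideal_determined[OF gen, of I I'] by blast
    qed
    ultimately show ?case by (rule finite_imageD[OF finite_subset])
  qed simp
  have "irreducible_ideals \<subseteq> ?X (Suc (card A))"
    using A by (auto simp: less_Suc_eq_le intro: card_mono)
  then have finX: "finite irreducible_ideals" using fin finite_subset by blast
  \<comment> \<open>Irreducible ideals separate elements: unless \<open>a \<sqsubseteq> b\<close>,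
    an ideal critical for \<open>a\<close> and containing the principal ideal of \<open>b\<close>
    omits \<open>a\<close> but not \<open>b\<close>.\<close>
  let ?g = "\<lambda>a. {I \<in> irreducible_ideals. a \<notin> I}"
  have sep: "a \<sqsubseteq> b" if ab: "?g a = ?g b" "a \<in> carrier L" "b \<in> carrier L" for a b
  proof (rule ccontr)
    assume "\<not> a \<sqsubseteq> b"
    moreover have "ideal {c \<in> carrier L. c \<sqsubseteq> b}"
      using that ideal_below by blast
    ultimately obtain J where "{c \<in> carrier L. c \<sqsubseteq> b} \<subseteq> J" and J: "critical J a"
      using ex_critical[of "{c \<in> carrier L. c \<sqsubseteq> b}" a] ab by auto
    then have "b \<in> J" using that le_refl by blast
    then show False using that(1) J unfolding irreducible_ideals_def critical_def by blast
  qed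
  have "inj_on ?g (carrier L)"
  proof (rule inj_onI)
    fix a b assume "a \<in> carrier L" "b \<in> carrier L" "?g a = ?g b"
    then show "a = b" using sep[of a b] sep[of b a] le_antisym[of a b] by simp
  qed
  moreover have "finite (?g ` carrier L)"
    by (rule finite_subset[of _ "Pow irreducible_ideals"]) (use finX in auto)
  ultimately show ?thesis by (rule finite_imageD[rotated])
qed

lemma finite_span:
  assumes "finite A" "A \<subseteq> carrier L" shows "finite (span L A)"
proof -
  interpret S: cbs "restrict_to L (span L A)"
    using span_sub restrict_cbs assms by blast
  show ?thesis using S.finite_of_span[of A] assms by (simp add: span_restrict)
qed

end

subsection \<open>Embeddings\<close>

lemma cbs_embeddingD:
  assumes "cbs_embedding e L B"
  shows "\<And>a. a \<in> carrier L \<Longrightarrow> e a \<in> carrier B" "inj_on e (carrier L)" "e \<zero>\<^bsub>L\<^esub> = \<zero>\<^bsub>B\<^esub>"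
    "\<And>a b. \<lbrakk>a \<in> carrier L; b \<in> carrier L\<rbrakk> \<Longrightarrow> e (a \<squnion>\<^bsub>L\<^esub> b) = e a \<squnion>\<^bsub>B\<^esub> e b"
    "\<And>a b. \<lbrakk>a \<in> carrier L; b \<in> carrier L\<rbrakk> \<Longrightarrow> e (a \<ominus>\<^bsub>L\<^esub> b) = e a \<ominus>\<^bsub>B\<^esub> e b"
  using assms unfolding cbs_embedding_def by auto

lemma cbs_embedding_eq_iff:
  "\<lbrakk>cbs_embedding e L B; a \<in> carrier L; b \<in> carrier L\<rbrakk> \<Longrightarrow> e a = e b \<longleftrightarrow> a = b"
  using cbs_embeddingD(2) inj_on_eq_iff by metis

text \<open>The order is definable by \<open>a \<ominus> b = \<zero>\<close>, so it is preserved and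
  reflected although embeddings do not mention it.\<close>

lemma cbs_embedding_le_iff:
  assumes "cbs L" "cbs B" "cbs_embedding e L B" "a \<in> carrier L" "b \<in> carrier L"
  shows "e a \<sqsubseteq>\<^bsub>B\<^esub> e b \<longleftrightarrow> a \<sqsubseteq>\<^bsub>L\<^esub> b"
proof -
  interpret L: cbs L by fact
  interpret B: cbs B by fact
  note e = cbs_embeddingD[OF assms(3)]
  have "e a \<sqsubseteq>\<^bsub>B\<^esub> e b \<longleftrightarrow> e (a \<ominus>\<^bsub>L\<^esub> b) = e \<zero>\<^bsub>L\<^esub>"
    using e assms(4,5) by (simp add: B.diff_eq_zero_iff)
  also have "\<dots> \<longleftrightarrow> a \<ominus>\<^bsub>L\<^esub> b = \<zero>\<^bsub>L\<^esub>"
    using cbs_embedding_eq_iff[OF assms(3)] assms(4,5) L.diff_closed L.zero_closed by blast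
  finally show ?thesis using assms(4,5) by (simp add: L.diff_eq_zero_iff)
qed

lemma cbs_embedding_less_iff:
  assumes "cbs L" "cbs B" "cbs_embedding e L B" "a \<in> carrier L" "b \<in> carrier L"
  shows "e a \<sqsubset>\<^bsub>B\<^esub> e b \<longleftrightarrow> a \<sqsubset>\<^bsub>L\<^esub> b"
  using cbs_embedding_le_iff[OF assms] cbs_embedding_eq_iff[OF assms(3-5)] by (simp add: less_def)

lemma cbs_embedding_comp:
  assumes "cbs_embedding e L B" "cbs_embedding f B C"
  shows "cbs_embedding (f \<circ> e) L C"
proof -
  have "e ` carrier L \<subseteq> carrier B" using cbs_embeddingD(1)[OF assms(1)] by blast
  then have "inj_on (f \<circ> e) (carrier L)"
    using cbs_embeddingD(2)[OF assms(1)] cbs_embeddingD(2)[OF assms(2)] inj_on_subset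
    by (intro comp_inj_on) auto
  then show ?thesis
    using cbs_embeddingD[OF assms(1)] cbs_embeddingD[OF assms(2)]
    unfolding cbs_embedding_def by auto
qed

lemma cbs_embedding_sub:
  assumes "cbs_embedding e L B" "sub_cbs S L"
  shows "cbs_embedding e (restrict_to L S) B" "sub_cbs (e ` S) B"
    "cbs_embedding e (restrict_to L S) (restrict_to B (e ` S))"
proof -
  have S: "S \<subseteq> carrier L" using assms(2) by (simp add: sub_cbs_def)
  have "inj_on e S" using cbs_embeddingD(2)[OF assms(1)] S inj_on_subset by blast
  then show "cbs_embedding e (restrict_to L S) B"
    "cbs_embedding e (restrict_to L S) (restrict_to B (e ` S))"
    using assms S unfolding cbs_embedding_def sub_cbs_def by (auto simp: subset_iff)
  have "e ` S \<subseteq> carrier B" using S cbs_embeddingD(1)[OF assms(1)] by blast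
  moreover have "\<zero>\<^bsub>B\<^esub> \<in> e ` S"
    using imageI[of _ S e, OF sub_cbsD(2)[OF assms(2)]] cbs_embeddingD(3)[OF assms(1)] by simp
  moreover have "e a \<squnion>\<^bsub>B\<^esub> e b \<in> e ` S \<and> e a \<ominus>\<^bsub>B\<^esub> e b \<in> e ` S" if ab: "a \<in> S" "b \<in> S" for a b
  proof -
    have "a \<in> carrier L" "b \<in> carrier L" using ab S by auto
    then have "e a \<squnion>\<^bsub>B\<^esub> e b = e (a \<squnion>\<^bsub>L\<^esub> b)" "e a \<ominus>\<^bsub>B\<^esub> e b = e (a \<ominus>\<^bsub>L\<^esub> b)"
      using cbs_embeddingD(4,5)[OF assms(1)] by auto
    then show ?thesis using sub_cbsD(3,4)[OF assms(2)] ab by simp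
  qed
  ultimately show "sub_cbs (e ` S) B" unfolding sub_cbs_def by auto
qed

lemma cbs_embedding_restrict_codomain:
  assumes "cbs_embedding e L (restrict_to B S)" "S \<subseteq> carrier B"
  shows "cbs_embedding e L B"
  using assms unfolding cbs_embedding_def by auto

lemma join_irreducible_iso:
  assumes "cbs L" "cbs B" "cbs_embedding e L B" and surj: "e ` carrier L = carrier B"
    and "p \<in> carrier L"
  shows "join_irreducible B (e p) \<longleftrightarrow> join_irreducible L p"
proof -
  interpret L: cbs L by fact
  interpret B: cbs B by fact
  note e = cbs_embeddingD[OF assms(3)]
  have "e p = \<zero>\<^bsub>B\<^esub> \<longleftrightarrow> p = \<zero>\<^bsub>L\<^esub>"
    using cbs_embedding_eq_iff[OF assms(3,5) L.zero_closed] e(3) by simp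
  moreover have "e p \<sqsubseteq>\<^bsub>B\<^esub> e a \<squnion>\<^bsub>B\<^esub> e b \<longleftrightarrow> p \<sqsubseteq>\<^bsub>L\<^esub> a \<squnion>\<^bsub>L\<^esub> b"
    if "a \<in> carrier L" "b \<in> carrier L" for a b
    using cbs_embedding_le_iff[OF assms(1-3,5), of "a \<squnion>\<^bsub>L\<^esub> b"] e(4) that by simp
  ultimately show ?thesis
    using e(1) assms(5) cbs_embedding_le_iff[OF assms(1-3,5)]
    by (simp add: L.join_irreducible_iff B.join_irreducible_iff surj[symmetric])
qed

lemma signature1_iso:
  assumes iso: "cbs L" "cbs B" "cbs_embedding e L B" "e ` carrier L = carrier B"
    and sig: "signature1 L h G"
  shows "signature1 B (e h) (e ` G)"
proof -
  interpret L: cbs L by fact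
  have h: "h \<in> carrier L" and G: "\<And>g. g \<in> G \<Longrightarrow> join_irreducible L g"
    and inc: "\<And>g g'. \<lbrakk>g \<in> G; g' \<in> G; g \<noteq> g'\<rbrakk> \<Longrightarrow> \<not> g \<sqsubseteq>\<^bsub>L\<^esub> g'" and hG: "\<And>g. g \<in> G \<Longrightarrow> h \<sqsubset>\<^bsub>L\<^esub> g"
    using sig by (auto simp: signature1_def)
  have Gc: "\<And>g. g \<in> G \<Longrightarrow> g \<in> carrier L" using G L.join_irreducible_closed by blast
  show ?thesis
    unfolding signature1_def
    using h G inc hG Gc cbs_embeddingD(1)[OF iso(3)] join_irreducible_iso[OF iso]
      cbs_embedding_le_iff[OF iso(1-3)] cbs_embedding_less_iff[OF iso(1-3)]
    by auto
qed

text \<open>The predecessor is a definite description; it is carried over through its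
  characterization as the largest element strictly below, which is invariant because
  \<open>e\<close> is onto.\<close>

lemma signature2_iso:
  assumes iso: "cbs L" "cbs B" "cbs_embedding e L B" "e ` carrier L = carrier B"
    and fin: "finite (carrier L)" and sig: "signature2 L h1 h2 g"
  shows "signature2 B (e h1) (e h2) (e g)"
proof -
  interpret L: cbs L by fact
  interpret B: cbs B by fact
  have h: "h1 \<in> carrier L" "h2 \<in> carrier L" and g: "join_irreducible L g"
    and eq: "h1 \<squnion>\<^bsub>L\<^esub> h2 = predecessor L g"
    using sig by (auto simp: signature2_def)
  have gc: "g \<in> carrier L" using g L.join_irreducible_closed by blast
  have eg: "join_irreducible B (e g)" using join_irreducible_iso[OF iso gc] g by simp
  have finB: "finite (carrier B)" using fin iso(4) by (metis finite_imageI)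
  note pL = L.predecessor_greatest[OF fin g]
  note pB = B.predecessor_greatest[OF finB eg]
  obtain q where q: "q \<in> carrier L" "predecessor B (e g) = e q" using pB(1) iso(4) by auto
  have "q \<sqsubset>\<^bsub>L\<^esub> g" using pB(2) q gc cbs_embedding_less_iff[OF iso(1-3)] by simp
  then have "q \<sqsubseteq>\<^bsub>L\<^esub> predecessor L g" using pL(3) q by blast
  moreover have "e (predecessor L g) \<sqsubset>\<^bsub>B\<^esub> e g"
    using pL(1,2) gc cbs_embedding_less_iff[OF iso(1-3)] by simp
  then have "e (predecessor L g) \<sqsubseteq>\<^bsub>B\<^esub> e q"
    using pB(3) cbs_embeddingD(1)[OF iso(3) pL(1)] q(2) by simp
  then have "predecessor L g \<sqsubseteq>\<^bsub>L\<^esub> q"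
    using cbs_embedding_le_iff[OF iso(1-3)] pL(1) q(1) by simp
  ultimately have "q = predecessor L g" using L.le_antisym q(1) pL(1) by blast
  then have "e h1 \<squnion>\<^bsub>B\<^esub> e h2 = predecessor B (e g)"
    using eq q(2) cbs_embeddingD(4)[OF iso(3) h] by simp
  then show ?thesis
    using eg h cbs_embeddingD(1)[OF iso(3)] by (simp add: signature2_def)
qed

subsection \<open>Primitive elements and couples\<close>

context cbs
begin

text \<open>Every element is a join of join-irreducible ones: among the elements below
  \<open>t\<close> satisfying \<open>P\<close> there is a largest \<open>m\<close>, and a
  join-irreducible element below \<open>t\<close> but not below \<open>m\<close> would contradict
  its choice.\<close>

lemma finite_join_irreducible_induct [consumes 2, case_names zero irreducible join]:
  assumes fin: "finite (carrier L)" and t: "t \<in> carrier L"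
    and zero: "P \<zero>" and irr: "\<And>p. join_irreducible L p \<Longrightarrow> P p"
    and join: "\<And>a b. \<lbrakk>a \<in> carrier L; b \<in> carrier L; P a; P b\<rbrakk> \<Longrightarrow> P (a \<squnion> b)"
  shows "P t"
proof -
  let ?A = "{a \<in> carrier L. P a \<and> a \<sqsubseteq> t}"
  obtain m where m: "m \<in> ?A" "\<And>a. a \<in> ?A \<Longrightarrow> a \<sqsubseteq> m"
  proof (rule finite_greatest[of ?A])
    show "a \<squnion> b \<in> ?A" if "a \<in> ?A" "b \<in> ?A" for a b using that join t by simp
  qed (use fin t zero in auto)
  have "t \<sqsubseteq> m"
  proof (rule ccontr)
    assume "\<not> t \<sqsubseteq> m"
    then obtain p where p: "join_irreducible L p" "p \<sqsubseteq> t" "\<not> p \<sqsubseteq> m"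
      using join_irreducible_below[OF fin t, of m] m(1) by blast
    then show False using m(2)[of p] irr join_irreducible_closed by blast
  qed
  then have "t = m" using m(1) t le_antisym by blast
  then show ?thesis using m(1) by simp
qed

end

section \<open>Primitive elements over a finite subalgebra\<close>

locale cbs_with_sub = cbs L + S: cbs "restrict_to L S" for L (structure) and S +
  assumes sub: "sub_cbs S L" and fin: "finite S"
begin

lemma in_L: "a \<in> S \<Longrightarrow> a \<in> carrier L"
  using sub by (auto simp: sub_cbs_def)

lemma zero_in: "\<zero> \<in> S" and join_in: "\<lbrakk>a \<in> S; b \<in> S\<rbrakk> \<Longrightarrow> a \<squnion> b \<in> S"
  and diff_in: "\<lbrakk>a \<in> S; b \<in> S\<rbrakk> \<Longrightarrow> a \<ominus> b \<in> S"
  using sub by (auto simp: sub_cbs_def)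

abbreviation "irr p \<equiv> join_irreducible (restrict_to L S) p"

lemma irr_in: "irr p \<Longrightarrow> p \<in> S"
  using S.join_irreducible_closed by auto

lemma irr_nonzero: "irr p \<Longrightarrow> p \<noteq> \<zero>"
  using S.join_irreducible_nonzero by auto

lemma irr_le_join: "\<lbrakk>irr p; a \<in> S; b \<in> S\<rbrakk> \<Longrightarrow> p \<sqsubseteq> a \<squnion> b \<longleftrightarrow> p \<sqsubseteq> a \<or> p \<sqsubseteq> b"
  using S.join_irreducible_le_join[of p a b] by simp

lemma irr_diff: "\<lbrakk>irr p; a \<in> S; \<not> p \<sqsubseteq> a\<rbrakk> \<Longrightarrow> p \<ominus> a = p"
  using S.join_irreducible_diff[of p a] by simp

lemma irr_below:
  assumes "b \<in> S" "c \<in> S" "\<not> b \<sqsubseteq> c"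
  obtains p where "irr p" "p \<sqsubseteq> b" "\<not> p \<sqsubseteq> c"
  using S.join_irreducible_below[of b c] fin assms by auto

lemma irr_induct [consumes 1, case_names zero irreducible join]:
  assumes "t \<in> S" "P \<zero>" "\<And>p. irr p \<Longrightarrow> P p"
    and "\<And>a b. \<lbrakk>a \<in> S; b \<in> S; P a; P b\<rbrakk> \<Longrightarrow> P (a \<squnion> b)"
  shows "P t"
  using S.finite_join_irreducible_induct[of t P] assms fin by simp

text \<open>The dichotomy \<open>irr_diff\<close> survives for \<open>x\<close> outside
  \<open>S\<close> when the difference stays in \<open>S\<close>: if \<open>p\<close> were not below
  \<open>p \<ominus> x\<close>, then subtracting this element of \<open>S\<close> would leave all of
  \<open>p\<close>, although what is left lies below \<open>x\<close>.\<close>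

lemma irr_diff_outside:
  assumes p: "irr p" and x: "x \<in> carrier L" and "p \<ominus> x \<in> S" "\<not> p \<sqsubseteq> x"
  shows "p \<ominus> x = p"
proof -
  have pc: "p \<in> carrier L" using p irr_in in_L by blast
  have "p \<sqsubseteq> p \<ominus> x"
  proof (rule ccontr)
    assume "\<not> p \<sqsubseteq> p \<ominus> x"
    then have "p \<ominus> (p \<ominus> x) = p" using irr_diff assms by blast
    moreover have "p \<ominus> (p \<ominus> x) \<sqsubseteq> x"
      using le_join_diff[OF pc x] pc x by (simp add: join_comm)
    ultimately show False using assms by simp
  qed
  then show ?thesis using pc x by (intro le_antisym) auto
qed

text \<open>The signature thus fixes all differences between \<open>x\<close> and \<open>S\<close>.
  It suffices to treat join-irreducible \<open>t\<close>, because a difference distributes over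
  joins in its first argument and turns joins in its second argument into repeated
  subtraction.\<close>

lemma primitive1_diff:
  assumes sig: "signature1 (restrict_to L S) h G" and prim: "primitive1 L S x"
    and ind: "induces1 L S x h G" and t: "t \<in> S"
  shows "t \<ominus> x = t \<ominus> h" "x \<ominus> t = (if \<exists>g\<in>G. g \<sqsubseteq> t then \<zero> else x)"
proof -
  have h: "h \<in> S" and G: "\<And>g. g \<in> G \<Longrightarrow> irr g"
    using sig by (auto simp: signature1_def)
  have x: "x \<in> carrier L" "x \<notin> S" and
    px: "\<And>p. irr p \<Longrightarrow> p \<ominus> x \<in> S \<and> (x \<ominus> p = x \<or> x \<ominus> p = \<zero>)"
    using prim by (auto simp: primitive1_def)
  have below: "\<And>p. irr p \<Longrightarrow> p \<sqsubset> x \<longleftrightarrow> p \<sqsubseteq> h"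
    and above: "\<And>p. irr p \<Longrightarrow> x \<sqsubset> p \<longleftrightarrow> (\<exists>g\<in>G. g \<sqsubseteq> p)"
    using ind by (auto simp: induces1_def)
  show "t \<ominus> x = t \<ominus> h"
    using t
  proof (induction rule: irr_induct)
    case (irreducible p)
    have p: "p \<in> S" "p \<in> carrier L" using irreducible irr_in in_L by auto
    have "p \<sqsubseteq> x \<longleftrightarrow> p \<sqsubseteq> h"
      using below[OF irreducible] p(1) x(2) by (auto simp: less_def)
    moreover have "p \<ominus> x = p" if "\<not> p \<sqsubseteq> x"
      using irr_diff_outside[OF irreducible x(1) _ that] px[OF irreducible] by blast
    moreover have "p \<ominus> h = p" if "\<not> p \<sqsubseteq> h"
      using irr_diff[OF irreducible h that] .
    ultimately show ?case
      using diff_eq_zero_iff[OF p(2) x(1)] diff_eq_zero_iff[OF p(2) in_L[OF h]] by metis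
  qed (use x h in_L in \<open>simp_all add: join_diff_distrib\<close>)
  show "x \<ominus> t = (if \<exists>g\<in>G. g \<sqsubseteq> t then \<zero> else x)"
    using t
  proof (induction rule: irr_induct)
    case zero
    have "\<not> g \<sqsubseteq> \<zero>" if "g \<in> G" for g
      using G[OF that] irr_nonzero irr_in in_L by simp
    then show ?case using x by simp
  next
    case (irreducible p)
    have p: "p \<in> S" "p \<in> carrier L" using irreducible irr_in in_L by auto
    have "x \<sqsubseteq> p \<longleftrightarrow> (\<exists>g\<in>G. g \<sqsubseteq> p)"
      using above[OF irreducible] p(1) x(2) by (auto simp: less_def)
    then show ?case
      using px[OF irreducible] diff_eq_zero_iff[OF x(1) p(2)] by auto
  next
    case (join a b)
    have "(\<exists>g\<in>G. g \<sqsubseteq> a \<squnion> b) \<longleftrightarrow> (\<exists>g\<in>G. g \<sqsubseteq> a) \<or> (\<exists>g\<in>G. g \<sqsubseteq> b)"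
      using irr_le_join[OF G join(1,2)] by blast
    moreover have "x \<ominus> (a \<squnion> b) = x \<ominus> a \<ominus> b"
      using join in_L x by (simp add: diff_join)
    ultimately show ?case
      using join in_L[of b] by simp
  qed
qed

text \<open>Elements above \<open>g\<close> are excluded from the last two claims because
  \<open>g \<ominus> x1 = x2\<close> is outside \<open>S\<close>; \<open>couple_diff\<close> deals
  with them. The other irreducible elements are either strictly below \<open>g\<close>, where
  primitivity applies, or not below \<open>g\<close>, and then subtracting anything below
  \<open>g\<close> leaves them unchanged.\<close>

lemma primitive2_diff:
  assumes sig: "signature2 (restrict_to L S) h1 h2 g" and prim: "primitive2 L S x1 x2"
    and ind: "induces2 L S x1 x2 h1 h2 g"
  shows "x1 \<squnion> x2 = g" "g \<ominus> x1 = x2" "g \<ominus> x2 = x1"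
    "\<And>t. \<lbrakk>t \<in> S; \<not> g \<sqsubseteq> t\<rbrakk> \<Longrightarrow> t \<ominus> x1 = t \<ominus> h1"
    "\<And>t. \<lbrakk>t \<in> S; \<not> g \<sqsubseteq> t\<rbrakk> \<Longrightarrow> t \<ominus> x2 = t \<ominus> h2"
proof -
  have h: "h1 \<in> S" "h2 \<in> S" and g: "irr g" and eq: "h1 \<squnion> h2 = predecessor (restrict_to L S) g"
    using sig by (auto simp: signature2_def)
  have gS: "g \<in> S" "g \<in> carrier L" using g irr_in in_L by auto
  have hc: "h1 \<in> carrier L" "h2 \<in> carrier L" using h in_L by auto
  have "h1 \<squnion> h2 \<sqsubseteq> g"
    using S.predecessor_greatest(2)[OF _ g] fin eq by (simp add: less_def)
  then have hg: "h1 \<sqsubseteq> g" "h2 \<sqsubseteq> g" using hc gS by auto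
  obtain g' where g': "irr g'" "g' \<ominus> x1 = x2" "g' \<ominus> x2 = x1"
    and xS: "\<And>a. \<lbrakk>irr a; a \<sqsubset> g'\<rbrakk> \<Longrightarrow> a \<ominus> x1 \<in> S \<and> a \<ominus> x2 \<in> S"
    and x: "x1 \<in> carrier L" "x2 \<in> carrier L" "x1 \<notin> S" "x2 \<notin> S"
    using prim by (auto simp: primitive2_def)
  have below: "\<And>p. irr p \<Longrightarrow> p \<sqsubset> x1 \<longleftrightarrow> p \<sqsubseteq> h1" "\<And>p. irr p \<Longrightarrow> p \<sqsubset> x2 \<longleftrightarrow> p \<sqsubseteq> h2"
    and gx: "g = x1 \<squnion> x2"
    using ind by (auto simp: induces2_def)
  have g'c: "g' \<in> carrier L" using g' irr_in in_L by blast
  have "g' \<sqsubseteq> x1 \<squnion> x2" using le_join_diff[OF g'c x(1)] g'(2) by simp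
  moreover have "x1 \<sqsubseteq> g'" "x2 \<sqsubseteq> g'"
    using diff_le[OF g'c x(1)] diff_le[OF g'c x(2)] g' by simp_all
  \<comment> \<open>Primitivity only provides some irreducible element split by the couple. Being
    the join of the couple, it is the \<open>g\<close> of the signature.\<close>
  ultimately have [simp]: "g' = g" using gx g'c x by (intro le_antisym) auto
  show "x1 \<squnion> x2 = g" "g \<ominus> x1 = x2" "g \<ominus> x2 = x1" using gx g' by auto
  have *: "t \<ominus> x = t \<ominus> h" if "t \<in> S" "\<not> g \<sqsubseteq> t" and hyp: "x \<in> carrier L" "x \<notin> S" "x \<sqsubseteq> g" "h \<in> S" "h \<sqsubseteq> g"
    "\<And>a. \<lbrakk>irr a; a \<sqsubset> g\<rbrakk> \<Longrightarrow> a \<ominus> x \<in> S" "\<And>p. irr p \<Longrightarrow> p \<sqsubset> x \<longleftrightarrow> p \<sqsubseteq> h" for t x h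
  proof -
    have hc: "h \<in> carrier L" using hyp in_L by blast
    have "g \<sqsubseteq> t \<or> t \<ominus> x = t \<ominus> h"
      using that(1)
    proof (induction rule: irr_induct)
      case (irreducible p)
      have p: "p \<in> S" "p \<in> carrier L" using irreducible irr_in in_L by auto
      consider "g \<sqsubseteq> p" | "p \<sqsubset> g" | "\<not> p \<sqsubseteq> g"
        using p gS by (auto simp: less_def)
      then show ?case
      proof cases
        case 2
        have "p \<sqsubseteq> x \<longleftrightarrow> p \<sqsubseteq> h"
          using hyp(7)[OF irreducible] p(1) hyp(2) by (auto simp: less_def)
        moreover have "p \<ominus> x = p" if "\<not> p \<sqsubseteq> x"
          using irr_diff_outside[OF irreducible hyp(1) hyp(6)[OF irreducible 2] that] .
        moreover have "p \<ominus> h = p" if "\<not> p \<sqsubseteq> h"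
          using irr_diff[OF irreducible hyp(4) that] .
        ultimately show ?thesis
          using diff_eq_zero_iff[OF p(2) hyp(1)] diff_eq_zero_iff[OF p(2) hc] by metis
      next
        case 3
        have "p \<ominus> u = p" if "u \<in> carrier L" "u \<sqsubseteq> g" for u
        proof (rule le_antisym)
          have "p \<ominus> g \<sqsubseteq> p \<ominus> u" using diff_antimono[of u g p] that gS p by simp
          then show "p \<sqsubseteq> p \<ominus> u" using irr_diff[OF irreducible gS(1) 3] by simp
        qed (use that p in auto)
        then show ?thesis using hyp hc by simp
      qed simp
    next
      case (join a b)
      then have c: "a \<in> carrier L" "b \<in> carrier L" using in_L by auto
      then show ?case
        using join le_joinI1[of g a b] le_joinI2[of g b a] gS hyp(1) hc
        by (auto simp: join_diff_distrib)
    qed (use hyp hc in simp)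
    then show ?thesis using that(2) by blast
  qed
  have xg: "x1 \<sqsubseteq> g" "x2 \<sqsubseteq> g" using gx x by auto
  show "t \<ominus> x1 = t \<ominus> h1" if "t \<in> S" "\<not> g \<sqsubseteq> t" for t
    using *[OF that x(1,3) xg(1) h(1) hg(1)] xS below by simp
  show "t \<ominus> x2 = t \<ominus> h2" if "t \<in> S" "\<not> g \<sqsubseteq> t" for t
    using *[OF that x(2,4) xg(2) h(2) hg(2)] xS below by simp
qed


lemma greatest_below:
  assumes "x \<in> carrier L"
  obtains h where "h \<in> S" "h \<sqsubseteq> x" "\<And>t. \<lbrakk>t \<in> S; t \<sqsubseteq> x\<rbrakk> \<Longrightarrow> t \<sqsubseteq> h"
proof -
  obtain h where "h \<in> {t \<in> S. t \<sqsubseteq> x}" "\<And>t. t \<in> {t \<in> S. t \<sqsubseteq> x} \<Longrightarrow> t \<sqsubseteq> h"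
    by (rule finite_greatest[of "{t \<in> S. t \<sqsubseteq> x}"])
      (use assms fin in_L zero_in join_in in auto)
  then show ?thesis using that by blast
qed

text \<open>A minimal element outside the subalgebra is either itself primitive or half of a primitive
  couple.\<close>

lemma ex_primitive:
  assumes finL: "finite (carrier L)" and proper: "S \<noteq> carrier L"
  shows "(\<exists>x h G. signature1 (restrict_to L S) h G \<and> primitive1 L S x \<and> induces1 L S x h G) \<or>
    (\<exists>x1 x2 h1 h2 g. signature2 (restrict_to L S) h1 h2 g \<and>
       primitive2 L S x1 x2 \<and> induces2 L S x1 x2 h1 h2 g)"
proof -
  obtain q where q0: "q \<in> carrier L - S" and
    min0: "\<And>x. x \<in> carrier L - S \<Longrightarrow> x \<sqsubseteq> q \<Longrightarrow> x = q"
    by (rule finite_minimal[OF cbs_axioms, of "carrier L - S"]) (use finL proper in_L in auto)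
  then have q: "q \<in> carrier L" "q \<notin> S" by auto
  have min: "u \<in> S \<or> u = q" if "u \<in> carrier L" "u \<sqsubseteq> q" for u
    using min0[of u] that by blast
  \<comment> \<open>If \<open>?u\<close> is nonzero, the rest \<open>q \<ominus> ?u\<close> lies
    below \<open>a\<close> and differs from \<open>q\<close>, so it belongs to \<open>S\<close>. The
    two parts join to \<open>q\<close>, hence \<open>?u\<close> is outside \<open>S\<close> and
    minimality makes it equal to \<open>q\<close>.\<close>
  have q_diff: "q \<ominus> a = q \<or> q \<ominus> a = \<zero>" if a: "a \<in> carrier L" for a
  proof (rule disjCI)
    let ?u = "q \<ominus> a"
    assume "?u \<noteq> \<zero>"
    then have na: "\<not> q \<sqsubseteq> a" using q a by simp
    have "q \<ominus> ?u \<sqsubseteq> a" using le_join_diff[OF q(1) a] q a by (simp add: join_comm)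
    then have "q \<ominus> ?u \<noteq> q" using na by metis
    then have "q \<ominus> ?u \<in> S" using min[of "q \<ominus> ?u"] q a by simp
    moreover have "?u \<squnion> (q \<ominus> ?u) = q"
      using q a le_join_diff[of q ?u] by (intro le_antisym) auto
    ultimately have "?u \<notin> S" using join_in[of ?u "q \<ominus> ?u"] q(2) by auto
    then show "?u = q" using min[of ?u] q a by simp
  qed
  \<comment> \<open>The part \<open>p \<ominus> (p \<ominus> q)\<close> always lies below
    \<open>q\<close>, so it is \<open>q\<close> or in \<open>S\<close>. In the latter case either
    \<open>p\<close> lies below it, hence below \<open>q\<close>, or \<open>p\<close> loses nothing
    when \<open>q\<close> is subtracted.\<close>
  have irr_q: "p \<ominus> q = p \<or> p \<ominus> q = \<zero>" if p: "irr p" "p \<ominus> (p \<ominus> q) \<noteq> q" for p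
  proof -
    let ?u = "p \<ominus> (p \<ominus> q)"
    have pc: "p \<in> carrier L" using p irr_in in_L by blast
    have uq: "?u \<sqsubseteq> q" using le_join_diff[OF pc q(1)] q pc by (simp add: join_comm)
    then have uS: "?u \<in> S" using min[of ?u] p q pc by simp
    show ?thesis
    proof (cases "p \<sqsubseteq> ?u")
      case True
      then have "p \<sqsubseteq> q" using uq le_trans[of p ?u q] pc q by simp
      then show ?thesis using pc q by simp
    next
      case False
      then have "p \<ominus> ?u = p" using irr_diff p uS by blast
      moreover have "p \<ominus> ?u \<sqsubseteq> p \<ominus> q"
        using le_join_diff[of p "p \<ominus> q"] pc q by (simp add: join_comm)
      ultimately show ?thesis using pc q by (auto intro!: le_antisym)
    qed
  qed
  show ?thesis
  proof (cases "\<exists>p. irr p \<and> p \<ominus> (p \<ominus> q) = q")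
    case False
    obtain h where h: "h \<in> S" "h \<sqsubseteq> q" and hmax: "\<And>t. \<lbrakk>t \<in> S; t \<sqsubseteq> q\<rbrakk> \<Longrightarrow> t \<sqsubseteq> h"
      using greatest_below[OF q(1)] by blast
    have hc: "h \<in> carrier L" using h in_L by blast
    define P where "P = {p. irr p \<and> q \<sqsubseteq> p}"
    \<comment> \<open>Passing to the minimal members of \<open>P\<close> gives the incomparability
      demanded of a signature; by finiteness every member of \<open>P\<close> still lies above one
      of them.\<close>
    define G where "G = {g \<in> P. \<forall>p\<in>P. p \<sqsubseteq> g \<longrightarrow> p = g}"
    have PS: "P \<subseteq> S" using irr_in by (auto simp: P_def)
    have Pc: "\<And>p. p \<in> P \<Longrightarrow> p \<in> carrier L" using PS in_L by blast
    have GP: "G \<subseteq> P" by (auto simp: G_def)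
    have ex_G: "\<exists>g\<in>G. g \<sqsubseteq> p" if p: "p \<in> P" for p
    proof -
      let ?Q = "{p' \<in> P. p' \<sqsubseteq> p}"
      have Q: "finite ?Q" "?Q \<subseteq> carrier L" "?Q \<noteq> {}"
        using finite_subset[of ?Q S] PS fin p Pc by auto
      obtain g where g: "g \<in> ?Q" "\<And>x. x \<in> ?Q \<Longrightarrow> x \<sqsubseteq> g \<Longrightarrow> x = g"
        by (rule finite_minimal[OF cbs_axioms Q]) (rule that)
      have "x = g" if "x \<in> P" "x \<sqsubseteq> g" for x
        using g le_trans[of x g p] Pc that p by blast
      then show ?thesis using g by (auto simp: G_def)
    qed
    have "h \<sqsubset> p" if "p \<in> P" for p
    proof -
      have "h \<sqsubseteq> p" using le_trans[of h q p] h(2) hc q(1) Pc that by (simp add: P_def)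
      moreover have "h \<noteq> p" using that le_antisym[of h q] h hc q by (auto simp: P_def)
      ultimately show ?thesis by (simp add: less_def)
    qed
    then have "signature1 (restrict_to L S) h G"
      unfolding signature1_def using h GP by (auto simp: G_def P_def less_def)
    moreover have "primitive1 L S q"
      unfolding primitive1_def
    proof (intro conjI allI impI)
      fix a assume a: "irr a"
      then have "a \<in> S" using irr_in by blast
      then show "q \<ominus> a = q \<or> q \<ominus> a = \<zero>" using q_diff in_L by blast
      show "a \<ominus> q \<in> S" using irr_q[OF a] False a \<open>a \<in> S\<close> zero_in by metis
    qed (use q in auto)
    moreover have "induces1 L S q h G"
      unfolding induces1_def
    proof (intro allI impI conjI)
      fix a assume a: "irr a"
      then have aS: "a \<in> S" using irr_in by blast
      then have ac: "a \<in> carrier L" "a \<noteq> q" using in_L q by auto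
      show "a \<sqsubset> q \<longleftrightarrow> a \<sqsubseteq> h"
        using hmax[OF aS] le_trans[of a h q] ac hc q(1) h(2) by (auto simp: less_def)
      show "q \<sqsubset> a \<longleftrightarrow> (\<exists>g\<in>G. g \<sqsubseteq> a)"
      proof
        assume "q \<sqsubset> a"
        then show "\<exists>g\<in>G. g \<sqsubseteq> a" using ex_G[of a] a by (simp add: P_def less_def)
      next
        assume "\<exists>g\<in>G. g \<sqsubseteq> a"
        then obtain g where g: "g \<in> P" "g \<sqsubseteq> a" using GP by blast
        then have "q \<sqsubseteq> a" using le_trans[of q g a] q(1) Pc ac by (simp add: P_def)
        then show "q \<sqsubset> a" using ac by (auto simp: less_def)
      qed
    qed
    ultimately show ?thesis by blast
  next
    case True
    then obtain p where p: "irr p" and ppq: "p \<ominus> (p \<ominus> q) = q" by blast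
    have pS: "p \<in> S" using p irr_in by blast
    then have pc: "p \<in> carrier L" using in_L by blast
    \<comment> \<open>Now \<open>q\<close> and \<open>x\<close> are complementary: each is
      \<open>p\<close> minus the other, and neither lies in \<open>S\<close>.\<close>
    define x where "x = p \<ominus> q"
    have x: "x \<in> carrier L" "p \<ominus> x = q" using pc q ppq by (simp_all add: x_def)
    have xp: "x \<sqsubseteq> p" and qp: "q \<sqsubseteq> p"
      using diff_le[OF pc q(1)] diff_le[OF pc x(1)] x by (simp_all add: x_def)
    have pxq: "p = q \<squnion> x"
    proof (rule le_antisym)
      show "p \<sqsubseteq> q \<squnion> x" using le_join_diff[OF pc q(1)] by (simp add: x_def)
    qed (use pc q x xp qp in auto)
    have xS: "x \<notin> S" using diff_in[OF pS] x q by metis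
    have xq: "q \<noteq> x" using pxq q pS by auto
    \<comment> \<open>Subtracting an \<open>a\<close> strictly below \<open>p\<close> leaves all of
      \<open>p\<close>. If \<open>a\<close> were above \<open>q\<close>, then \<open>p\<close> would
      lie below \<open>p \<ominus> q = x\<close>, and \<open>q = p \<ominus> x\<close> would be
      zero.\<close>
    have not_q: "\<not> q \<sqsubseteq> a" if a: "irr a" "a \<sqsubset> p" for a
    proof
      assume "q \<sqsubseteq> a"
      have aS: "a \<in> S" and ac: "a \<in> carrier L" using a irr_in in_L by auto
      have "\<not> p \<sqsubseteq> a" using a le_antisym[of p a] pc ac by (auto simp: less_def)
      then have "p \<ominus> a = p" using irr_diff[OF p aS] by blast
      moreover have "p \<ominus> a \<sqsubseteq> x"
        using diff_antimono[OF \<open>q \<sqsubseteq> a\<close> pc q(1) ac] by (simp add: x_def)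
      ultimately have "p \<ominus> x = \<zero>" using pc x(1) by simp
      then show False using x q zero_in by auto
    qed
    have a_q: "a \<ominus> q \<in> S" if a: "irr a" "a \<sqsubset> p" for a
    proof -
      have aS: "a \<in> S" and ac: "a \<in> carrier L" using a irr_in in_L by auto
      have "a \<ominus> (a \<ominus> q) \<noteq> q"
        using not_q[OF a] diff_le[of a "a \<ominus> q"] ac q(1) diff_closed by metis
      then show ?thesis using irr_q[OF a(1)] aS zero_in by metis
    qed
    have a_x: "a \<ominus> x \<in> S" if a: "irr a" "a \<sqsubset> p" for a
    proof -
      have aS: "a \<in> S" and ac: "a \<in> carrier L" using a irr_in in_L by auto
      have "a \<ominus> x \<sqsubseteq> q"
        using a(2) pxq ac q(1) x(1) by (simp add: less_def join_comm)
      moreover have "a \<ominus> x \<noteq> q"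
        using not_q[OF a] diff_le[OF ac x(1)] by metis
      ultimately show ?thesis using min[of "a \<ominus> x"] ac x(1) by simp
    qed
    have prim: "primitive2 L S q x"
      unfolding primitive2_def
    proof (intro conjI exI[of _ p] allI impI)
      fix a assume "irr a \<and> a \<sqsubset> p"
      then show "a \<ominus> q \<in> S" "a \<ominus> x \<in> S" using a_q a_x by blast+
    qed (use q x xS xq p x_def in auto)
    obtain h1 where h1: "h1 \<in> S" "h1 \<sqsubseteq> q" and h1max: "\<And>t. \<lbrakk>t \<in> S; t \<sqsubseteq> q\<rbrakk> \<Longrightarrow> t \<sqsubseteq> h1"
      using greatest_below[OF q(1)] by blast
    obtain h2 where h2: "h2 \<in> S" "h2 \<sqsubseteq> x" and h2max: "\<And>t. \<lbrakk>t \<in> S; t \<sqsubseteq> x\<rbrakk> \<Longrightarrow> t \<sqsubseteq> h2"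
      using greatest_below[OF x(1)] by blast
    have hc: "h1 \<in> carrier L" "h2 \<in> carrier L" using h1 h2 in_L by auto
    have hp: "h1 \<sqsubseteq> p" "h2 \<sqsubseteq> p"
      using le_trans[OF hc(1) q(1) pc h1(2) qp] le_trans[OF hc(2) x(1) pc h2(2) xp] by auto
    have "\<not> p \<sqsubseteq> h1" "\<not> p \<sqsubseteq> h2"
    proof -
      have "q \<noteq> p" "x \<noteq> p" using q xS pS by auto
      then have "\<not> p \<sqsubseteq> q" "\<not> p \<sqsubseteq> x" using le_antisym pc q(1) x(1) qp xp by metis+
      then show "\<not> p \<sqsubseteq> h1" "\<not> p \<sqsubseteq> h2"
        using le_trans[OF pc hc(1) q(1) _ h1(2)] le_trans[OF pc hc(2) x(1) _ h2(2)] by auto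
    qed
    then have np: "\<not> p \<sqsubseteq> h1 \<squnion> h2" using irr_le_join[OF p h1(1) h2(1)] by blast
    have finS: "finite (carrier (restrict_to L S))" using fin by simp
    note pred = S.predecessor_greatest[OF finS p]
    let ?m = "predecessor (restrict_to L S) p"
    have m: "?m \<in> S" "?m \<sqsubseteq> p" "?m \<noteq> p" using pred by (auto simp: less_def)
    have mc: "?m \<in> carrier L" using m in_L by blast
    have "h1 \<squnion> h2 = ?m"
    proof (rule le_antisym)
      have "h1 \<squnion> h2 \<sqsubseteq> p" "h1 \<squnion> h2 \<noteq> p" using hp np hc pc by auto
      then show "h1 \<squnion> h2 \<sqsubseteq> ?m"
        using pred(3)[of "h1 \<squnion> h2"] join_in h1 h2 by (simp add: less_def)
      \<comment> \<open>An irreducible \<open>a\<close> below the predecessor but not below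
        \<open>q\<close> is unchanged by subtracting \<open>q\<close>, so
        \<open>a \<sqsubseteq> q \<squnion> x\<close> puts it below \<open>x\<close>. Hence it lies
        below \<open>h1\<close> or \<open>h2\<close>.\<close>
      show "?m \<sqsubseteq> h1 \<squnion> h2"
      proof (rule ccontr)
        assume "\<not> ?m \<sqsubseteq> h1 \<squnion> h2"
        then obtain a where a: "irr a" "a \<sqsubseteq> ?m" "\<not> a \<sqsubseteq> h1 \<squnion> h2"
          using irr_below[OF m(1) join_in[OF h1(1) h2(1)]] by blast
        have aS: "a \<in> S" and ac: "a \<in> carrier L" using a irr_in in_L by auto
        have "a \<sqsubseteq> p" using le_trans[OF ac mc pc a(2) m(2)] .
        moreover have "a \<noteq> p" using a(2) m le_antisym[OF mc pc] by auto
        ultimately have ap: "a \<sqsubset> p" by (simp add: less_def)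
        have "\<not> a \<sqsubseteq> q"
          using a(3) h1max[OF aS] le_joinI1[OF _ ac hc] by blast
        then have "a \<ominus> q = a" using irr_diff_outside[OF a(1) q(1) a_q[OF a(1) ap]] by blast
        then have "a \<sqsubseteq> x"
          using \<open>a \<sqsubseteq> p\<close> pxq ac q(1) x(1) diff_le_iff[of a q x] by simp
        then show False using a(3) h2max[OF aS] le_joinI2[OF _ ac hc] by blast
      qed
    qed (use hc mc in auto)
    then have sig: "signature2 (restrict_to L S) h1 h2 p"
      using h1 h2 p by (simp add: signature2_def)
    have "a \<sqsubset> q \<longleftrightarrow> a \<sqsubseteq> h1" "a \<sqsubset> x \<longleftrightarrow> a \<sqsubseteq> h2" if a: "irr a" for a
    proof -
      have aS: "a \<in> S" and ac: "a \<in> carrier L" using a irr_in in_L by auto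
      have "a \<noteq> q" "a \<noteq> x" using aS q xS by auto
      then show "a \<sqsubset> q \<longleftrightarrow> a \<sqsubseteq> h1" "a \<sqsubset> x \<longleftrightarrow> a \<sqsubseteq> h2"
        using h1max[OF aS] h2max[OF aS] le_trans[OF ac hc(1) q(1) _ h1(2)]
          le_trans[OF ac hc(2) x(1) _ h2(2)] by (auto simp: less_def)
    qed
    then have "induces2 L S q x h1 h2 p"
      using pxq by (simp add: induces2_def)
    then show ?thesis using sig prim by blast
  qed
qed

end

subsection \<open>Extending embeddings\<close>

text \<open>A subalgebra of a product is the graph of an isomorphism if it relates zero only to zero:
  apply this to the differences of two related pairs.\<close>

lemma embedding_of_graph:
  assumes "cbs M" "cbs L" and R: "R \<subseteq> carrier M \<times> carrier L" "(\<zero>\<^bsub>M\<^esub>, \<zero>\<^bsub>L\<^esub>) \<in> R"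
    and join: "\<And>a b c d. \<lbrakk>(a, b) \<in> R; (c, d) \<in> R\<rbrakk> \<Longrightarrow> (a \<squnion>\<^bsub>M\<^esub> c, b \<squnion>\<^bsub>L\<^esub> d) \<in> R"
    and diff: "\<And>a b c d. \<lbrakk>(a, b) \<in> R; (c, d) \<in> R\<rbrakk> \<Longrightarrow> (a \<ominus>\<^bsub>M\<^esub> c, b \<ominus>\<^bsub>L\<^esub> d) \<in> R"
    and zero: "\<And>a b. (a, b) \<in> R \<Longrightarrow> a = \<zero>\<^bsub>M\<^esub> \<longleftrightarrow> b = \<zero>\<^bsub>L\<^esub>"
  obtains f where "sub_cbs (Domain R) M" "cbs_embedding f (restrict_to M (Domain R)) L"
    "\<And>a b. (a, b) \<in> R \<Longrightarrow> f a = b"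
proof -
  interpret M: cbs M by fact
  interpret L: cbs L by fact
  have closed: "a \<in> carrier M" "b \<in> carrier L" if "(a, b) \<in> R" for a b
    using R(1) that by auto
  have le: "a \<sqsubseteq>\<^bsub>M\<^esub> c \<longleftrightarrow> b \<sqsubseteq>\<^bsub>L\<^esub> d" if ab: "(a, b) \<in> R" "(c, d) \<in> R" for a b c d
    using zero[OF diff[OF ab]] closed[OF ab(1)] closed[OF ab(2)] by simp
  have eq: "a = c \<longleftrightarrow> b = d" if ab: "(a, b) \<in> R" "(c, d) \<in> R" for a b c d
  proof -
    have "a \<in> carrier M" "c \<in> carrier M" "b \<in> carrier L" "d \<in> carrier L"
      using closed[OF ab(1)] closed[OF ab(2)] by auto
    then show ?thesis
      using le[OF ab] le[OF ab(2,1)] M.le_antisym[of a c] L.le_antisym[of b d]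
      by auto
  qed
  define f where "f a = (SOME b. (a, b) \<in> R)" for a
  have f: "f a = b" if "(a, b) \<in> R" for a b
  proof -
    have "(a, f a) \<in> R" unfolding f_def using that by (rule someI)
    then show ?thesis using eq[OF _ that] by blast
  qed
  have dom: "\<exists>b. (a, b) \<in> R \<and> f a = b \<and> a \<in> carrier M \<and> b \<in> carrier L" if "a \<in> Domain R" for a
    using that f R by fastforce
  have "sub_cbs (Domain R) M"
    unfolding sub_cbs_def using R join diff by blast
  moreover have "cbs_embedding f (restrict_to M (Domain R)) L"
    unfolding cbs_embedding_def
  proof (intro conjI ballI inj_onI)
    show "f ` carrier (restrict_to M (Domain R)) \<subseteq> carrier L" using dom by auto
    show "f \<zero>\<^bsub>restrict_to M (Domain R)\<^esub> = \<zero>\<^bsub>L\<^esub>" using f R by simp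
  next
    fix a c assume "a \<in> carrier (restrict_to M (Domain R))" "c \<in> carrier (restrict_to M (Domain R))"
    then obtain b d where ab: "(a, b) \<in> R" "f a = b" "(c, d) \<in> R" "f c = d"
      using dom by auto
    show "a = c" if "f a = f c" using eq[OF ab(1,3)] ab that by simp
    show "f (a \<squnion>\<^bsub>restrict_to M (Domain R)\<^esub> c) = f a \<squnion>\<^bsub>L\<^esub> f c"
      using f[OF join[OF ab(1,3)]] ab by simp
    show "f (a \<ominus>\<^bsub>restrict_to M (Domain R)\<^esub> c) = f a \<ominus>\<^bsub>L\<^esub> f c"
      using f[OF diff[OF ab(1,3)]] ab by simp
  qed
  ultimately show ?thesis using that f by blast
qed

context cbs
begin

lemma join_left_idem: "\<lbrakk>a \<in> carrier L; b \<in> carrier L\<rbrakk> \<Longrightarrow> a \<squnion> (a \<squnion> b) = a \<squnion> b"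
  by (simp add: join_assoc[symmetric])

lemmas join_ac = join_assoc join_comm join_left_comm join_left_idem

text \<open>For \<open>t\<close> above \<open>g\<close>, split \<open>t\<close> as
  \<open>(t \<ominus> g) \<squnion> g\<close> and subtract \<open>x\<close> from both parts. If
  \<open>t \<ominus> g\<close> is itself above \<open>g\<close>, then
  \<open>t \<ominus> g = t\<close> and subtracting \<open>x\<close> removes nothing.\<close>

lemma couple_diff:
  assumes c: "t \<in> carrier L" "g \<in> carrier L" "x \<in> carrier L"
    and "g \<ominus> x = x'" "x \<sqsubseteq> g"
    and H: "\<not> g \<sqsubseteq> t \<Longrightarrow> t \<ominus> x = t \<ominus> h" "\<not> g \<sqsubseteq> t \<ominus> g \<Longrightarrow> t \<ominus> g \<ominus> x = t \<ominus> g \<ominus> h"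
  shows "t \<ominus> x = (if \<not> g \<sqsubseteq> t then t \<ominus> h else if g \<sqsubseteq> t \<ominus> g then t else (t \<ominus> g \<ominus> h) \<squnion> x')"
proof (cases "g \<sqsubseteq> t")
  case True
  have t: "t = (t \<ominus> g) \<squnion> g"
    using le_join_diff[OF c(1,2)] True c by (intro le_antisym) (auto simp: join_comm)
  show ?thesis
  proof (cases "g \<sqsubseteq> t \<ominus> g")
    case g: True
    have tg: "t \<ominus> g = t" using t join_absorb(2)[OF g] c by simp
    have "t \<ominus> g \<sqsubseteq> t \<ominus> x" using diff_antimono[OF \<open>x \<sqsubseteq> g\<close>] c by blast
    then have "t \<ominus> x = t" using tg c by (intro le_antisym) auto
    then show ?thesis using True g by simp
  next
    case False
    have "t \<ominus> x = ((t \<ominus> g) \<squnion> g) \<ominus> x" using t by simp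
    also have "\<dots> = (t \<ominus> g \<ominus> x) \<squnion> (g \<ominus> x)" by (rule join_diff_distrib) (use c in auto)
    finally show ?thesis using True False H assms(4) by simp
  qed
qed (use H in simp)

end

text \<open>Serves both kinds of primitive extension, with index type \<open>unit\<close> for an
  element and \<open>bool\<close> for a couple. By \<open>A\<close> to \<open>D\<close>, differences
  and joins involving the new elements are given by the same expressions in \<open>M\<close> and in
  \<open>L\<close>; so the pairs \<open>(t, j t)\<close> and their joins with a pair
  \<open>(xs i, ys i)\<close> form a subalgebra of the product, to which
  \<open>embedding_of_graph\<close> applies.\<close>

lemma extend_embedding:
  fixes xs :: "'i \<Rightarrow> 'a" and ys :: "'i \<Rightarrow> 'b" and M :: "'a cbs_sig" and L :: "'b cbs_sig"
  assumes "cbs M" "cbs L" and T: "sub_cbs T M" and j: "cbs_embedding j (restrict_to M T) L"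
    and xs: "\<And>i. xs i \<in> carrier M" "\<And>i. xs i \<notin> T"
    and ys: "\<And>i. ys i \<in> carrier L" "\<And>i. ys i \<notin> j ` T"
    and A: "\<And>i t. t \<in> T \<Longrightarrow> (\<exists>u\<in>T. t \<ominus>\<^bsub>M\<^esub> xs i = u \<and> j t \<ominus>\<^bsub>L\<^esub> ys i = j u) \<or>
      (\<exists>u\<in>T. \<exists>k. t \<ominus>\<^bsub>M\<^esub> xs i = u \<squnion>\<^bsub>M\<^esub> xs k \<and> j t \<ominus>\<^bsub>L\<^esub> ys i = j u \<squnion>\<^bsub>L\<^esub> ys k)"
    and B: "\<And>i t. t \<in> T \<Longrightarrow> xs i \<ominus>\<^bsub>M\<^esub> t = \<zero>\<^bsub>M\<^esub> \<and> ys i \<ominus>\<^bsub>L\<^esub> j t = \<zero>\<^bsub>L\<^esub> \<or>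
      xs i \<ominus>\<^bsub>M\<^esub> t = xs i \<and> ys i \<ominus>\<^bsub>L\<^esub> j t = ys i"
    and C: "\<And>i k. i \<noteq> k \<Longrightarrow> xs i \<ominus>\<^bsub>M\<^esub> xs k = xs i \<and> ys i \<ominus>\<^bsub>L\<^esub> ys k = ys i"
    and D: "\<And>i k. i \<noteq> k \<Longrightarrow> xs i \<squnion>\<^bsub>M\<^esub> xs k \<in> T \<and> ys i \<squnion>\<^bsub>L\<^esub> ys k = j (xs i \<squnion>\<^bsub>M\<^esub> xs k)"
  obtains f T' where "T \<subset> T'" "sub_cbs T' M" "cbs_embedding f (restrict_to M T') L"
    "\<And>t. t \<in> T \<Longrightarrow> f t = j t"
proof -
  interpret M: cbs M by fact
  interpret L: cbs L by fact
  note T' = sub_cbsD[OF T]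
  have Tc: "t \<in> carrier M" if "t \<in> T" for t using T'(1) that by blast
  have jc: "j t \<in> carrier L" if "t \<in> T" for t using cbs_embeddingD(1)[OF j] that by simp
  have j0: "j \<zero>\<^bsub>M\<^esub> = \<zero>\<^bsub>L\<^esub>" using cbs_embeddingD(3)[OF j] by simp
  have jj: "j (s \<squnion>\<^bsub>M\<^esub> t) = j s \<squnion>\<^bsub>L\<^esub> j t" "j (s \<ominus>\<^bsub>M\<^esub> t) = j s \<ominus>\<^bsub>L\<^esub> j t" if "s \<in> T" "t \<in> T" for s t
    using cbs_embeddingD(4,5)[OF j] that by simp_all
  note cl = Tc jc xs(1) ys(1) T'(2-4) M.join_closed M.diff_closed L.join_closed L.diff_closed
  define R where "R = {(t, j t) | t. t \<in> T} \<union> {(t \<squnion>\<^bsub>M\<^esub> xs i, j t \<squnion>\<^bsub>L\<^esub> ys i) | t i. t \<in> T}"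
  have R1: "(t, j t) \<in> R" if "t \<in> T" for t using that by (auto simp: R_def)
  have R2: "(t \<squnion>\<^bsub>M\<^esub> xs i, j t \<squnion>\<^bsub>L\<^esub> ys i) \<in> R" if "t \<in> T" for t i
    using that by (auto simp: R_def)
  have R0: "(\<zero>\<^bsub>M\<^esub>, \<zero>\<^bsub>L\<^esub>) \<in> R" using R1[OF T'(2)] j0 by simp
  have Rx: "(xs i, ys i) \<in> R" for i
    using R2[OF T'(2), of i] j0 xs(1) ys(1) by simp
  have RE: thesis if "(a, b) \<in> R" "\<And>t. \<lbrakk>t \<in> T; a = t; b = j t\<rbrakk> \<Longrightarrow> thesis"
    "\<And>t i. \<lbrakk>t \<in> T; a = t \<squnion>\<^bsub>M\<^esub> xs i; b = j t \<squnion>\<^bsub>L\<^esub> ys i\<rbrakk> \<Longrightarrow> thesis" for a b thesis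
    using that unfolding R_def by blast
  have sub: "R \<subseteq> carrier M \<times> carrier L"
    unfolding R_def using cl by auto
  have RJ: "(a \<squnion>\<^bsub>M\<^esub> c, b \<squnion>\<^bsub>L\<^esub> d) \<in> R" if ab: "(a, b) \<in> R" and cd: "(c, d) \<in> R" for a b c d
    using ab
  proof (rule RE)
    fix t assume t: "t \<in> T" "a = t" "b = j t"
    show ?thesis
      using cd
    proof (rule RE)
      fix s assume s: "s \<in> T" "c = s" "d = j s"
      show ?thesis using R1[of "t \<squnion>\<^bsub>M\<^esub> s"] s t T'(3) by (simp add: jj)
    next
      fix s i assume s: "s \<in> T" "c = s \<squnion>\<^bsub>M\<^esub> xs i" "d = j s \<squnion>\<^bsub>L\<^esub> ys i"
      show ?thesis using R2[of "t \<squnion>\<^bsub>M\<^esub> s" i] s t by (simp add: cl jj M.join_assoc L.join_assoc)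
    qed
  next
    fix t k assume t: "t \<in> T" "a = t \<squnion>\<^bsub>M\<^esub> xs k" "b = j t \<squnion>\<^bsub>L\<^esub> ys k"
    show ?thesis
      using cd
    proof (rule RE)
      fix s assume s: "s \<in> T" "c = s" "d = j s"
      show ?thesis using R2[of "t \<squnion>\<^bsub>M\<^esub> s" k] s t by (simp add: cl jj M.join_ac L.join_ac)
    next
      fix s i assume s: "s \<in> T" "c = s \<squnion>\<^bsub>M\<^esub> xs i" "d = j s \<squnion>\<^bsub>L\<^esub> ys i"
      show ?thesis
      proof (cases "i = k")
        case True
        then show ?thesis using R2[of "t \<squnion>\<^bsub>M\<^esub> s" i] s t by (simp add: cl jj M.join_ac L.join_ac)
      next
        \<comment> \<open>Two different new elements join to an element of \<open>T\<close> by
          \<open>D\<close>, so the result has no new summand left.\<close>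
        case False
        have "a \<squnion>\<^bsub>M\<^esub> c = (t \<squnion>\<^bsub>M\<^esub> s) \<squnion>\<^bsub>M\<^esub> (xs i \<squnion>\<^bsub>M\<^esub> xs k)"
          using s t by (simp add: cl M.join_ac)
        moreover have "b \<squnion>\<^bsub>L\<^esub> d = (j t \<squnion>\<^bsub>L\<^esub> j s) \<squnion>\<^bsub>L\<^esub> (ys i \<squnion>\<^bsub>L\<^esub> ys k)"
          using s t by (simp add: cl L.join_ac)
        ultimately show ?thesis
          using R1[of "(t \<squnion>\<^bsub>M\<^esub> s) \<squnion>\<^bsub>M\<^esub> (xs i \<squnion>\<^bsub>M\<^esub> xs k)"] D[OF False] s t T'(3)
          by (simp add: jj)
      qed
    qed
  qed
  have RA: "(t \<ominus>\<^bsub>M\<^esub> xs i, j t \<ominus>\<^bsub>L\<^esub> ys i) \<in> R" if t: "t \<in> T" for t i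
    using A[OF t, of i] R1 R2 by auto
  have RD: "(a \<ominus>\<^bsub>M\<^esub> c, b \<ominus>\<^bsub>L\<^esub> d) \<in> R" if ab: "(a, b) \<in> R" and cd: "(c, d) \<in> R" for a b c d
    using ab
  proof (rule RE)
    fix t assume t: "t \<in> T" "a = t" "b = j t"
    show ?thesis
      using cd
    proof (rule RE)
      fix s assume s: "s \<in> T" "c = s" "d = j s"
      show ?thesis using R1[of "t \<ominus>\<^bsub>M\<^esub> s"] s t T'(4) by (simp add: jj)
    next
      fix s i assume s: "s \<in> T" "c = s \<squnion>\<^bsub>M\<^esub> xs i" "d = j s \<squnion>\<^bsub>L\<^esub> ys i"
      show ?thesis
        using RA[OF T'(4)[OF t(1) s(1)], of i] s t by (simp add: cl jj M.diff_join L.diff_join)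
    qed
  next
    fix t k assume t: "t \<in> T" "a = t \<squnion>\<^bsub>M\<^esub> xs k" "b = j t \<squnion>\<^bsub>L\<^esub> ys k"
    show ?thesis
      using cd
    proof (rule RE)
      fix s assume s: "s \<in> T" "c = s" "d = j s"
      have "(xs k \<ominus>\<^bsub>M\<^esub> s, ys k \<ominus>\<^bsub>L\<^esub> j s) \<in> R"
        using B[OF s(1), of k] Rx R0 by auto
      then show ?thesis
        using RJ[OF R1[OF T'(4)[OF t(1) s(1)]]] s t
        by (simp add: cl jj M.join_diff_distrib L.join_diff_distrib)
    next
      fix s i assume s: "s \<in> T" "c = s \<squnion>\<^bsub>M\<^esub> xs i" "d = j s \<squnion>\<^bsub>L\<^esub> ys i"
      have "(xs k \<ominus>\<^bsub>M\<^esub> s \<ominus>\<^bsub>M\<^esub> xs i, ys k \<ominus>\<^bsub>L\<^esub> j s \<ominus>\<^bsub>L\<^esub> ys i) \<in> R"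
      proof (cases "i = k")
        case True
        have "xs k \<ominus>\<^bsub>M\<^esub> s \<ominus>\<^bsub>M\<^esub> xs k = \<zero>\<^bsub>M\<^esub>" "ys k \<ominus>\<^bsub>L\<^esub> j s \<ominus>\<^bsub>L\<^esub> ys k = \<zero>\<^bsub>L\<^esub>"
          using s xs ys by (simp_all add: cl)
        then show ?thesis using R0 True by simp
      next
        case False
        then show ?thesis
          using B[OF s(1), of k] C[of k i] Rx R0 xs(1)[of i] ys(1)[of i] by auto
      qed
      then show ?thesis
        using RJ[OF RA[OF T'(4)[OF t(1) s(1)]], of _ _ i] s t
        by (simp add: cl jj M.join_diff_distrib L.join_diff_distrib M.diff_join L.diff_join)
    qed
  qed
  have zero: "a = \<zero>\<^bsub>M\<^esub> \<longleftrightarrow> b = \<zero>\<^bsub>L\<^esub>" if ab: "(a, b) \<in> R" for a b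
    using ab
  proof (rule RE)
    fix t assume t: "t \<in> T" "a = t" "b = j t"
    then show ?thesis using cbs_embedding_eq_iff[OF j, of t "\<zero>\<^bsub>M\<^esub>"] j0 T'(2) by simp
  next
    fix t i assume t: "t \<in> T" "a = t \<squnion>\<^bsub>M\<^esub> xs i" "b = j t \<squnion>\<^bsub>L\<^esub> ys i"
    have "a \<noteq> \<zero>\<^bsub>M\<^esub>"
    proof
      assume "a = \<zero>\<^bsub>M\<^esub>"
      then have "xs i \<sqsubseteq>\<^bsub>M\<^esub> \<zero>\<^bsub>M\<^esub>" using M.join_upper2[of t "xs i"] t cl by simp
      then show False using xs[of i] T'(2) by simp
    qed
    moreover have "b \<noteq> \<zero>\<^bsub>L\<^esub>"
    proof
      assume "b = \<zero>\<^bsub>L\<^esub>"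
      then have "ys i \<sqsubseteq>\<^bsub>L\<^esub> \<zero>\<^bsub>L\<^esub>" using L.join_upper2[of "j t" "ys i"] t cl by simp
      then have "ys i = j \<zero>\<^bsub>M\<^esub>" using ys(1) j0 by simp
      then show False using ys(2)[of i] T'(2) by auto
    qed
    ultimately show ?thesis by simp
  qed
  obtain f where f: "sub_cbs (Domain R) M" "cbs_embedding f (restrict_to M (Domain R)) L"
    "\<And>a b. (a, b) \<in> R \<Longrightarrow> f a = b"
    using embedding_of_graph[OF assms(1,2) sub R0 RJ RD zero] by blast
  have "T \<subseteq> Domain R" using R1 by blast
  \<comment> \<open>\<open>undefined\<close> is just some index: the index type is nonempty, so the
    domain really grows.\<close>
  moreover have "xs undefined \<in> Domain R" using Rx by blast
  ultimately have "T \<subset> Domain R" using xs(2) by blast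
  then show ?thesis using that[OF _ f(1,2)] f(3) R1 by blast
qed

definition realizes_signatures :: "'a cbs_sig \<Rightarrow> bool" where
  "realizes_signatures L \<longleftrightarrow> (\<forall>S. finite S \<longrightarrow> sub_cbs S L \<longrightarrow>
      (\<forall>h G. signature1 (restrict_to L S) h G \<longrightarrow>
         (\<exists>x. primitive1 L S x \<and> induces1 L S x h G)) \<and>
      (\<forall>h1 h2 g. signature2 (restrict_to L S) h1 h2 g \<longrightarrow>
         (\<exists>x1 x2. primitive2 L S x1 x2 \<and> induces2 L S x1 x2 h1 h2 g)))"

lemma realizes_signaturesD:
  assumes "realizes_signatures L" "finite S" "sub_cbs S L"
  shows "signature1 (restrict_to L S) h G \<Longrightarrow> \<exists>x. primitive1 L S x \<and> induces1 L S x h G"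
    "signature2 (restrict_to L S) h1 h2 g \<Longrightarrow>
      \<exists>x1 x2. primitive2 L S x1 x2 \<and> induces2 L S x1 x2 h1 h2 g"
  using assms by (simp_all add: realizes_signatures_def)

lemma cbs_embedding_onto_image:
  assumes "cbs A" "cbs_embedding e A L"
  shows "cbs_embedding e A (restrict_to L (e ` carrier A))" "sub_cbs (e ` carrier A) L"
  using cbs_embedding_sub[OF assms(2) cbs.sub_carrier[OF assms(1)]] by simp_all

lemma cbs_with_subI:
  assumes "cbs L" "sub_cbs S L" "finite S" shows "cbs_with_sub L S"
proof -
  interpret cbs L by fact
  interpret S: cbs "restrict_to L S" by (rule restrict_cbs) fact
  show ?thesis by unfold_locales (use assms in auto)
qed

text \<open>The signature of a primitive element or couple of \<open>M\<close> over \<open>T\<close>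
  is transported along \<open>j\<close> and realized in \<open>L\<close>. The difference tables on
  both sides then agree, by \<open>primitive1_diff\<close> in the first case and by
  \<open>primitive2_diff\<close> with \<open>couple_diff\<close> in the second.\<close>

lemma extend_embedding_step:
  fixes M :: "'a cbs_sig" and L :: "'b cbs_sig"
  assumes "cbs M" "cbs L" and T: "sub_cbs T M" and j: "cbs_embedding j (restrict_to M T) L"
    and fin: "finite (carrier M)" and proper: "T \<noteq> carrier M" and real: "realizes_signatures L"
  obtains f T' where "T \<subset> T'" "sub_cbs T' M" "cbs_embedding f (restrict_to M T') L"
    "\<And>t. t \<in> T \<Longrightarrow> f t = j t"
proof -
  have finT: "finite T" using fin finite_subset sub_cbsD(1)[OF T] by blast
  interpret M: cbs_with_sub M T by (rule cbs_with_subI) fact+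
  have rT: "cbs (restrict_to M T)" by (rule M.S.cbs_axioms)
  let ?S = "j ` T"
  have S: "sub_cbs ?S L" and jS: "cbs_embedding j (restrict_to M T) (restrict_to L ?S)"
    using cbs_embedding_onto_image[OF rT j] by simp_all
  have finS: "finite ?S" using finT by simp
  interpret L: cbs_with_sub L ?S by (rule cbs_with_subI) fact+
  have rS: "cbs (restrict_to L ?S)" by (rule L.S.cbs_axioms)
  note iso = rT rS jS
  have onto: "j ` carrier (restrict_to M T) = carrier (restrict_to L ?S)" by simp
  have le: "j s \<sqsubseteq>\<^bsub>L\<^esub> j t \<longleftrightarrow> s \<sqsubseteq>\<^bsub>M\<^esub> t" if "s \<in> T" "t \<in> T" for s t
    using cbs_embedding_le_iff[OF iso, of s t] that by simp
  have jd: "j (s \<ominus>\<^bsub>M\<^esub> t) = j s \<ominus>\<^bsub>L\<^esub> j t" if "s \<in> T" "t \<in> T" for s t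
    using cbs_embeddingD(5)[OF j] that by simp
  from M.ex_primitive[OF fin proper] show ?thesis
  proof (elim disjE exE conjE)
    fix x h G
    assume sig: "signature1 (restrict_to M T) h G" and p: "primitive1 M T x"
      and i: "induces1 M T x h G"
    have sig': "signature1 (restrict_to L ?S) (j h) (j ` G)"
      using signature1_iso[OF iso onto sig] .
    then obtain y where p': "primitive1 L ?S y" and i': "induces1 L ?S y (j h) (j ` G)"
      using realizes_signaturesD(1)[OF real finS S sig'] by auto
    have h: "h \<in> T" and G: "G \<subseteq> T"
      using sig M.irr_in by (auto simp: signature1_def)
    note dx = M.primitive1_diff[OF sig p i] and dy = L.primitive1_diff[OF sig' p' i']
    show ?thesis
    proof (rule extend_embedding[OF assms(1-4), of "\<lambda>_::unit. x" "\<lambda>_. y"])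
      show "x \<in> carrier M" "x \<notin> T" "y \<in> carrier L" "y \<notin> j ` T"
        using p p' by (auto simp: primitive1_def)
    next
      fix t assume t: "t \<in> T"
      then have "t \<ominus>\<^bsub>M\<^esub> x = t \<ominus>\<^bsub>M\<^esub> h \<and> j t \<ominus>\<^bsub>L\<^esub> y = j (t \<ominus>\<^bsub>M\<^esub> h)"
        using dx(1)[OF t] dy(1)[of "j t"] h jd by simp
      then show "(\<exists>u\<in>T. t \<ominus>\<^bsub>M\<^esub> x = u \<and> j t \<ominus>\<^bsub>L\<^esub> y = j u) \<or>
        (\<exists>u\<in>T. \<exists>k::unit. t \<ominus>\<^bsub>M\<^esub> x = u \<squnion>\<^bsub>M\<^esub> x \<and> j t \<ominus>\<^bsub>L\<^esub> y = j u \<squnion>\<^bsub>L\<^esub> y)"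
        using M.diff_in[OF t h] by blast
      have "(\<exists>g\<in>j ` G. g \<sqsubseteq>\<^bsub>L\<^esub> j t) \<longleftrightarrow> (\<exists>g\<in>G. g \<sqsubseteq>\<^bsub>M\<^esub> t)"
        using le t G by auto
      then show "x \<ominus>\<^bsub>M\<^esub> t = \<zero>\<^bsub>M\<^esub> \<and> y \<ominus>\<^bsub>L\<^esub> j t = \<zero>\<^bsub>L\<^esub> \<or> x \<ominus>\<^bsub>M\<^esub> t = x \<and> y \<ominus>\<^bsub>L\<^esub> j t = y"
        using dx(2)[OF t] dy(2)[of "j t"] t by simp
    qed (use that in auto)
  next
    fix x1 x2 h1 h2 g
    assume sig: "signature2 (restrict_to M T) h1 h2 g" and p: "primitive2 M T x1 x2"
      and i: "induces2 M T x1 x2 h1 h2 g"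
    have sig': "signature2 (restrict_to L ?S) (j h1) (j h2) (j g)"
      using signature2_iso[OF iso onto _ sig] finT by simp
    then obtain y1 y2 where p': "primitive2 L ?S y1 y2"
      and i': "induces2 L ?S y1 y2 (j h1) (j h2) (j g)"
      using realizes_signaturesD(2)[OF real finS S sig'] by auto
    have h: "h1 \<in> T" "h2 \<in> T" and g: "M.irr g"
      using sig by (auto simp: signature2_def)
    have g': "L.irr (j g)" using sig' by (auto simp: signature2_def)
    have gT: "g \<in> T" using g M.irr_in by blast
    have gc: "g \<in> carrier M" "j g \<in> carrier L" using gT M.in_L L.in_L by auto
    note dx = M.primitive2_diff[OF sig p i] and dy = L.primitive2_diff[OF sig' p' i']
    have x: "x1 \<in> carrier M" "x2 \<in> carrier M" "x1 \<notin> T" "x2 \<notin> T"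
      using p by (auto simp: primitive2_def)
    have y: "y1 \<in> carrier L" "y2 \<in> carrier L" "y1 \<notin> ?S" "y2 \<notin> ?S"
      using p' by (auto simp: primitive2_def)
    have xg: "x1 \<sqsubseteq>\<^bsub>M\<^esub> g" "x2 \<sqsubseteq>\<^bsub>M\<^esub> g" using dx(1) x M.join_upper1 M.join_upper2 by metis+
    have yg: "y1 \<sqsubseteq>\<^bsub>L\<^esub> j g" "y2 \<sqsubseteq>\<^bsub>L\<^esub> j g" using dy(1) y L.join_upper1 L.join_upper2 by metis+
    \<comment> \<open>With \<open>bool\<close> as index, \<open>\<not> b\<close> is the other half
      of the couple, and each fact is proved once for both halves.\<close>
    define xs ys hs where "xs b = (if b then x1 else x2)" and "ys b = (if b then y1 else y2)"
      and "hs b = (if b then h1 else h2)" for b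
    have X: "xs b \<in> carrier M" "xs b \<notin> T" "xs b \<sqsubseteq>\<^bsub>M\<^esub> g" "g \<ominus>\<^bsub>M\<^esub> xs b = xs (\<not> b)" for b
      using x xg dx(2,3) by (auto simp: xs_def)
    have Y: "ys b \<in> carrier L" "ys b \<notin> ?S" "ys b \<sqsubseteq>\<^bsub>L\<^esub> j g" "j g \<ominus>\<^bsub>L\<^esub> ys b = ys (\<not> b)" for b
      using y yg dy(2,3) by (auto simp: ys_def)
    have hs: "hs b \<in> T" for b using h by (simp add: hs_def)
    have X2: "\<not> g \<sqsubseteq>\<^bsub>M\<^esub> t \<Longrightarrow> t \<ominus>\<^bsub>M\<^esub> xs b = t \<ominus>\<^bsub>M\<^esub> hs b" if "t \<in> T" for t b
      using dx(4,5)[OF that] by (simp add: xs_def hs_def)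
    have Y2: "\<not> j g \<sqsubseteq>\<^bsub>L\<^esub> t \<Longrightarrow> t \<ominus>\<^bsub>L\<^esub> ys b = t \<ominus>\<^bsub>L\<^esub> j (hs b)" if "t \<in> ?S" for t b
      using dy(4,5)[OF that] by (simp add: ys_def hs_def)
    \<comment> \<open>The half \<open>xs b\<close> is \<open>g\<close> minus the other half, and
      subtractions commute; so the effect of subtracting \<open>t\<close> is governed by the
      dichotomy for the irreducible \<open>g\<close>.\<close>
    have X3: "xs b \<ominus>\<^bsub>M\<^esub> t = (if g \<sqsubseteq>\<^bsub>M\<^esub> t then \<zero>\<^bsub>M\<^esub> else xs b)" if t: "t \<in> T" for b t
    proof (cases "g \<sqsubseteq>\<^bsub>M\<^esub> t")
      case True
      then show ?thesis using X[of b] M.in_L[OF t] gc M.le_trans[of "xs b" g t] by simp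
    next
      case False
      have "xs b \<ominus>\<^bsub>M\<^esub> t = g \<ominus>\<^bsub>M\<^esub> t \<ominus>\<^bsub>M\<^esub> xs (\<not> b)"
        using X(4)[of "\<not> b"] X(1) M.in_L[OF t] gc M.diff_diff_comm[of g "xs (\<not> b)" t] by simp
      then show ?thesis using M.irr_diff[OF g t False] False X(4)[of "\<not> b"] by simp
    qed
    have Y3: "ys b \<ominus>\<^bsub>L\<^esub> t = (if j g \<sqsubseteq>\<^bsub>L\<^esub> t then \<zero>\<^bsub>L\<^esub> else ys b)" if t: "t \<in> ?S" for b t
    proof (cases "j g \<sqsubseteq>\<^bsub>L\<^esub> t")
      case True
      then show ?thesis using Y[of b] L.in_L[OF t] gc L.le_trans[of "ys b" "j g" t] by simp
    next
      case False
      have "ys b \<ominus>\<^bsub>L\<^esub> t = j g \<ominus>\<^bsub>L\<^esub> t \<ominus>\<^bsub>L\<^esub> ys (\<not> b)"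
        using Y(4)[of "\<not> b"] Y(1) L.in_L[OF t] gc L.diff_diff_comm[of "j g" "ys (\<not> b)" t] by simp
      then show ?thesis using L.irr_diff[OF g' t False] False Y(4)[of "\<not> b"] by simp
    qed
    show ?thesis
    proof (rule extend_embedding[OF assms(1-4), of xs ys])
      fix t b assume t: "t \<in> T"
      have jt: "j t \<in> ?S" using t by blast
      have tg: "t \<ominus>\<^bsub>M\<^esub> g \<in> T" using M.diff_in t gT by blast
      have jtg: "j t \<ominus>\<^bsub>L\<^esub> j g \<in> ?S" using jd[OF t gT] tg by force
      have "t \<ominus>\<^bsub>M\<^esub> xs b = (if \<not> g \<sqsubseteq>\<^bsub>M\<^esub> t then t \<ominus>\<^bsub>M\<^esub> hs b
          else if g \<sqsubseteq>\<^bsub>M\<^esub> t \<ominus>\<^bsub>M\<^esub> g then t else (t \<ominus>\<^bsub>M\<^esub> g \<ominus>\<^bsub>M\<^esub> hs b) \<squnion>\<^bsub>M\<^esub> xs (\<not> b))"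
        by (rule M.couple_diff[OF M.in_L[OF t] gc(1) X(1) X(4) X(3) X2[OF t] X2[OF tg]])
      moreover have "j t \<ominus>\<^bsub>L\<^esub> ys b = (if \<not> j g \<sqsubseteq>\<^bsub>L\<^esub> j t then j t \<ominus>\<^bsub>L\<^esub> j (hs b)
          else if j g \<sqsubseteq>\<^bsub>L\<^esub> j t \<ominus>\<^bsub>L\<^esub> j g then j t
          else (j t \<ominus>\<^bsub>L\<^esub> j g \<ominus>\<^bsub>L\<^esub> j (hs b)) \<squnion>\<^bsub>L\<^esub> ys (\<not> b))"
        by (rule L.couple_diff[OF L.in_L[OF jt] gc(2) Y(1) Y(4) Y(3) Y2[OF jt] Y2[OF jtg]])
      moreover have "j g \<sqsubseteq>\<^bsub>L\<^esub> j t \<longleftrightarrow> g \<sqsubseteq>\<^bsub>M\<^esub> t" using le gT t by blast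
      moreover have "j g \<sqsubseteq>\<^bsub>L\<^esub> j t \<ominus>\<^bsub>L\<^esub> j g \<longleftrightarrow> g \<sqsubseteq>\<^bsub>M\<^esub> t \<ominus>\<^bsub>M\<^esub> g"
        using le[OF gT tg] jd[OF t gT] by metis
      moreover have "j t \<ominus>\<^bsub>L\<^esub> j (hs b) = j (t \<ominus>\<^bsub>M\<^esub> hs b)" using jd[OF t hs] by simp
      moreover have "j t \<ominus>\<^bsub>L\<^esub> j g \<ominus>\<^bsub>L\<^esub> j (hs b) = j (t \<ominus>\<^bsub>M\<^esub> g \<ominus>\<^bsub>M\<^esub> hs b)"
        using jd[OF t gT] jd[OF tg hs] by metis
      moreover have "t \<ominus>\<^bsub>M\<^esub> hs b \<in> T" "t \<ominus>\<^bsub>M\<^esub> g \<ominus>\<^bsub>M\<^esub> hs b \<in> T"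
        using M.diff_in t tg hs by blast+
      ultimately show "(\<exists>u\<in>T. t \<ominus>\<^bsub>M\<^esub> xs b = u \<and> j t \<ominus>\<^bsub>L\<^esub> ys b = j u) \<or>
        (\<exists>u\<in>T. \<exists>k. t \<ominus>\<^bsub>M\<^esub> xs b = u \<squnion>\<^bsub>M\<^esub> xs k \<and> j t \<ominus>\<^bsub>L\<^esub> ys b = j u \<squnion>\<^bsub>L\<^esub> ys k)"
        using t by metis
      show "xs b \<ominus>\<^bsub>M\<^esub> t = \<zero>\<^bsub>M\<^esub> \<and> ys b \<ominus>\<^bsub>L\<^esub> j t = \<zero>\<^bsub>L\<^esub> \<or>
          xs b \<ominus>\<^bsub>M\<^esub> t = xs b \<and> ys b \<ominus>\<^bsub>L\<^esub> j t = ys b"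
        using X3[OF t, of b] Y3[OF jt, of b] le[OF gT t] by simp
    next
      fix b c :: bool assume "b \<noteq> c"
      then have c: "c = (\<not> b)" by simp
      show "xs b \<ominus>\<^bsub>M\<^esub> xs c = xs b \<and> ys b \<ominus>\<^bsub>L\<^esub> ys c = ys b"
        using M.diff_diff_same[OF gc(1) X(1)[of c]] L.diff_diff_same[OF gc(2) Y(1)[of c]]
          X(4)[of c] Y(4)[of c] c by simp
      show "xs b \<squnion>\<^bsub>M\<^esub> xs c \<in> T \<and> ys b \<squnion>\<^bsub>L\<^esub> ys c = j (xs b \<squnion>\<^bsub>M\<^esub> xs c)"
        using dx(1) dy(1) gT x y c M.join_comm L.join_comm by (cases b) (simp_all add: xs_def ys_def)
    qed (use X Y that in auto)
  qed
qed

text \<open>Each application of \<open>extend_embedding_step\<close> lowers the number of elements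
  of \<open>M\<close> outside the domain and keeps the values already chosen.\<close>

lemma finite_extension_embeds:
  fixes M :: "'a cbs_sig" and L :: "'b cbs_sig"
  assumes "cbs M" "cbs L" "finite (carrier M)" "realizes_signatures L"
    and "sub_cbs T M" "cbs_embedding j (restrict_to M T) L"
  shows "\<exists>f. cbs_embedding f M L \<and> (\<forall>t\<in>T. f t = j t)"
  using assms(5,6)
proof (induction "card (carrier M - T)" arbitrary: T j rule: less_induct)
  case less
  show ?case
  proof (cases "T = carrier M")
    case True
    then show ?thesis using less.prems by auto
  next
    case False
    obtain f T' where T': "T \<subset> T'" "sub_cbs T' M"
      and f: "cbs_embedding f (restrict_to M T') L" "\<And>t. t \<in> T \<Longrightarrow> f t = j t"
      by (rule extend_embedding_step[OF assms(1,2) less.prems assms(3) False assms(4)]) (rule that)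
    have "carrier M - T' \<subset> carrier M - T"
      using T'(1) sub_cbsD(1)[OF T'(2)] by blast
    then have "card (carrier M - T') < card (carrier M - T)"
      using assms(3) by (simp add: psubset_card_mono)
    then obtain f' where "cbs_embedding f' M L" "\<forall>t\<in>T'. f' t = f t"
      using less.hyps[OF _ T'(2) f(1)] by auto
    then show ?thesis using f(2) T'(1) by fastforce
  qed
qed

subsection \<open>Realized signatures imply existential closedness\<close>

primrec term_vars :: "'a cbs_term \<Rightarrow> nat set" where
  "term_vars (Var n) = {n}"
| "term_vars (Param a) = {}"
| "term_vars Zero = {}"
| "term_vars (Join s t) = term_vars s \<union> term_vars t"
| "term_vars (Diff s t) = term_vars s \<union> term_vars t"

primrec form_vars :: "'a qf_form \<Rightarrow> nat set" where
  "form_vars (Eq s t) = term_vars s \<union> term_vars t"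
| "form_vars (Neg \<phi>) = form_vars \<phi>"
| "form_vars (And \<phi> \<psi>) = form_vars \<phi> \<union> form_vars \<psi>"
| "form_vars (Or \<phi> \<psi>) = form_vars \<phi> \<union> form_vars \<psi>"

lemma finite_term_vars: "finite (term_vars t)"
  by (induction t) auto

lemma finite_form_vars: "finite (form_vars \<phi>)"
  by (induction \<phi>) (auto simp: finite_term_vars)

lemma finite_term_params: "finite (term_params t)"
  by (induction t) auto

lemma finite_form_params: "finite (form_params \<phi>)"
  by (induction \<phi>) (auto simp: finite_term_params)

lemma term_val_restrict: "term_val (restrict_to M N) v t = term_val M v t"
  by (induction t) auto

lemma qf_sat_restrict: "qf_sat (restrict_to M N) v \<phi> \<longleftrightarrow> qf_sat M v \<phi>"
  by (induction \<phi>) (auto simp: term_val_restrict)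

text \<open>The maps run in opposite directions: \<open>e\<close> carries parameters into
  \<open>M\<close> and \<open>f\<close> leads back. Conditions are imposed only on the parameters
  and variables that occur, because \<open>f\<close> will undo \<open>e\<close> merely on a finite
  subalgebra.\<close>

lemma term_val_embedding:
  assumes "cbs M" "cbs_embedding f M L"
    and "\<And>a. a \<in> term_params t \<Longrightarrow> e a \<in> carrier M \<and> f (e a) = a"
    and "\<And>n. n \<in> term_vars t \<Longrightarrow> v n \<in> carrier M \<and> f (v n) = w n"
  shows "term_val M v (map_cbs_term e t) \<in> carrier M \<and>
    f (term_val M v (map_cbs_term e t)) = term_val L w t"
proof -
  interpret M: cbs M by fact
  show ?thesis
    using assms(3,4)
    by (induction t) (use cbs_embeddingD[OF assms(2)] in simp_all)
qed

lemma qf_sat_embedding: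
  assumes "cbs M" "cbs_embedding f M L"
    and "\<And>a. a \<in> form_params \<phi> \<Longrightarrow> e a \<in> carrier M \<and> f (e a) = a"
    and "\<And>n. n \<in> form_vars \<phi> \<Longrightarrow> v n \<in> carrier M \<and> f (v n) = w n"
  shows "qf_sat M v (map_qf_form e \<phi>) \<longleftrightarrow> qf_sat L w \<phi>"
  using assms(3,4)
proof (induction \<phi>)
  case (Eq s t)
  have s: "term_val M v (map_cbs_term e s) \<in> carrier M"
    "f (term_val M v (map_cbs_term e s)) = term_val L w s"
    using term_val_embedding[OF assms(1,2), of s e v w] Eq by simp_all
  have t: "term_val M v (map_cbs_term e t) \<in> carrier M"
    "f (term_val M v (map_cbs_term e t)) = term_val L w t"
    using term_val_embedding[OF assms(1,2), of t e v w] Eq by simp_all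
  show ?case using cbs_embedding_eq_iff[OF assms(2) s(1) t(1)] s(2) t(2) by simp
qed auto

lemma cbs_embedding_inverse:
  assumes "cbs A" "cbs_embedding e A B"
  shows "cbs_embedding (inv_into (carrier A) e) (restrict_to B (e ` carrier A)) A"
proof -
  interpret A: cbs A by fact
  note e = cbs_embeddingD[OF assms(2)]
  let ?g = "inv_into (carrier A) e"
  have g: "?g (e a) = a" if "a \<in> carrier A" for a
    using inv_into_f_f[OF e(2) that] .
  show ?thesis
    unfolding cbs_embedding_def
  proof (intro conjI ballI)
    show "?g ` carrier (restrict_to B (e ` carrier A)) \<subseteq> carrier A" using g by auto
    show "inj_on ?g (carrier (restrict_to B (e ` carrier A)))"
      by (simp add: inj_on_inv_into)
    show "?g \<zero>\<^bsub>restrict_to B (e ` carrier A)\<^esub> = \<zero>\<^bsub>A\<^esub>"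
      using g[OF A.zero_closed] e(3) by simp
  next
    fix x y
    assume "x \<in> carrier (restrict_to B (e ` carrier A))" "y \<in> carrier (restrict_to B (e ` carrier A))"
    then obtain a b where ab: "a \<in> carrier A" "b \<in> carrier A" "x = e a" "y = e b" by auto
    show "?g (x \<squnion>\<^bsub>restrict_to B (e ` carrier A)\<^esub> y) = ?g x \<squnion>\<^bsub>A\<^esub> ?g y"
      using g[of "a \<squnion>\<^bsub>A\<^esub> b"] e(4)[of a b] g ab by simp
    show "?g (x \<ominus>\<^bsub>restrict_to B (e ` carrier A)\<^esub> y) = ?g x \<ominus>\<^bsub>A\<^esub> ?g y"
      using g[of "a \<ominus>\<^bsub>A\<^esub> b"] e(5)[of a b] g ab by simp
  qed
qed

text \<open>The parameters generate a finite subalgebra \<open>S\<close>, and its image together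
  with the witnesses generates a finite subalgebra \<open>N\<close> of \<open>B\<close>. Embedding
  \<open>N\<close> into \<open>L\<close> so that \<open>e\<close> is undone on \<open>S\<close>
  brings the witnesses back to \<open>L\<close>.\<close>

lemma realizes_signatures_imp_existentially_closed:
  fixes L :: "'a cbs_sig"
  assumes L: "cbs L" and real: "realizes_signatures L"
  shows "existentially_closed TYPE('b) L"
  unfolding existentially_closed_def
proof (intro allI impI)
  fix B :: "'b cbs_sig" and e \<phi>
  assume B: "cbs B" and e: "cbs_embedding e L B" and par: "form_params \<phi> \<subseteq> carrier L"
    and "ex_true B (map_qf_form e \<phi>)"
  then obtain v where v: "range v \<subseteq> carrier B" "qf_sat B v (map_qf_form e \<phi>)"
    by (auto simp: ex_true_def)
  interpret L: cbs L by fact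
  interpret B: cbs B by fact
  define S where "S = span L (form_params \<phi>)"
  have S: "sub_cbs S L" "finite S"
    using L.span_sub[OF par] L.finite_span[OF finite_form_params par] by (simp_all add: S_def)
  have rS: "cbs (restrict_to L S)" using L.restrict_cbs[OF S(1)] .
  have Sc: "S \<subseteq> carrier L" using sub_cbsD(1)[OF S(1)] .
  have eS: "cbs_embedding e (restrict_to L S) B" "sub_cbs (e ` S) B"
    using cbs_embedding_sub[OF e S(1)] by simp_all
  define W where "W = e ` S \<union> v ` form_vars \<phi>"
  define N where "N = span B W"
  have W: "finite W" "W \<subseteq> carrier B"
    using S(2) finite_form_vars[of \<phi>] sub_cbsD(1)[OF eS(2)] v(1) by (auto simp: W_def)
  have N: "sub_cbs N B" "finite N"
    using B.span_sub[OF W(2)] B.finite_span[OF W] by (simp_all add: N_def)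
  have WN: "W \<subseteq> N" using span_base[of _ W B] by (auto simp: N_def)
  have rN: "cbs (restrict_to B N)" using B.restrict_cbs[OF N(1)] .
  have T: "sub_cbs (e ` S) (restrict_to B N)"
    using eS(2) WN by (auto simp: sub_cbs_def W_def)
  have "cbs_embedding (inv_into S e) (restrict_to B (e ` S)) (restrict_to L S)"
    using cbs_embedding_inverse[OF rS eS(1)] by simp
  then have "cbs_embedding (inv_into S e) (restrict_to (restrict_to B N) (e ` S)) L"
    using cbs_embedding_restrict_codomain[OF _ Sc] by simp
  then obtain f where f: "cbs_embedding f (restrict_to B N) L" "\<forall>t\<in>e ` S. f t = inv_into S e t"
    using finite_extension_embeds[OF rN L _ real T] N(2) by auto
  have inj: "inj_on e S" using cbs_embeddingD(2)[OF eS(1)] by simp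
  \<comment> \<open>The default zero only keeps the valuation inside \<open>carrier L\<close>, since
    \<open>f\<close> is controlled on \<open>N\<close> alone.\<close>
  define w where "w n = (if n \<in> form_vars \<phi> then f (v n) else \<zero>\<^bsub>L\<^esub>)" for n
  have "e a \<in> carrier (restrict_to B N) \<and> f (e a) = a" if "a \<in> form_params \<phi>" for a
  proof -
    have "a \<in> S" using that span_base[of a "form_params \<phi>" L] by (simp add: S_def)
    then show ?thesis using f(2) inv_into_f_f[OF inj] WN by (auto simp: W_def)
  qed
  moreover have vN: "v n \<in> carrier (restrict_to B N)" if "n \<in> form_vars \<phi>" for n
    using that WN by (auto simp: W_def)
  ultimately have "qf_sat L w \<phi>"
    using qf_sat_embedding[OF rN f(1), of \<phi> e v w] v(2) by (simp add: qf_sat_restrict w_def)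
  moreover have "w n \<in> carrier L" for n
    using cbs_embeddingD(1)[OF f(1) vN] by (simp add: w_def)
  ultimately show "ex_true L \<phi>" unfolding ex_true_def by blast
qed

subsection \<open>Lattices of down-sets\<close>

text \<open>For a preorder \<open>r\<close>, the difference is the down-closure of the set
  difference, that is, the least down-set whose union with \<open>B\<close> covers
  \<open>A\<close>.\<close>

definition down_sets :: "'z set \<Rightarrow> ('z \<Rightarrow> 'z \<Rightarrow> bool) \<Rightarrow> 'z set cbs_sig" where
  "down_sets Z r = \<lparr>carrier = {D. D \<subseteq> Z \<and> (\<forall>z\<in>D. \<forall>y\<in>Z. r y z \<longrightarrow> y \<in> D)},
     le = (\<subseteq>), zero = {}, join = (\<union>), diff = (\<lambda>A B. {y \<in> Z. \<exists>z\<in>A - B. r y z})\<rparr>"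

lemma down_sets_simps [simp]:
  "carrier (down_sets Z r) = {D. D \<subseteq> Z \<and> (\<forall>z\<in>D. \<forall>y\<in>Z. r y z \<longrightarrow> y \<in> D)}"
  "A \<sqsubseteq>\<^bsub>down_sets Z r\<^esub> B \<longleftrightarrow> A \<subseteq> B" "\<zero>\<^bsub>down_sets Z r\<^esub> = {}" "A \<squnion>\<^bsub>down_sets Z r\<^esub> B = A \<union> B"
  "A \<ominus>\<^bsub>down_sets Z r\<^esub> B = {y \<in> Z. \<exists>z\<in>A - B. r y z}"
  by (simp_all add: down_sets_def)

lemma cbs_down_sets:
  assumes refl: "\<And>z. z \<in> Z \<Longrightarrow> r z z"
    and trans: "\<And>x y z. \<lbrakk>x \<in> Z; y \<in> Z; z \<in> Z; r x y; r y z\<rbrakk> \<Longrightarrow> r x z"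
  shows "cbs (down_sets Z r)"
proof
  fix A B
  assume A: "A \<in> carrier (down_sets Z r)" and B: "B \<in> carrier (down_sets Z r)"
  have AZ: "A \<subseteq> Z" using A by simp
  have "x \<in> A \<ominus>\<^bsub>down_sets Z r\<^esub> B"
    if yx: "y \<in> A \<ominus>\<^bsub>down_sets Z r\<^esub> B" "x \<in> Z" "r x y" for x y
  proof -
    obtain z where "y \<in> Z" "z \<in> A" "z \<notin> B" "r y z" using yx(1) by auto
    then have "z \<in> A - B" "r x z" using trans[of x y z] yx(2,3) AZ by auto
    then show ?thesis using that(2) by auto
  qed
  then show "A \<ominus>\<^bsub>down_sets Z r\<^esub> B \<in> carrier (down_sets Z r)" by auto
  fix C assume C: "C \<in> carrier (down_sets Z r)"
  show "A \<ominus>\<^bsub>down_sets Z r\<^esub> B \<sqsubseteq>\<^bsub>down_sets Z r\<^esub> C \<longleftrightarrow> A \<sqsubseteq>\<^bsub>down_sets Z r\<^esub> B \<squnion>\<^bsub>down_sets Z r\<^esub> C"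
  proof
    assume le: "A \<ominus>\<^bsub>down_sets Z r\<^esub> B \<sqsubseteq>\<^bsub>down_sets Z r\<^esub> C"
    have "z \<in> C" if "z \<in> A" "z \<notin> B" for z
    proof -
      have "z \<in> A \<ominus>\<^bsub>down_sets Z r\<^esub> B" using that AZ refl[of z] by auto
      then show ?thesis using le by auto
    qed
    then show "A \<sqsubseteq>\<^bsub>down_sets Z r\<^esub> B \<squnion>\<^bsub>down_sets Z r\<^esub> C" by auto
  next
    assume le: "A \<sqsubseteq>\<^bsub>down_sets Z r\<^esub> B \<squnion>\<^bsub>down_sets Z r\<^esub> C"
    have "y \<in> C" if "y \<in> Z" "z \<in> A" "z \<notin> B" "r y z" for y z
    proof -
      have "z \<in> C" using le that by auto
      then show ?thesis using C that by simp
    qed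
    then show "A \<ominus>\<^bsub>down_sets Z r\<^esub> B \<sqsubseteq>\<^bsub>down_sets Z r\<^esub> C" by auto
  qed
qed auto

text \<open>Points are labelled by elements of \<open>L\<close>, and joins become unions whatever
  the labels are. For differences, a point \<open>y\<close> with \<open>a\<close> not below
  \<open>b \<squnion> \<pi> y\<close> has to be lifted to a point labelled
  \<open>b \<squnion> \<pi> y\<close>, which \<open>lift\<close> provides. Injectivity comes from
  \<open>surj\<close>: a point labelled \<open>b\<close> detects that \<open>a\<close> is not below
  \<open>b\<close>.\<close>

lemma embedding_down_sets:
  fixes L (structure)
  assumes "cbs L" and closed: "\<And>z. z \<in> Z \<Longrightarrow> \<pi> z \<in> carrier L"
    and mono: "\<And>y z. \<lbrakk>y \<in> Z; z \<in> Z; r y z\<rbrakk> \<Longrightarrow> \<pi> y \<sqsubseteq> \<pi> z"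
    and lift: "\<And>z c. \<lbrakk>z \<in> Z; c \<in> carrier L; \<pi> z \<sqsubseteq> c\<rbrakk> \<Longrightarrow> \<exists>y\<in>Z. r z y \<and> \<pi> y = c"
    and surj: "\<And>c. c \<in> carrier L \<Longrightarrow> \<exists>z\<in>Z. \<pi> z = c"
  shows "cbs_embedding (\<lambda>a. {z \<in> Z. \<not> a \<sqsubseteq> \<pi> z}) L (down_sets Z r)"
proof -
  interpret cbs L by fact
  let ?e = "\<lambda>a. {z \<in> Z. \<not> a \<sqsubseteq> \<pi> z}"
  have sep: "a \<sqsubseteq> b" if ab: "a \<in> carrier L" "b \<in> carrier L" "?e a = ?e b" for a b
  proof (rule ccontr)
    assume n: "\<not> a \<sqsubseteq> b"
    obtain z where "z \<in> Z" "\<pi> z = b" using surj ab by blast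
    then have "z \<in> ?e a" "z \<notin> ?e b" using n ab(1,2) by simp_all
    then show False using ab(3) by blast
  qed
  show ?thesis
    unfolding cbs_embedding_def
  proof (intro conjI ballI subsetI)
    fix D assume "D \<in> ?e ` carrier L"
    then obtain a where a: "a \<in> carrier L" "D = ?e a" by blast
    have "\<not> a \<sqsubseteq> \<pi> y" if "z \<in> Z" "\<not> a \<sqsubseteq> \<pi> z" "y \<in> Z" "r y z" for y z
      using le_trans[of a "\<pi> y" "\<pi> z"] that mono[of y z] closed a by blast
    then show "D \<in> carrier (down_sets Z r)" using a(2) by auto
  next
    show "inj_on ?e (carrier L)"
    proof (rule inj_onI)
      fix a b assume "a \<in> carrier L" "b \<in> carrier L" "?e a = ?e b"
      then show "a = b" using sep[of a b] sep[of b a] le_antisym[of a b] by simp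
    qed
    show "?e \<zero> = \<zero>\<^bsub>down_sets Z r\<^esub>" using closed by simp
  next
    fix a b assume ab: "a \<in> carrier L" "b \<in> carrier L"
    show "?e (a \<squnion> b) = ?e a \<squnion>\<^bsub>down_sets Z r\<^esub> ?e b"
      using ab closed by auto
    show "?e (a \<ominus> b) = ?e a \<ominus>\<^bsub>down_sets Z r\<^esub> ?e b"
    proof (intro set_eqI iffI)
      fix y assume "y \<in> ?e (a \<ominus> b)"
      then have y: "y \<in> Z" "\<not> a \<sqsubseteq> b \<squnion> \<pi> y" using ab closed by auto
      then obtain z where z: "z \<in> Z" "r y z" "\<pi> z = b \<squnion> \<pi> y"
        using lift[of y "b \<squnion> \<pi> y"] ab closed by auto
      then show "y \<in> ?e a \<ominus>\<^bsub>down_sets Z r\<^esub> ?e b" using y ab closed by auto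
    next
      fix y assume "y \<in> ?e a \<ominus>\<^bsub>down_sets Z r\<^esub> ?e b"
      then obtain z where y: "y \<in> Z" and z: "z \<in> Z" "\<not> a \<sqsubseteq> \<pi> z" "b \<sqsubseteq> \<pi> z" "r y z" by auto
      have "\<not> a \<ominus> b \<sqsubseteq> \<pi> y"
      proof
        assume "a \<ominus> b \<sqsubseteq> \<pi> y"
        then have "a \<ominus> b \<sqsubseteq> \<pi> z"
          using le_trans[of "a \<ominus> b" "\<pi> y" "\<pi> z"] mono[of y z] y z closed ab diff_closed by blast
        then have "a \<sqsubseteq> b \<squnion> \<pi> z" using ab closed z by simp
        then show False using z join_absorb(1)[OF z(3)] ab closed by simp
      qed
      then show "y \<in> ?e (a \<ominus> b)" using y by blast
    qed
  qed
qed

subsection \<open>Amalgamation over a finite subalgebra\<close>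

text \<open>Both projections must satisfy the lifting condition of
  \<open>embedding_down_sets\<close>. When one coordinate is raised, the other is joined with the
  largest element of \<open>S\<close> below the new value. Since the coordinates of a point have the
  same trace on \<open>S\<close>, the two embeddings agree there.\<close>

lemma amalgamation:
  fixes L :: "'a cbs_sig" and M :: "'c cbs_sig"
  assumes "cbs L" "cbs M" "finite S" "sub_cbs S L" and i: "cbs_embedding i (restrict_to L S) M"
  obtains B :: "('a \<times> 'c) set cbs_sig" and e k where "cbs B" "cbs_embedding e L B"
    "cbs_embedding k M B" "\<And>s. s \<in> S \<Longrightarrow> e s = k (i s)"
proof -
  interpret L: cbs_with_sub L S by (rule cbs_with_subI) fact+
  interpret M: cbs M by fact
  have rS: "cbs (restrict_to L S)" by (rule L.S.cbs_axioms)
  define Z where "Z = {(c, d). c \<in> carrier L \<and> d \<in> carrier M \<and> (\<forall>s\<in>S. s \<sqsubseteq>\<^bsub>L\<^esub> c \<longleftrightarrow> i s \<sqsubseteq>\<^bsub>M\<^esub> d)}"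
  define r where "r z z' \<longleftrightarrow> fst z \<sqsubseteq>\<^bsub>L\<^esub> fst z' \<and> snd z \<sqsubseteq>\<^bsub>M\<^esub> snd z'" for z z' :: "'a \<times> 'c"
  have ic: "i s \<in> carrier M" if "s \<in> S" for s using cbs_embeddingD(1)[OF i] that by simp
  have ile: "i s \<sqsubseteq>\<^bsub>M\<^esub> i t \<longleftrightarrow> s \<sqsubseteq>\<^bsub>L\<^esub> t" if "s \<in> S" "t \<in> S" for s t
    using cbs_embedding_le_iff[OF rS assms(2) i, of s t] that by simp
  have idiff: "i (s \<ominus>\<^bsub>L\<^esub> t) = i s \<ominus>\<^bsub>M\<^esub> i t" and ijoin: "i (s \<squnion>\<^bsub>L\<^esub> t) = i s \<squnion>\<^bsub>M\<^esub> i t"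
    if "s \<in> S" "t \<in> S" for s t
    using cbs_embeddingD(4,5)[OF i] that by simp_all
  have i0: "i \<zero>\<^bsub>L\<^esub> = \<zero>\<^bsub>M\<^esub>" using cbs_embeddingD(3)[OF i] by simp
  have Zc: "fst z \<in> carrier L" "snd z \<in> carrier M" if "z \<in> Z" for z
    using that by (auto simp: Z_def)
  have Ziff: "s \<sqsubseteq>\<^bsub>L\<^esub> fst z \<longleftrightarrow> i s \<sqsubseteq>\<^bsub>M\<^esub> snd z" if "z \<in> Z" "s \<in> S" for z s
    using that by (auto simp: Z_def)
  have greatestM: "\<exists>m\<in>S. i m \<sqsubseteq>\<^bsub>M\<^esub> d \<and> (\<forall>s\<in>S. i s \<sqsubseteq>\<^bsub>M\<^esub> d \<longrightarrow> s \<sqsubseteq>\<^bsub>L\<^esub> m)" if d: "d \<in> carrier M" for d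
  proof -
    let ?A = "{s \<in> S. i s \<sqsubseteq>\<^bsub>M\<^esub> d}"
    have A: "finite ?A" "?A \<subseteq> carrier L" "\<zero>\<^bsub>L\<^esub> \<in> ?A"
      using assms(3) L.in_L L.zero_in i0 d by auto
    have J: "a \<squnion>\<^bsub>L\<^esub> b \<in> ?A" if "a \<in> ?A" "b \<in> ?A" for a b
      using that L.join_in[of a b] ijoin[of a b] ic d by auto
    obtain m where "m \<in> ?A" "\<And>a. a \<in> ?A \<Longrightarrow> a \<sqsubseteq>\<^bsub>L\<^esub> m"
      by (rule L.finite_greatest[OF A J]) (assumption | rule that)+
    then show ?thesis by blast
  qed
  have liftL: "\<exists>y\<in>Z. r z y \<and> fst y = c" if z: "z \<in> Z" and c: "c \<in> carrier L" "fst z \<sqsubseteq>\<^bsub>L\<^esub> c" for z c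
  proof -
    obtain m where m: "m \<in> S" "m \<sqsubseteq>\<^bsub>L\<^esub> c" "\<And>s. \<lbrakk>s \<in> S; s \<sqsubseteq>\<^bsub>L\<^esub> c\<rbrakk> \<Longrightarrow> s \<sqsubseteq>\<^bsub>L\<^esub> m"
      using L.greatest_below[OF c(1)] by metis
    let ?d = "snd z \<squnion>\<^bsub>M\<^esub> i m"
    have "s \<sqsubseteq>\<^bsub>L\<^esub> c \<longleftrightarrow> i s \<sqsubseteq>\<^bsub>M\<^esub> ?d" if s: "s \<in> S" for s
    proof
      assume "s \<sqsubseteq>\<^bsub>L\<^esub> c"
      then show "i s \<sqsubseteq>\<^bsub>M\<^esub> ?d"
        using M.le_joinI2[of "i s" "i m" "snd z"] ile[OF s m(1)] m(3)[OF s] ic s m(1) Zc[OF z] by simp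
    next
      \<comment> \<open>No new element of \<open>S\<close> gets below the second coordinate without
        being below \<open>c\<close>: \<open>s \<ominus> m\<close> is in \<open>S\<close> and
        already below the old point, so \<open>s\<close> lies below
        \<open>m \<squnion> c = c\<close>.\<close>
      assume "i s \<sqsubseteq>\<^bsub>M\<^esub> ?d"
      then have "i (s \<ominus>\<^bsub>L\<^esub> m) \<sqsubseteq>\<^bsub>M\<^esub> snd z"
        using idiff[OF s m(1)] ic s m(1) Zc[OF z] by (simp add: M.join_comm)
      then have "s \<ominus>\<^bsub>L\<^esub> m \<sqsubseteq>\<^bsub>L\<^esub> fst z" using Ziff[OF z] L.diff_in[OF s m(1)] by blast
      then have "s \<ominus>\<^bsub>L\<^esub> m \<sqsubseteq>\<^bsub>L\<^esub> c"
        using L.le_trans[of "s \<ominus>\<^bsub>L\<^esub> m" "fst z" c] c Zc[OF z] L.in_L s m(1) L.diff_closed by blast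
      then have "s \<sqsubseteq>\<^bsub>L\<^esub> m \<squnion>\<^bsub>L\<^esub> c" using L.in_L s m(1) c by simp
      then show "s \<sqsubseteq>\<^bsub>L\<^esub> c" using L.join_absorb(1)[OF m(2)] L.in_L m(1) c by simp
    qed
    then have "(c, ?d) \<in> Z" using c Zc[OF z] ic m(1) by (simp add: Z_def)
    moreover have "r z (c, ?d)" using c Zc[OF z] ic m(1) by (simp add: r_def)
    ultimately show ?thesis by force
  qed
  have liftM: "\<exists>y\<in>Z. r z y \<and> snd y = d" if z: "z \<in> Z" and d: "d \<in> carrier M" "snd z \<sqsubseteq>\<^bsub>M\<^esub> d" for z d
  proof -
    obtain m where m: "m \<in> S" "i m \<sqsubseteq>\<^bsub>M\<^esub> d" "\<And>s. \<lbrakk>s \<in> S; i s \<sqsubseteq>\<^bsub>M\<^esub> d\<rbrakk> \<Longrightarrow> s \<sqsubseteq>\<^bsub>L\<^esub> m"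
      using greatestM[OF d(1)] by blast
    have mc: "m \<in> carrier L" using m L.in_L by blast
    let ?c = "fst z \<squnion>\<^bsub>L\<^esub> m"
    have "s \<sqsubseteq>\<^bsub>L\<^esub> ?c \<longleftrightarrow> i s \<sqsubseteq>\<^bsub>M\<^esub> d" if s: "s \<in> S" for s
    proof
      assume "i s \<sqsubseteq>\<^bsub>M\<^esub> d"
      then show "s \<sqsubseteq>\<^bsub>L\<^esub> ?c"
        using L.le_joinI2[of s m "fst z"] m(3)[OF s] L.in_L[OF s] mc Zc[OF z] by simp
    next
      assume "s \<sqsubseteq>\<^bsub>L\<^esub> ?c"
      then have "s \<ominus>\<^bsub>L\<^esub> m \<sqsubseteq>\<^bsub>L\<^esub> fst z"
        using L.in_L[OF s] mc Zc[OF z] by (simp add: L.join_comm)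
      then have "i (s \<ominus>\<^bsub>L\<^esub> m) \<sqsubseteq>\<^bsub>M\<^esub> snd z" using Ziff[OF z] L.diff_in[OF s m(1)] by blast
      then have "i s \<ominus>\<^bsub>M\<^esub> i m \<sqsubseteq>\<^bsub>M\<^esub> d"
        using M.le_trans[of "i s \<ominus>\<^bsub>M\<^esub> i m" "snd z" d] d Zc[OF z] ic[OF s] ic[OF m(1)]
          idiff[OF s m(1)] M.diff_closed by metis
      then have "i s \<sqsubseteq>\<^bsub>M\<^esub> i m \<squnion>\<^bsub>M\<^esub> d" using ic[OF s] ic[OF m(1)] d by simp
      then show "i s \<sqsubseteq>\<^bsub>M\<^esub> d" using M.join_absorb(1)[OF m(2)] ic[OF m(1)] d by simp
    qed
    then have "(?c, d) \<in> Z" using d Zc[OF z] mc by (simp add: Z_def)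
    moreover have "r z (?c, d)" using d Zc[OF z] mc by (simp add: r_def)
    ultimately show ?thesis by force
  qed
  have z0: "(\<zero>\<^bsub>L\<^esub>, \<zero>\<^bsub>M\<^esub>) \<in> Z"
    using ile[OF _ L.zero_in] i0 L.in_L ic by (simp add: Z_def)
  have "cbs (down_sets Z r)"
  proof (rule cbs_down_sets)
    fix x y z assume "x \<in> Z" "y \<in> Z" "z \<in> Z" "r x y" "r y z"
    then show "r x z"
      using L.le_trans[of "fst x" "fst y" "fst z"] M.le_trans[of "snd x" "snd y" "snd z"] Zc
      by (simp add: r_def)
  qed (use Zc in \<open>simp add: r_def\<close>)
  moreover have "cbs_embedding (\<lambda>a. {z \<in> Z. \<not> a \<sqsubseteq>\<^bsub>L\<^esub> fst z}) L (down_sets Z r)"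
  proof (rule embedding_down_sets[OF assms(1)])
    show "\<exists>z\<in>Z. fst z = c" if "c \<in> carrier L" for c using liftL[OF z0 that] that by auto
  qed (use Zc liftL in \<open>auto simp: r_def\<close>)
  moreover have "cbs_embedding (\<lambda>a. {z \<in> Z. \<not> a \<sqsubseteq>\<^bsub>M\<^esub> snd z}) M (down_sets Z r)"
  proof (rule embedding_down_sets[OF assms(2)])
    show "\<exists>z\<in>Z. snd z = c" if "c \<in> carrier M" for c using liftM[OF z0 that] that by auto
  qed (use Zc liftM in \<open>auto simp: r_def\<close>)
  moreover have "{z \<in> Z. \<not> s \<sqsubseteq>\<^bsub>L\<^esub> fst z} = {z \<in> Z. \<not> i s \<sqsubseteq>\<^bsub>M\<^esub> snd z}" if "s \<in> S" for s
    using Ziff[OF _ that] by auto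
  ultimately show ?thesis by (rule that)
qed

text \<open>Copies an extension into the type \<open>'b\<close>, over which existential closedness
  quantifies.\<close>

lemma cbs_transport:
  fixes B :: "'d cbs_sig" and u :: "'d \<Rightarrow> 'b"
  assumes "cbs B" and inj: "inj_on u (carrier B)"
  shows "\<exists>B' :: 'b cbs_sig. cbs B' \<and> cbs_embedding u B B'"
proof -
  interpret B: cbs B by fact
  define g where "g = inv_into (carrier B) u"
  have g: "g (u a) = a" if "a \<in> carrier B" for a
    using inv_into_f_f[OF inj that] by (simp add: g_def)
  define B' where "B' = \<lparr>carrier = u ` carrier B, le = (\<lambda>x y. g x \<sqsubseteq>\<^bsub>B\<^esub> g y), zero = u \<zero>\<^bsub>B\<^esub>,
    join = (\<lambda>x y. u (g x \<squnion>\<^bsub>B\<^esub> g y)), diff = (\<lambda>x y. u (g x \<ominus>\<^bsub>B\<^esub> g y))\<rparr>"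
  have B' [simp]: "carrier B' = u ` carrier B" "\<zero>\<^bsub>B'\<^esub> = u \<zero>\<^bsub>B\<^esub>"
    "x \<sqsubseteq>\<^bsub>B'\<^esub> y \<longleftrightarrow> g x \<sqsubseteq>\<^bsub>B\<^esub> g y" "x \<squnion>\<^bsub>B'\<^esub> y = u (g x \<squnion>\<^bsub>B\<^esub> g y)" "x \<ominus>\<^bsub>B'\<^esub> y = u (g x \<ominus>\<^bsub>B\<^esub> g y)"
    for x y
    by (simp_all add: B'_def)
  have "cbs B'"
  proof
    fix x y assume "x \<in> carrier B'" "y \<in> carrier B'" "x \<sqsubseteq>\<^bsub>B'\<^esub> y" "y \<sqsubseteq>\<^bsub>B'\<^esub> x"
    then show "x = y" using B.le_antisym[of "g x" "g y"] by (auto simp: g)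
  next
    fix x y z
    assume "x \<in> carrier B'" "y \<in> carrier B'" "z \<in> carrier B'" "x \<sqsubseteq>\<^bsub>B'\<^esub> y" "y \<sqsubseteq>\<^bsub>B'\<^esub> z"
    then show "x \<sqsubseteq>\<^bsub>B'\<^esub> z" using B.le_trans[of "g x" "g y" "g z"] by (auto simp: g)
  qed (auto simp: g)
  moreover have "cbs_embedding u B B'"
    using inj by (auto simp: cbs_embedding_def g)
  ultimately show ?thesis by blast
qed

section \<open>Size of generated subalgebras\<close>

context
  includes cardinal_syntax
begin

primrec span_stage :: "'a cbs_sig \<Rightarrow> 'a set \<Rightarrow> nat \<Rightarrow> 'a set" where
  "span_stage B W 0 = insert \<zero>\<^bsub>B\<^esub> W"
| "span_stage B W (Suc n) = span_stage B W n \<union>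
     ((\<lambda>(a, b). a \<squnion>\<^bsub>B\<^esub> b) ` (span_stage B W n \<times> span_stage B W n) \<union>
      (\<lambda>(a, b). a \<ominus>\<^bsub>B\<^esub> b) ` (span_stage B W n \<times> span_stage B W n))"

lemma span_stage_mono: "m \<le> n \<Longrightarrow> span_stage B W m \<subseteq> span_stage B W n"
  by (rule lift_Suc_mono_le) auto

lemma span_le_stages: "span B W \<subseteq> (\<Union>n. span_stage B W n)"
proof
  fix x assume "x \<in> span B W"
  then show "x \<in> (\<Union>n. span_stage B W n)"
  proof induction
    case span_zero
    have "\<zero>\<^bsub>B\<^esub> \<in> span_stage B W 0" by simp
    then show ?case by blast
  next
    case (span_base a)
    then have "a \<in> span_stage B W 0" by simp
    then show ?case by blast
  next
    case (span_join a b)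
    then obtain m n where "a \<in> span_stage B W m" "b \<in> span_stage B W n" by blast
    then have "a \<in> span_stage B W (max m n)" "b \<in> span_stage B W (max m n)"
      using span_stage_mono[of m "max m n" B W] span_stage_mono[of n "max m n" B W] by auto
    then have "a \<squnion>\<^bsub>B\<^esub> b \<in> span_stage B W (Suc (max m n))" by force
    then show ?case by blast
  next
    case (span_diff a b)
    then obtain m n where "a \<in> span_stage B W m" "b \<in> span_stage B W n" by blast
    then have "a \<in> span_stage B W (max m n)" "b \<in> span_stage B W (max m n)"
      using span_stage_mono[of m "max m n" B W] span_stage_mono[of n "max m n" B W] by auto
    then have "a \<ominus>\<^bsub>B\<^esub> b \<in> span_stage B W (Suc (max m n))" by force
    then show ?case by blast
  qed
qed

text \<open>The span is covered by countably many stages, each obtained from the previous one by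
  adding two images of its square. Neither these steps nor the countable union can exceed the
  infinite cardinal of \<open>'b\<close>.\<close>

lemma inj_on_span:
  assumes inf: "infinite (UNIV :: 'b set)" and W: "W = W1 \<union> W2"
    and W1: "inj_on (u :: 'a \<Rightarrow> 'b) W1" and W2: "finite W2"
  shows "\<exists>f :: 'a \<Rightarrow> 'b. inj_on f (span B W)"
proof -
  let ?U = "UNIV :: 'b set"
  have U: "\<not> finite (Field |?U| )" "Card_order |?U|"
    using inf card_of_Card_order[of ?U] by (simp_all only: Field_card_of not_False_eq_True)
  have fin: "|A| \<le>o |?U|" if "finite A" for A :: "'a set"
    using finite_ordLess_infinite[OF card_of_Well_order[of A] card_of_Well_order[of ?U]] that inf
    by (simp only: Field_card_of ordLess_imp_ordLeq not_False_eq_True)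
  have un: "|A \<union> C| \<le>o |?U|" if "|A| \<le>o |?U|" "|C| \<le>o |?U|" for A C :: "'a set"
    by (rule card_of_Un_ordLeq_infinite_Field[OF U(1) that U(2)])
  have im: "|f ` (A \<times> A)| \<le>o |?U|" if "|A| \<le>o |?U|" for A :: "'a set" and f :: "'a \<times> 'a \<Rightarrow> 'a"
    using card_of_image card_of_Times_ordLeq_infinite_Field[OF U(1) that that U(2)]
    by (rule ordLeq_transitive)
  have "|W1| \<le>o |?U|" using W1 card_of_ordLeq[of W1 ?U] by auto
  then have "|span_stage B W 0| \<le>o |?U|"
    using un[of W1 "insert \<zero>\<^bsub>B\<^esub> W2"] fin[of "insert \<zero>\<^bsub>B\<^esub> W2"] W2 by (simp add: W)
  then have "|span_stage B W n| \<le>o |?U|" for n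
    by (induction n) (auto intro!: un im)
  moreover have "|UNIV :: nat set| \<le>o |?U|"
    using inf infinite_iff_card_of_nat by blast
  ultimately have "|\<Union>n. span_stage B W n| \<le>o |?U|"
    using card_of_UNION_ordLeq_infinite[OF inf] by blast
  then have "|span B W| \<le>o |?U|"
    using card_of_mono1[OF span_le_stages] ordLeq_transitive by blast
  then show ?thesis using card_of_ordLeq[of "span B W" ?U] by blast
qed

end

subsection \<open>Existential closedness and finite extensions\<close>

primrec conj_list :: "'a qf_form list \<Rightarrow> 'a qf_form" where
  "conj_list [] = Eq Zero Zero"
| "conj_list (\<phi> # \<phi>s) = And \<phi> (conj_list \<phi>s)"

lemma qf_sat_conj_list: "qf_sat M v (conj_list \<phi>s) \<longleftrightarrow> (\<forall>\<phi>\<in>set \<phi>s. qf_sat M v \<phi>)"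
  by (induction \<phi>s) auto

lemma form_params_conj_list: "form_params (conj_list \<phi>s) = (\<Union>\<phi>\<in>set \<phi>s. form_params \<phi>)"
  by (induction \<phi>s) auto

lemma map_conj_list: "map_qf_form e (conj_list \<phi>s) = conj_list (map (map_qf_form e) \<phi>s)"
  by (induction \<phi>s) auto

text \<open>The variable \<open>x a\<close> names the element \<open>a\<close>, and the last block
  ties the images of \<open>S\<close> to parameters. If \<open>ms\<close> and \<open>ss\<close> list
  \<open>M\<close> and \<open>S\<close>, a valuation in \<open>L\<close> satisfying this formula
  composes with \<open>x\<close> to an embedding of \<open>M\<close> that undoes \<open>i\<close> on
  \<open>S\<close>.\<close>

definition diagram :: "'c cbs_sig \<Rightarrow> ('c \<Rightarrow> nat) \<Rightarrow> ('a \<Rightarrow> 'c) \<Rightarrow> 'c list \<Rightarrow> 'a list \<Rightarrow> 'a qf_form" where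
  "diagram M x i ms ss = conj_list (Eq Zero (Var (x \<zero>\<^bsub>M\<^esub>)) #
     [Eq (Join (Var (x a)) (Var (x b))) (Var (x (a \<squnion>\<^bsub>M\<^esub> b))). a \<leftarrow> ms, b \<leftarrow> ms] @
     [Eq (Diff (Var (x a)) (Var (x b))) (Var (x (a \<ominus>\<^bsub>M\<^esub> b))). a \<leftarrow> ms, b \<leftarrow> ms] @
     [Neg (Eq (Var (x a)) (Var (x b))). a \<leftarrow> ms, b \<leftarrow> ms, a \<noteq> b] @
     [Eq (Var (x (i s))) (Param s). s \<leftarrow> ss])"

lemma form_params_diagram: "form_params (diagram M x i ms ss) = set ss"
  unfolding diagram_def form_params_conj_list by auto

lemma qf_sat_diagram:
  "qf_sat N v (map_qf_form e (diagram M x i ms ss)) \<longleftrightarrow> \<zero>\<^bsub>N\<^esub> = v (x \<zero>\<^bsub>M\<^esub>) \<and>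
    (\<forall>a\<in>set ms. \<forall>b\<in>set ms. v (x a) \<squnion>\<^bsub>N\<^esub> v (x b) = v (x (a \<squnion>\<^bsub>M\<^esub> b))) \<and>
    (\<forall>a\<in>set ms. \<forall>b\<in>set ms. v (x a) \<ominus>\<^bsub>N\<^esub> v (x b) = v (x (a \<ominus>\<^bsub>M\<^esub> b))) \<and>
    (\<forall>a\<in>set ms. \<forall>b\<in>set ms. a \<noteq> b \<longrightarrow> v (x a) \<noteq> v (x b)) \<and>
    (\<forall>s\<in>set ss. v (x (i s)) = e s)"
  unfolding diagram_def map_conj_list qf_sat_conj_list
  by (simp add: ball_Un) (simp add: Ball_def imp_conjL)

lemma existentially_closed_extends:
  fixes L :: "'a cbs_sig" and M :: "'c cbs_sig"
  assumes L: "cbs L" and inf: "infinite (UNIV :: 'b set)" and u: "inj_on (u :: 'a \<Rightarrow> 'b) (carrier L)"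
    and ec: "existentially_closed TYPE('b) L"
    and S: "finite S" "sub_cbs S L"
    and M: "cbs M" "finite (carrier M)" and i: "cbs_embedding i (restrict_to L S) M"
  shows "\<exists>f. cbs_embedding f M L \<and> (\<forall>s\<in>S. f (i s) = s)"
proof -
  interpret L: cbs L by fact
  interpret M: cbs M by fact
  obtain B :: "('a \<times> 'c) set cbs_sig" and e k where B: "cbs B" and e: "cbs_embedding e L B"
    and k: "cbs_embedding k M B" and ek: "\<And>s. s \<in> S \<Longrightarrow> e s = k (i s)"
    by (rule amalgamation[OF L M(1) S i]) (rule that)
  interpret B: cbs B by fact
  let ?W = "e ` carrier L \<union> k ` carrier M"
  \<comment> \<open>The whole amalgam may be too large to be copied into \<open>'b\<close>; the part
    generated by the two images is not, as \<open>L\<close> injects into \<open>'b\<close> and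
    \<open>M\<close> is finite.\<close>
  let ?N = "span B ?W"
  have "?W \<subseteq> carrier B" using cbs_embeddingD(1)[OF e] cbs_embeddingD(1)[OF k] by auto
  then have N: "sub_cbs ?N B" by (rule B.span_sub)
  have WN: "?W \<subseteq> ?N" using span_base[of _ ?W B] by blast
  have eN: "cbs_embedding e L (restrict_to B ?N)" and kN: "cbs_embedding k M (restrict_to B ?N)"
    using e k WN by (auto simp: cbs_embedding_def)
  have "inj_on (inv_into (carrier L) e) (e ` carrier L)" by (rule inj_on_inv_into) simp
  then have "inj_on (u \<circ> inv_into (carrier L) e) (e ` carrier L)"
    using u cbs_embeddingD(2)[OF e] by (intro comp_inj_on) (auto simp: inj_on_def)
  then obtain f :: "_ \<Rightarrow> 'b" where f: "inj_on f ?N"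
    using inj_on_span[OF inf refl, of _ "e ` carrier L" "k ` carrier M" B] M(2) by blast
  obtain B' :: "'b cbs_sig" where B': "cbs B'" and f': "cbs_embedding f (restrict_to B ?N) B'"
    using cbs_transport[OF B.restrict_cbs[OF N]] f by auto
  define e' k' where "e' = f \<circ> e" and "k' = f \<circ> k"
  have e': "cbs_embedding e' L B'" and k': "cbs_embedding k' M B'"
    unfolding e'_def k'_def using cbs_embedding_comp eN kN f' by blast+
  have ek': "e' s = k' (i s)" if "s \<in> S" for s using ek[OF that] by (simp add: e'_def k'_def)
  note k'D = cbs_embeddingD[OF k']
  interpret B': cbs B' by fact
  obtain x :: "'c \<Rightarrow> nat" where x: "inj_on x (carrier M)"
    using finite_imp_inj_to_nat_seg[OF M(2)] by blast
  obtain ms where ms: "set ms = carrier M" using finite_list[OF M(2)] by blast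
  obtain ss where ss: "set ss = S" using finite_list[OF S(1)] by blast
  let ?\<phi> = "diagram M x i ms ss"
  define v where "v n = (if n \<in> x ` carrier M then k' (inv_into (carrier M) x n) else \<zero>\<^bsub>B'\<^esub>)" for n
  have vx: "v (x a) = k' a" if "a \<in> carrier M" for a
    using that inv_into_f_f[OF x that] by (simp add: v_def)
  have ic: "i s \<in> carrier M" if "s \<in> S" for s using cbs_embeddingD(1)[OF i] that by simp
  have "range v \<subseteq> carrier B'"
    using k'D(1) inv_into_into[of _ x "carrier M"] by (auto simp: v_def)
  moreover have "qf_sat B' v (map_qf_form e' ?\<phi>)"
    unfolding qf_sat_diagram ms ss
    using vx k'D(3-5) ek' ic cbs_embedding_eq_iff[OF k'] by simp
  ultimately have "ex_true B' (map_qf_form e' ?\<phi>)" by (auto simp: ex_true_def)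
  moreover have "form_params ?\<phi> \<subseteq> carrier L"
    using sub_cbsD(1)[OF S(2)] ss by (simp add: form_params_diagram)
  ultimately have "ex_true L ?\<phi>"
    using ec B' e' unfolding existentially_closed_def by blast
  \<comment> \<open>Mapping by the identity changes nothing but gives the formula the shape required
    by \<open>qf_sat_diagram\<close>.\<close>
  then obtain w where w: "range w \<subseteq> carrier L" "qf_sat L w (map_qf_form id ?\<phi>)"
    by (auto simp: ex_true_def qf_form.map_id)
  note sat = w(2)[unfolded qf_sat_diagram ms ss]
  have "cbs_embedding (w \<circ> x) M L"
    using w(1) sat unfolding cbs_embedding_def inj_on_def by auto
  moreover have "\<forall>s\<in>S. (w \<circ> x) (i s) = s" using sat by simp
  ultimately show ?thesis by blast
qed

subsection \<open>Existential closedness realizes signatures\<close>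

context cbs_with_sub
begin

text \<open>\<open>u\<close> is a join of irreducible elements \<open>q\<close>, and each
  \<open>q \<ominus> t\<close> is \<open>\<zero>\<close> or \<open>q\<close>. So
  \<open>u \<ominus> t\<close> is the join of the irreducible elements below \<open>u\<close> that
  are not below \<open>t\<close>, and \<open>p\<close> must lie below one of them.\<close>

lemma irr_le_diff:
  assumes p: "irr p" and "t \<in> S" "u \<in> S" "p \<sqsubseteq> u \<ominus> t"
  shows "\<exists>p'. irr p' \<and> p \<sqsubseteq> p' \<and> p' \<sqsubseteq> u \<and> \<not> p' \<sqsubseteq> t"
proof -
  have tc: "t \<in> carrier L" and pc: "p \<in> carrier L" "p \<noteq> \<zero>"
    using assms irr_in irr_nonzero in_L by auto
  have "p \<sqsubseteq> u \<ominus> t \<longrightarrow> ?thesis"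
    using assms(3)
  proof (induction rule: irr_induct)
    case zero
    then show ?case using tc pc by simp
  next
    case (irreducible q)
    have qc: "q \<in> carrier L" using irreducible irr_in in_L by blast
    show ?case
    proof
      assume le: "p \<sqsubseteq> q \<ominus> t"
      have nq: "\<not> q \<sqsubseteq> t"
      proof
        assume "q \<sqsubseteq> t"
        then have "q \<ominus> t = \<zero>" using qc tc by simp
        then show False using le pc by simp
      qed
      then have "q \<ominus> t = q" using irr_diff irreducible assms(2) by blast
      then show "\<exists>p'. irr p' \<and> p \<sqsubseteq> p' \<and> p' \<sqsubseteq> q \<and> \<not> p' \<sqsubseteq> t"
        using le nq irreducible qc by auto
    qed
  next
    case (join a b)
    have c: "a \<in> carrier L" "b \<in> carrier L" using join in_L by auto
    show ?case
    proof
      assume "p \<sqsubseteq> (a \<squnion> b) \<ominus> t"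
      then have "p \<sqsubseteq> a \<ominus> t \<or> p \<sqsubseteq> b \<ominus> t"
        using irr_le_join[OF p diff_in[OF join(1) assms(2)] diff_in[OF join(2) assms(2)]] c tc
        by (simp add: join_diff_distrib)
      then obtain p' where p': "irr p'" "p \<sqsubseteq> p'" "p' \<sqsubseteq> a \<or> p' \<sqsubseteq> b" "\<not> p' \<sqsubseteq> t"
        using join by blast
      then show "\<exists>p'. irr p' \<and> p \<sqsubseteq> p' \<and> p' \<sqsubseteq> a \<squnion> b \<and> \<not> p' \<sqsubseteq> t"
        using irr_le_join[OF p'(1) join(1,2)] by blast
    qed
  qed
  then show ?thesis using assms(4) by blast
qed

text \<open>Read \<open>d z p\<close> as: the point \<open>z\<close> lies below the join-irreducible element \<open>p\<close>. Differences are
  preserved because below each \<open>p\<close> the points having \<open>p\<close> as least join-irreducible element above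
  them are cofinal.\<close>

lemma embedding_into_down_sets:
  fixes d :: "'z \<Rightarrow> 'a \<Rightarrow> bool"
  assumes down: "\<And>y z p. \<lbrakk>y \<in> Q; z \<in> Q; irr p; r y z; d z p\<rbrakk> \<Longrightarrow> d y p"
    and up: "\<And>z p p'. \<lbrakk>z \<in> Q; irr p; irr p'; d z p; p \<sqsubseteq> p'\<rbrakk> \<Longrightarrow> d z p'"
    and crit: "\<And>z p. \<lbrakk>z \<in> Q; irr p; d z p\<rbrakk> \<Longrightarrow>
      \<exists>y\<in>Q. r z y \<and> d y p \<and> (\<forall>p'. irr p' \<longrightarrow> d y p' \<longrightarrow> p \<sqsubseteq> p')"
    and nonempty: "\<And>p. irr p \<Longrightarrow> \<exists>z\<in>Q. d z p"
  shows "cbs_embedding (\<lambda>s. {z \<in> Q. \<exists>p. irr p \<and> p \<sqsubseteq> s \<and> d z p}) (restrict_to L S) (down_sets Q r)"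
proof -
  let ?e = "\<lambda>s. {z \<in> Q. \<exists>p. irr p \<and> p \<sqsubseteq> s \<and> d z p}"
  have irr_c: "p \<in> carrier L" if "irr p" for p using that irr_in in_L by blast
  \<comment> \<open>A point with \<open>p\<close> as least irreducible element above it tests
    whether \<open>p \<sqsubseteq> s\<close>. This yields injectivity and the preservation of
    differences.\<close>
  have crit_iff: "(y \<in> ?e s) \<longleftrightarrow> p \<sqsubseteq> s"
    if y: "irr p" "y \<in> Q" "d y p" "\<forall>p'. irr p' \<longrightarrow> d y p' \<longrightarrow> p \<sqsubseteq> p'" and s: "s \<in> S" for y p s
  proof
    assume "y \<in> ?e s"
    then obtain p' where p': "irr p'" "p' \<sqsubseteq> s" "d y p'" by blast
    then show "p \<sqsubseteq> s" using le_trans[of p p' s] y(4) irr_c[OF p'(1)] irr_c[OF y(1)] in_L[OF s] by blast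
  qed (use y in blast)
  have sep: "s \<sqsubseteq> t" if st: "s \<in> S" "t \<in> S" "?e s = ?e t" for s t
  proof (rule ccontr)
    assume "\<not> s \<sqsubseteq> t"
    then obtain p where p: "irr p" "p \<sqsubseteq> s" "\<not> p \<sqsubseteq> t" using irr_below st by blast
    obtain z where "z \<in> Q" "d z p" using nonempty[OF p(1)] by blast
    then obtain y where y: "y \<in> Q" "d y p" "\<forall>p'. irr p' \<longrightarrow> d y p' \<longrightarrow> p \<sqsubseteq> p'"
      using crit p(1) by blast
    have "y \<in> ?e s" "y \<notin> ?e t"
      using crit_iff[OF p(1) y st(1)] crit_iff[OF p(1) y st(2)] p by simp_all
    then show False using st(3) by blast
  qed
  show ?thesis
    unfolding cbs_embedding_def
  proof (intro conjI ballI subsetI)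
    fix D assume "D \<in> ?e ` carrier (restrict_to L S)"
    then obtain s where "D = ?e s" by blast
    then show "D \<in> carrier (down_sets Q r)" using down by auto
  next
    show "inj_on ?e (carrier (restrict_to L S))"
    proof (rule inj_onI)
      fix s t assume "s \<in> carrier (restrict_to L S)" "t \<in> carrier (restrict_to L S)" "?e s = ?e t"
      then show "s = t" using sep[of s t] sep[of t s] le_antisym[of s t] in_L by simp
    qed
    have "\<not> p \<sqsubseteq> \<zero>" if "irr p" for p using that irr_c irr_nonzero by simp
    then show "?e \<zero>\<^bsub>restrict_to L S\<^esub> = \<zero>\<^bsub>down_sets Q r\<^esub>" by auto
  next
    fix s t assume "s \<in> carrier (restrict_to L S)" "t \<in> carrier (restrict_to L S)"
    then have st: "s \<in> S" "t \<in> S" by simp_all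
    then have c: "s \<in> carrier L" "t \<in> carrier L" using in_L by auto
    show "?e (s \<squnion>\<^bsub>restrict_to L S\<^esub> t) = ?e s \<squnion>\<^bsub>down_sets Q r\<^esub> ?e t"
      using irr_le_join[OF _ st] by auto
    show "?e (s \<ominus>\<^bsub>restrict_to L S\<^esub> t) = ?e s \<ominus>\<^bsub>down_sets Q r\<^esub> ?e t"
    proof (intro set_eqI iffI)
      fix y assume "y \<in> ?e (s \<ominus>\<^bsub>restrict_to L S\<^esub> t)"
      then obtain p where p: "y \<in> Q" "irr p" "p \<sqsubseteq> s \<ominus> t" "d y p" by auto
      obtain p' where p': "irr p'" "p \<sqsubseteq> p'" "p' \<sqsubseteq> s" "\<not> p' \<sqsubseteq> t"
        using irr_le_diff[OF p(2) st(2,1) p(3)] by blast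
      then have "d y p'" using up p by blast
      then obtain z where z: "z \<in> Q" "r y z" "d z p'" "\<forall>q. irr q \<longrightarrow> d z q \<longrightarrow> p' \<sqsubseteq> q"
        using crit p(1) p'(1) by blast
      have "z \<in> ?e s" "z \<notin> ?e t"
        using crit_iff[OF p'(1) z(1,3,4) st(1)] crit_iff[OF p'(1) z(1,3,4) st(2)] p' by simp_all
      then show "y \<in> ?e s \<ominus>\<^bsub>down_sets Q r\<^esub> ?e t"
        unfolding down_sets_simps using z(2) p(1) by blast
    next
      fix y assume "y \<in> ?e s \<ominus>\<^bsub>down_sets Q r\<^esub> ?e t"
      then obtain z where z: "y \<in> Q" "r y z" "z \<in> ?e s" "z \<notin> ?e t"
        unfolding down_sets_simps by blast
      then obtain p where p: "irr p" "p \<sqsubseteq> s" "d z p" "z \<in> Q" by blast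
      then have "\<not> p \<sqsubseteq> t" using z(4) by blast
      then have "p \<ominus> t = p" using irr_diff p(1) st by blast
      then have "p \<sqsubseteq> s \<ominus> t" using diff_mono[OF p(2) irr_c[OF p(1)] c] by simp
      moreover have "d y p" using down z(1,2) p by blast
      ultimately show "y \<in> ?e (s \<ominus>\<^bsub>restrict_to L S\<^esub> t)" using p(1) z(1) by auto
    qed
  qed
qed

text \<open>Reduces realization in \<open>L\<close> to a computation in \<open>M\<close>. As
  \<open>f\<close> undoes \<open>i\<close> and sends \<open>x\<close> outside \<open>S\<close>, the
  weak inequalities checked in \<open>M\<close> amount to the strict ones of the definition.\<close>

lemma primitive1_transfer:
  assumes M: "cbs M" and i: "cbs_embedding i (restrict_to L S) M" and f: "cbs_embedding f M L"
    and fi: "\<And>s. s \<in> S \<Longrightarrow> f (i s) = s"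
    and x: "x \<in> carrier M" "x \<notin> i ` S"
    and diff: "\<And>a. irr a \<Longrightarrow> i a \<ominus>\<^bsub>M\<^esub> x \<in> i ` S" "\<And>a. irr a \<Longrightarrow> x \<ominus>\<^bsub>M\<^esub> i a = x \<or> x \<ominus>\<^bsub>M\<^esub> i a = \<zero>\<^bsub>M\<^esub>"
    and below: "\<And>a. irr a \<Longrightarrow> i a \<sqsubseteq>\<^bsub>M\<^esub> x \<longleftrightarrow> a \<sqsubseteq> h"
    and above: "\<And>a. irr a \<Longrightarrow> x \<sqsubseteq>\<^bsub>M\<^esub> i a \<longleftrightarrow> (\<exists>g\<in>G. g \<sqsubseteq> a)"
  shows "primitive1 L S (f x) \<and> induces1 L S (f x) h G"
proof -
  interpret M: cbs M by fact
  note fD = cbs_embeddingD[OF f]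
  have ic: "i s \<in> carrier M" if "s \<in> S" for s using cbs_embeddingD(1)[OF i] that by simp
  have fx: "f x \<notin> S"
  proof
    assume "f x \<in> S"
    then have "f (i (f x)) = f x" using fi by blast
    then have "i (f x) = x" using cbs_embedding_eq_iff[OF f ic x(1)] \<open>f x \<in> S\<close> by blast
    then show False using x(2) \<open>f x \<in> S\<close> by force
  qed
  have "a \<ominus> f x = f (i a \<ominus>\<^bsub>M\<^esub> x)" "f x \<ominus> a = f (x \<ominus>\<^bsub>M\<^esub> i a)"
    "a \<sqsubseteq> f x \<longleftrightarrow> i a \<sqsubseteq>\<^bsub>M\<^esub> x" "f x \<sqsubseteq> a \<longleftrightarrow> x \<sqsubseteq>\<^bsub>M\<^esub> i a" "a \<noteq> f x" if "irr a" for a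
  proof -
    have a: "a \<in> S" using irr_in[OF that] .
    show "a \<ominus> f x = f (i a \<ominus>\<^bsub>M\<^esub> x)" "f x \<ominus> a = f (x \<ominus>\<^bsub>M\<^esub> i a)"
      using fD(5)[OF ic[OF a] x(1)] fD(5)[OF x(1) ic[OF a]] fi[OF a] by simp_all
    show "a \<sqsubseteq> f x \<longleftrightarrow> i a \<sqsubseteq>\<^bsub>M\<^esub> x" "f x \<sqsubseteq> a \<longleftrightarrow> x \<sqsubseteq>\<^bsub>M\<^esub> i a"
      using cbs_embedding_le_iff[OF M cbs_axioms f ic[OF a] x(1)]
        cbs_embedding_le_iff[OF M cbs_axioms f x(1) ic[OF a]] fi[OF a] by simp_all
    show "a \<noteq> f x" using a fx by blast
  qed note * = this
  have "a \<ominus> f x \<in> S" if "irr a" for a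
    using diff(1)[OF that] fi *(1)[OF that] by auto
  moreover have "f x \<ominus> a = f x \<or> f x \<ominus> a = \<zero>" if "irr a" for a
    using diff(2)[OF that] fD(3) *(2)[OF that] by auto
  ultimately show ?thesis
    using fD(1)[OF x(1)] fx * below above by (simp add: primitive1_def induces1_def less_def) blast
qed

text \<open>Counterpart of \<open>primitive1_transfer\<close> for couples; \<open>\<not> b\<close>
  again denotes the complementary half.\<close>

lemma primitive2_transfer:
  assumes M: "cbs M" and i: "cbs_embedding i (restrict_to L S) M" and f: "cbs_embedding f M L"
    and fi: "\<And>s. s \<in> S \<Longrightarrow> f (i s) = s" and g: "irr g"
    and x: "\<And>b. x b \<in> carrier M" "\<And>b :: bool. x b \<notin> i ` S" "x True \<noteq> x False"
    and gx: "\<And>b. i g \<ominus>\<^bsub>M\<^esub> x b = x (\<not> b)" "i g = x True \<squnion>\<^bsub>M\<^esub> x False"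
    and diff: "\<And>a b. \<lbrakk>irr a; a \<sqsubset> g\<rbrakk> \<Longrightarrow> i a \<ominus>\<^bsub>M\<^esub> x b \<in> i ` S"
    and below: "\<And>a b. irr a \<Longrightarrow> i a \<sqsubseteq>\<^bsub>M\<^esub> x b \<longleftrightarrow> a \<sqsubseteq> hs b"
  shows "primitive2 L S (f (x True)) (f (x False)) \<and>
    induces2 L S (f (x True)) (f (x False)) (hs True) (hs False) g"
proof -
  interpret M: cbs M by fact
  note fD = cbs_embeddingD[OF f]
  have ic: "i s \<in> carrier M" if "s \<in> S" for s using cbs_embeddingD(1)[OF i] that by simp
  have gS: "g \<in> S" using irr_in[OF g] .
  have fx: "f (x b) \<notin> S" for b
  proof
    assume S: "f (x b) \<in> S"
    then have "f (i (f (x b))) = f (x b)" using fi by blast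
    then have "i (f (x b)) = x b" using cbs_embedding_eq_iff[OF f ic[OF S] x(1)] by blast
    then show False using x(2)[of b] S by force
  qed
  have *: "a \<ominus> f (x b) = f (i a \<ominus>\<^bsub>M\<^esub> x b)" if "a \<in> S" for a b
    using fD(5)[OF ic[OF that] x(1)] fi[OF that] by simp
  have "f (x True) \<noteq> f (x False)" using cbs_embedding_eq_iff[OF f x(1,1)] x(3) by blast
  moreover have "g \<ominus> f (x b) = f (x (\<not> b))" for b using *[OF gS] gx(1) by simp
  moreover have "a \<ominus> f (x b) \<in> S" if "irr a" "a \<sqsubset> g" for a b
    using diff[OF that, of b] *[OF irr_in[OF that(1)], of b] fi by auto
  ultimately have "primitive2 L S (f (x True)) (f (x False))"
    unfolding primitive2_def using fD(1)[OF x(1)] fx g by (intro conjI exI[of _ g]) simp_all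
  moreover have "a \<sqsubset> f (x b) \<longleftrightarrow> a \<sqsubseteq> hs b" if a: "irr a" for a b
  proof -
    have aS: "a \<in> S" using irr_in[OF a] .
    have "a \<noteq> f (x b)" using fx[of b] aS by blast
    then show ?thesis
      using cbs_embedding_le_iff[OF M cbs_axioms f ic[OF aS] x(1), of b] fi[OF aS] below[OF a, of b]
      by (simp add: less_def)
  qed
  moreover have "g = f (x True) \<squnion> f (x False)"
    using fD(4)[OF x(1,1), of True False] fi[OF gS] gx(2) by simp
  ultimately show ?thesis by (simp add: induces2_def)
qed

end

lemma finite_down_sets: "finite Q \<Longrightarrow> finite (carrier (down_sets Q r))"
  by (rule finite_subset[of _ "Pow Q"]) auto

lemma down_sets_diff_top:
  assumes "A \<in> carrier (down_sets Q r)" "m \<in> A" "m \<notin> B" "\<And>y. y \<in> A \<Longrightarrow> r y m"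
  shows "A \<ominus>\<^bsub>down_sets Q r\<^esub> B = A"
  using assms unfolding down_sets_simps by blast

lemma down_sets_diff_subset: "A \<subseteq> B \<Longrightarrow> A \<ominus>\<^bsub>down_sets Q r\<^esub> B = {}"
  unfolding down_sets_simps by blast

section \<open>Realizing signatures by adding or splitting a point\<close>

context cbs_with_sub
begin

text \<open>The new point \<open>None\<close> is put above the irreducible elements below
  \<open>h\<close> and below those above a member of \<open>G\<close>; its principal down-set
  \<open>?x\<close> is the element sought. As \<open>?x\<close> and the images of irreducible
  elements each have a largest point, the differences in question are all or nothing.\<close>

lemma extension_realizes_signature1:
  assumes sig: "signature1 (restrict_to L S) h G"
    and ext: "\<And>(M :: 'a option set cbs_sig) i. \<lbrakk>cbs M; finite (carrier M);
      cbs_embedding i (restrict_to L S) M\<rbrakk> \<Longrightarrow> \<exists>f. cbs_embedding f M L \<and> (\<forall>s\<in>S. f (i s) = s)"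
  shows "\<exists>x. primitive1 L S x \<and> induces1 L S x h G"
proof -
  have h: "h \<in> S" "h \<in> carrier L" and G: "\<And>g. g \<in> G \<Longrightarrow> irr g"
    and hG: "\<And>g. g \<in> G \<Longrightarrow> h \<sqsubset> g"
    using sig in_L by (auto simp: signature1_def less_def)
  have ic: "p \<in> carrier L" if "irr p" for p using that irr_in in_L by blast
  have Gc: "g \<in> carrier L" if "g \<in> G" for g using that G ic by blast
  have no: False if "g \<in> G" "g \<sqsubseteq> h" for g
    using that hG[of g] le_antisym[of g h] h Gc by (auto simp: less_def)
  define Q where "Q = insert None (Some ` {p. irr p})"
  define d where "d z p = (case z of Some q \<Rightarrow> q \<sqsubseteq> p | None \<Rightarrow> \<exists>g\<in>G. g \<sqsubseteq> p)" for z p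
  define r where "r z y = (case y of Some p \<Rightarrow> d z p
    | None \<Rightarrow> (case z of Some q \<Rightarrow> q \<sqsubseteq> h | None \<Rightarrow> True))" for z y
  have d_simps [simp]: "d (Some q) p \<longleftrightarrow> q \<sqsubseteq> p" "d None p \<longleftrightarrow> (\<exists>g\<in>G. g \<sqsubseteq> p)" for p q
    by (simp_all add: d_def)
  have r_simps [simp]: "r z (Some p) \<longleftrightarrow> d z p" "r (Some q) None \<longleftrightarrow> q \<sqsubseteq> h" "r None None" for z p q
    by (simp_all add: r_def)
  have up: "d z p'" if zp: "z \<in> Q" "d z p" "p \<sqsubseteq> p'" "p \<in> carrier L" "p' \<in> carrier L" for z p p'
  proof (cases z)
    case None
    then obtain g where "g \<in> G" "g \<sqsubseteq> p" using zp by auto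
    then show ?thesis using le_trans[of g p p'] Gc that None by auto
  next
    case (Some q)
    then have "irr q" using that by (auto simp: Q_def)
    then show ?thesis using le_trans[of q p p'] ic that Some by auto
  qed
  have down: "d y p" if yz: "y \<in> Q" "z \<in> Q" "p \<in> carrier L" "r y z" "d z p" for y z p
  proof (cases z)
    case (Some q)
    then have "irr q" using that by (auto simp: Q_def)
    then show ?thesis using up[of y q p] that Some ic by simp
  next
    case None
    obtain g where g: "g \<in> G" "g \<sqsubseteq> p" using yz None by auto
    show ?thesis
    proof (cases y)
      case (Some q)
      then have q: "irr q" "q \<sqsubseteq> h" using that None by (auto simp: Q_def)
      \<comment> \<open>Here \<open>h \<sqsubset> g\<close> makes the relation transitive through
        the new point.\<close>
      have "q \<sqsubseteq> g" using le_trans[of q h g] ic[OF q(1)] h Gc[OF g(1)] q(2) hG[OF g(1)]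
        by (simp add: less_def)
      then show ?thesis using le_trans[of q g p] ic[OF q(1)] Gc[OF g(1)] that g(2) Some by simp
    qed (use g in auto)
  qed
  have trans: "r x z" if "x \<in> Q" "y \<in> Q" "z \<in> Q" "r x y" "r y z" for x y z
  proof (cases z)
    case (Some p)
    then have "irr p" using that by (auto simp: Q_def)
    then show ?thesis using down[of x y p] that Some ic by simp
  next
    case None
    show ?thesis
    proof (cases x)
      case x: (Some q)
      then have q: "irr q" using that by (auto simp: Q_def)
      show ?thesis
      proof (cases y)
        case (Some p)
        then have p: "irr p" using that by (auto simp: Q_def)
        then show ?thesis using le_trans[of q p h] ic[OF q] ic[OF p] h that Some None x by simp
      qed (use that x None in simp)
    qed (use None in simp)
  qed
  let ?M = "down_sets Q r"
  let ?i = "\<lambda>s. {z \<in> Q. \<exists>p. irr p \<and> p \<sqsubseteq> s \<and> d z p}"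
  have M: "cbs ?M"
  proof (rule cbs_down_sets)
    show "r z z" if "z \<in> Q" for z using that ic by (cases z) (auto simp: Q_def)
  qed (use trans in blast)
  have finQ: "finite Q"
    using finite_subset[of "{p. irr p}" S] irr_in fin by (auto simp: Q_def)
  have i: "cbs_embedding ?i (restrict_to L S) ?M"
  proof (rule embedding_into_down_sets)
    fix z p assume z: "z \<in> Q" "irr p" "d z p"
    have "Some p \<in> Q \<and> r z (Some p) \<and> d (Some p) p \<and> (\<forall>p'. irr p' \<longrightarrow> d (Some p) p' \<longrightarrow> p \<sqsubseteq> p')"
      using z ic by (simp add: Q_def)
    then show "\<exists>y\<in>Q. r z y \<and> d y p \<and> (\<forall>p'. irr p' \<longrightarrow> d y p' \<longrightarrow> p \<sqsubseteq> p')" by blast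
  next
    fix p assume p: "irr p"
    then have "Some p \<in> Q" "d (Some p) p" using ic by (simp_all add: Q_def)
    then show "\<exists>z\<in>Q. d z p" by blast
  qed (use up down ic in blast)+
  let ?x = "{z \<in> Q. r z None}"
  have NQ: "None \<in> Q" by (simp add: Q_def)
  have "r y None" if "y \<in> Q" "z \<in> Q" "r y z" "r z None" for y z
    using trans[OF that(1,2) NQ that(3,4)] .
  then have x: "?x \<in> carrier ?M" unfolding down_sets_simps by blast
  have i_iff: "z \<in> ?i a \<longleftrightarrow> z \<in> Q \<and> d z a" if a: "irr a" for z a
    using up[of z _ a] a ic le_refl by blast
  have xa: "?x \<subseteq> ?i a \<longleftrightarrow> (\<exists>g\<in>G. g \<sqsubseteq> a)" if a: "irr a" for a
  proof
    assume "?x \<subseteq> ?i a"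
    moreover have "None \<in> ?x" by (simp add: Q_def)
    ultimately show "\<exists>g\<in>G. g \<sqsubseteq> a" using i_iff[OF a] by auto
  next
    assume "\<exists>g\<in>G. g \<sqsubseteq> a"
    then have "d None a" by simp
    then have "d z a" if "z \<in> ?x" for z
      using down[of z None a] that ic[OF a] by (auto simp: Q_def)
    then show "?x \<subseteq> ?i a" using i_iff[OF a] by blast
  qed
  have ax: "?i a \<subseteq> ?x \<longleftrightarrow> a \<sqsubseteq> h" if a: "irr a" for a
  proof
    assume "?i a \<subseteq> ?x"
    moreover have "Some a \<in> ?i a" using i_iff[OF a] a ic by (simp add: Q_def)
    ultimately have "Some a \<in> ?x" by (rule subsetD)
    then show "a \<sqsubseteq> h" by simp
  next
    assume ah: "a \<sqsubseteq> h"
    have "r z None" if z: "z \<in> Q" "d z a" for z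
    proof (rule trans[of z "Some a" None])
      show "Some a \<in> Q" "None \<in> Q" using a by (simp_all add: Q_def)
    qed (use z ah in simp_all)
    then show "?i a \<subseteq> ?x" using i_iff[OF a] by blast
  qed
  \<comment> \<open>A down-set coming from \<open>S\<close> that contains \<open>None\<close> also
    contains \<open>Some g\<close> for some \<open>g \<in> G\<close>, which \<open>?x\<close> does
    not, since \<open>g\<close> is not below \<open>h\<close>.\<close>
  have not_x: "?x \<noteq> ?i s" if s: "s \<in> S" for s
  proof
    assume eq: "?x = ?i s"
    have "None \<in> ?x" by (simp add: Q_def)
    then obtain p where p: "irr p" "p \<sqsubseteq> s" "d None p" unfolding eq by blast
    then obtain g where g: "g \<in> G" "g \<sqsubseteq> p" by auto
    have "g \<sqsubseteq> s" using le_trans[of g p s] p g Gc ic in_L s by blast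
    then have "Some g \<in> ?i s" using G[OF g(1)] ic[OF G[OF g(1)]] by (auto simp: Q_def)
    then have "Some g \<in> ?x" using eq by simp
    then show False using no[OF g(1)] by simp
  qed
  obtain f where f: "cbs_embedding f ?M L" "\<And>s. s \<in> S \<Longrightarrow> f (?i s) = s"
    using ext[OF M finite_down_sets[OF finQ] i] by blast
  have d1: "?i a \<ominus>\<^bsub>?M\<^esub> ?x \<in> ?i ` S" if a: "irr a" for a
  proof (cases "a \<sqsubseteq> h")
    case True
    then have "?i a \<ominus>\<^bsub>?M\<^esub> ?x = {}" using ax[OF a] by (intro down_sets_diff_subset) simp
    also have "\<dots> = ?i \<zero>" using cbs_embeddingD(3)[OF i] by simp
    finally show ?thesis using zero_in by blast
  next
    case False
    have "?i a \<ominus>\<^bsub>?M\<^esub> ?x = ?i a"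
    proof (rule down_sets_diff_top)
      show "?i a \<in> carrier ?M" using cbs_embeddingD(1)[OF i, of a] irr_in[OF a] by simp
      show "Some a \<in> ?i a" using i_iff[OF a, of "Some a"] a ic by (simp add: Q_def)
      show "Some a \<notin> ?x" using False by simp
      show "r y (Some a)" if "y \<in> ?i a" for y using that i_iff[OF a, of y] by simp
    qed
    then show ?thesis using irr_in[OF a] by blast
  qed
  have d2: "?x \<ominus>\<^bsub>?M\<^esub> ?i a = ?x \<or> ?x \<ominus>\<^bsub>?M\<^esub> ?i a = \<zero>\<^bsub>?M\<^esub>" if a: "irr a" for a
  proof (cases "\<exists>g\<in>G. g \<sqsubseteq> a")
    case True
    then have "?x \<ominus>\<^bsub>?M\<^esub> ?i a = {}" using xa[OF a] by (intro down_sets_diff_subset) simp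
    then show ?thesis by simp
  next
    case False
    have "?x \<ominus>\<^bsub>?M\<^esub> ?i a = ?x"
    proof (rule down_sets_diff_top[OF x])
      show "None \<in> ?x" using NQ by simp
      show "None \<notin> ?i a" using i_iff[OF a, of None] False by simp
    qed simp
    then show ?thesis by blast
  qed
  have "primitive1 L S (f ?x) \<and> induces1 L S (f ?x) h G"
  proof (rule primitive1_transfer[OF M i f x])
    show "?x \<notin> ?i ` S" using not_x by blast
  qed (use d1 d2 ax xa in simp_all)
  then show ?thesis by blast
qed


text \<open>The point \<open>g\<close> is replaced by two incomparable copies with the same points
  above them; \<open>Inr b\<close> is put above the irreducible elements below \<open>hs b\<close>.
  Since \<open>h1 \<squnion> h2\<close> is the predecessor of \<open>g\<close>, every irreducible
  element strictly below \<open>g\<close> lies below a copy, so the principal down-sets of the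
  copies join to the image of \<open>g\<close>.\<close>

lemma extension_realizes_signature2:
  assumes sig: "signature2 (restrict_to L S) h1 h2 g"
    and ext: "\<And>(M :: ('a + bool) set cbs_sig) i. \<lbrakk>cbs M; finite (carrier M);
      cbs_embedding i (restrict_to L S) M\<rbrakk> \<Longrightarrow> \<exists>f. cbs_embedding f M L \<and> (\<forall>s\<in>S. f (i s) = s)"
  shows "\<exists>x1 x2. primitive2 L S x1 x2 \<and> induces2 L S x1 x2 h1 h2 g"
proof -
  have h12: "h1 \<in> S" "h2 \<in> S" and g: "irr g"
    and eq: "h1 \<squnion> h2 = predecessor (restrict_to L S) g"
    using sig by (auto simp: signature2_def)
  have ic: "p \<in> carrier L" if "irr p" for p using that irr_in in_L by blast
  note gc = ic[OF g]
  have finS: "finite (carrier (restrict_to L S))" using fin by simp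
  note pred = S.predecessor_greatest[OF finS g]
  define hs where "hs b = (if b then h1 else h2)" for b
  have hsS: "hs b \<in> S" for b using h12 by (simp add: hs_def)
  then have hc: "hs b \<in> carrier L" for b using in_L by blast
  have h12c: "h1 \<in> carrier L" "h2 \<in> carrier L" using h12 in_L by auto
  have jg: "h1 \<squnion> h2 \<sqsubseteq> g" "h1 \<squnion> h2 \<noteq> g" using pred(2) eq by (auto simp: less_def)
  have hg: "hs b \<sqsubseteq> g" for b using jg(1) h12c gc by (simp add: hs_def)
  have gh: "\<not> g \<sqsubseteq> hs b" for b
  proof
    assume "g \<sqsubseteq> hs b"
    then have "g \<sqsubseteq> h1 \<squnion> h2" using irr_le_join[OF g h12] by (auto simp: hs_def split: if_splits)
    then show False using jg le_antisym[of g "h1 \<squnion> h2"] h12c gc by simp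
  qed
  have below_g: "q \<sqsubseteq> g \<longleftrightarrow> q \<sqsubseteq> hs b \<or> q \<sqsubseteq> hs (\<not> b)" if q: "irr q" "q \<noteq> g" for q b
  proof
    assume "q \<sqsubseteq> g"
    then have "q \<sqsubseteq> h1 \<squnion> h2" using pred(3)[of q] q irr_in eq by (simp add: less_def)
    then show "q \<sqsubseteq> hs b \<or> q \<sqsubseteq> hs (\<not> b)" using irr_le_join[OF q(1) h12] by (auto simp: hs_def)
  next
    assume "q \<sqsubseteq> hs b \<or> q \<sqsubseteq> hs (\<not> b)"
    then show "q \<sqsubseteq> g" using le_trans[OF ic[OF q(1)] hc gc _ hg] by blast
  qed
  define Q where "Q = Inl ` {p. irr p \<and> p \<noteq> g} \<union> range (Inr :: bool \<Rightarrow> 'a + bool)"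
  define d where "d z p = (case z of Inl q \<Rightarrow> q \<sqsubseteq> p | Inr (b::bool) \<Rightarrow> g \<sqsubseteq> p)" for z p
  define r where "r z y = (case y of Inl p \<Rightarrow> d z p
    | Inr b \<Rightarrow> (case z of Inl q \<Rightarrow> q \<sqsubseteq> hs b | Inr c \<Rightarrow> b = c))" for z y
  have d_simps [simp]: "d (Inl q) p \<longleftrightarrow> q \<sqsubseteq> p" "d (Inr b) p \<longleftrightarrow> g \<sqsubseteq> p" for p q b
    by (simp_all add: d_def)
  have r_simps [simp]: "r z (Inl p) \<longleftrightarrow> d z p" "r (Inl q) (Inr b) \<longleftrightarrow> q \<sqsubseteq> hs b"
    "r (Inr c) (Inr b) \<longleftrightarrow> b = c" for z p q b c
    by (simp_all add: r_def)
  have Inl_Q: "Inl p \<in> Q \<longleftrightarrow> irr p \<and> p \<noteq> g" and Inr_Q: "Inr b \<in> Q" for p b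
    by (auto simp: Q_def)
  have up: "d z p'" if "z \<in> Q" "d z p" "p \<sqsubseteq> p'" "p \<in> carrier L" "p' \<in> carrier L" for z p p'
  proof (cases z)
    case (Inl q)
    then have "irr q" using that Inl_Q by auto
    then show ?thesis using le_trans[of q p p'] ic that Inl by auto
  next
    case (Inr b)
    then show ?thesis using le_trans[of g p p'] gc that by auto
  qed
  have down: "d y p" if "y \<in> Q" "z \<in> Q" "p \<in> carrier L" "r y z" "d z p" for y z p
  proof (cases z)
    case (Inl q)
    then have "irr q" using that Inl_Q by auto
    then show ?thesis using up[of y q p] that Inl ic by simp
  next
    case (Inr b)
    then have gp: "g \<sqsubseteq> p" using that by simp
    show ?thesis
    proof (cases y)
      case y: (Inl q)
      then have q: "irr q" "q \<noteq> g" "q \<sqsubseteq> hs b" using that Inr Inl_Q by auto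
      then have "q \<sqsubseteq> g" using below_g[OF q(1,2), of b] by blast
      then show ?thesis using le_trans[of q g p] ic[OF q(1)] gc gp that y by simp
    qed (use gp in simp)
  qed
  have trans: "r x z" if "x \<in> Q" "y \<in> Q" "z \<in> Q" "r x y" "r y z" for x y z
  proof (cases z)
    case (Inl p)
    then have "irr p" using that Inl_Q by auto
    then show ?thesis using down[of x y p] that Inl ic by simp
  next
    case (Inr b)
    show ?thesis
    proof (cases y)
      case (Inr c)
      then show ?thesis using that \<open>z = Inr b\<close> by simp
    next
      case (Inl p)
      then have p: "irr p" "p \<sqsubseteq> hs b" using that \<open>z = Inr b\<close> Inl_Q by auto
      show ?thesis
      proof (cases x)
        case x: (Inl q)
        then have q: "irr q" "q \<sqsubseteq> p" using that Inl Inl_Q by auto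
        then show ?thesis using le_trans[OF ic[OF q(1)] ic[OF p(1)] hc q(2) p(2)] x \<open>z = Inr b\<close> by simp
      next
        case (Inr c)
        \<comment> \<open>This case is impossible: a copy of \<open>g\<close> below \<open>p\<close>
          with \<open>p \<sqsubseteq> hs b\<close> would put \<open>g\<close> below
          \<open>hs b\<close>.\<close>
        then have "g \<sqsubseteq> p" using that Inl by simp
        then show ?thesis using le_trans[OF gc ic[OF p(1)] hc _ p(2)] gh by blast
      qed
    qed
  qed
  let ?M = "down_sets Q r"
  let ?i = "\<lambda>s. {z \<in> Q. \<exists>p. irr p \<and> p \<sqsubseteq> s \<and> d z p}"
  have M: "cbs ?M"
  proof (rule cbs_down_sets)
    show "r z z" if "z \<in> Q" for z using that ic Inl_Q by (cases z) auto
  qed (use trans in blast)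
  have "finite {p. irr p \<and> p \<noteq> g}"
    using finite_subset[of "{p. irr p \<and> p \<noteq> g}" S] irr_in fin by auto
  then have finQ: "finite Q" by (simp add: Q_def)
  have i: "cbs_embedding ?i (restrict_to L S) ?M"
  proof (rule embedding_into_down_sets)
    fix z p assume z: "z \<in> Q" "irr p" "d z p"
    have "\<exists>y\<in>Q. r z y \<and> (\<forall>p'. d y p' \<longleftrightarrow> p \<sqsubseteq> p')"
    proof (cases "p = g")
      case False
      then have "Inl p \<in> Q \<and> r z (Inl p)" using z Inl_Q by simp
      then show ?thesis using d_simps(1)[of p] by blast
    next
      case True
      \<comment> \<open>There is no point \<open>Inl g\<close>; a point below \<open>g\<close> lies
        below one of the copies instead, and both copies have \<open>g\<close> as least irreducible
        element above them.\<close>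
      have "\<exists>b. r z (Inr b)"
      proof (cases z)
        case (Inl q)
        then have "q \<sqsubseteq> hs True \<or> q \<sqsubseteq> hs False"
          using below_g[of q True] z True Inl_Q by simp
        then show ?thesis using Inl by auto
      qed simp
      then show ?thesis using True Inr_Q d_simps(2) by blast
    qed
    then show "\<exists>y\<in>Q. r z y \<and> d y p \<and> (\<forall>p'. irr p' \<longrightarrow> d y p' \<longrightarrow> p \<sqsubseteq> p')"
      using le_refl ic z(2) by blast
  next
    fix p assume p: "irr p"
    show "\<exists>z\<in>Q. d z p"
    proof (cases "p = g")
      case True
      then have "d (Inr True) p" using gc by simp
      then show ?thesis using Inr_Q by blast
    next
      case False
      then have "Inl p \<in> Q" "d (Inl p) p" using p ic Inl_Q by simp_all
      then show ?thesis by blast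
    qed
  qed (use up down ic in blast)+
  let ?x = "\<lambda>b. {z \<in> Q. r z (Inr b)}"
  have "r y (Inr b)" if "y \<in> Q" "z \<in> Q" "r y z" "r z (Inr b)" for y z b
    using trans[OF that(1,2) Inr_Q that(3,4)] .
  then have x: "?x b \<in> carrier ?M" for b unfolding down_sets_simps by blast
  have i_iff: "z \<in> ?i a \<longleftrightarrow> z \<in> Q \<and> d z a" if a: "irr a" for z a
    using up[of z _ a] a ic le_refl by blast
  have ax: "?i a \<subseteq> ?x b \<longleftrightarrow> a \<sqsubseteq> hs b" if a: "irr a" for a b
  proof
    assume sub: "?i a \<subseteq> ?x b"
    show "a \<sqsubseteq> hs b"
    proof (cases "a = g")
      case True
      have "Inr (\<not> b) \<in> ?i a" using i_iff[OF a, of "Inr (\<not> b)"] True gc Inr_Q by simp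
      with sub have "Inr (\<not> b) \<in> ?x b" by (rule subsetD)
      then show ?thesis by simp
    next
      case False
      have "Inl a \<in> ?i a" using i_iff[OF a, of "Inl a"] a ic Inl_Q False by simp
      with sub have "Inl a \<in> ?x b" by (rule subsetD)
      then show ?thesis by simp
    qed
  next
    assume ah: "a \<sqsubseteq> hs b"
    then have "Inl a \<in> Q" using gh a Inl_Q by auto
    then have "r z (Inr b)" if z: "z \<in> Q" "d z a" for z
      using trans[of z "Inl a" "Inr b"] z ah Inr_Q by simp
    then show "?i a \<subseteq> ?x b" using i_iff[OF a] by blast
  qed
  \<comment> \<open>The copies lie below the same irreducible elements, so a down-set coming from
    \<open>S\<close> contains both or neither, while \<open>?x b\<close> contains only one.\<close>
  have not_x: "?x b \<noteq> ?i s" if s: "s \<in> S" for s b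
  proof
    assume eq: "?x b = ?i s"
    have "Inr b \<in> ?x b" using Inr_Q by simp
    then obtain p where p: "irr p" "p \<sqsubseteq> s" "g \<sqsubseteq> p" unfolding eq by auto
    then have "Inr (\<not> b) \<in> ?i s" using Inr_Q by auto
    then have "Inr (\<not> b) \<in> ?x b" using eq by simp
    then show False by simp
  qed
  have g_iff: "d z g \<longleftrightarrow> r z (Inr b) \<or> r z (Inr (\<not> b))" if "z \<in> Q" for z b
  proof (cases z)
    case (Inl q)
    then show ?thesis using below_g[of q b] that Inl_Q by simp
  next
    case (Inr c)
    then show ?thesis using gc by auto
  qed
  have ig: "?i g = ?x b \<union> ?x (\<not> b)" for b
    using i_iff[OF g] g_iff[of _ b] by blast
  have gx1: "?i g \<ominus>\<^bsub>?M\<^esub> ?x b = ?x (\<not> b)" for b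
  proof (intro set_eqI iffI)
    fix y assume "y \<in> ?i g \<ominus>\<^bsub>?M\<^esub> ?x b"
    then obtain z where z: "y \<in> Q" "r y z" "z \<in> ?i g" "z \<notin> ?x b"
      unfolding down_sets_simps by blast
    then have "z \<in> ?x (\<not> b)" using ig[of b] by blast
    then show "y \<in> ?x (\<not> b)" using trans[of y z "Inr (\<not> b)"] z(1,2) Inr_Q by simp
  next
    fix y assume y: "y \<in> ?x (\<not> b)"
    have "Inr (\<not> b) \<in> ?i g - ?x b" using ig[of b] Inr_Q by auto
    then show "y \<in> ?i g \<ominus>\<^bsub>?M\<^esub> ?x b" using y unfolding down_sets_simps by blast
  qed
  have x_ne: "?x True \<noteq> ?x False"
  proof
    assume "?x True = ?x False"
    moreover have "Inr True \<in> ?x True" using Inr_Q by simp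
    ultimately have "Inr True \<in> ?x False" by (rule subst)
    then show False by simp
  qed
  have diff: "?i a \<ominus>\<^bsub>?M\<^esub> ?x b \<in> ?i ` S" if a: "irr a" "a \<sqsubset> g" for a b
  proof (cases "a \<sqsubseteq> hs b")
    case True
    then have "?i a \<ominus>\<^bsub>?M\<^esub> ?x b = {}" using ax[OF a(1), of b] by (intro down_sets_diff_subset) simp
    also have "\<dots> = ?i \<zero>" using cbs_embeddingD(3)[OF i] by simp
    finally show ?thesis using zero_in by blast
  next
    case False
    have "?i a \<ominus>\<^bsub>?M\<^esub> ?x b = ?i a"
    proof (rule down_sets_diff_top)
      show "?i a \<in> carrier ?M" using cbs_embeddingD(1)[OF i, of a] irr_in[OF a(1)] by simp
      show "Inl a \<in> ?i a"
        using i_iff[OF a(1), of "Inl a"] a ic Inl_Q by (simp add: less_def)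
      show "Inl a \<notin> ?x b" using False by simp
      show "r y (Inl a)" if "y \<in> ?i a" for y using that i_iff[OF a(1), of y] by simp
    qed
    then show ?thesis using irr_in[OF a(1)] by blast
  qed
  obtain f where f: "cbs_embedding f ?M L" "\<And>s. s \<in> S \<Longrightarrow> f (?i s) = s"
    using ext[OF M finite_down_sets[OF finQ] i] by blast
  have "primitive2 L S (f (?x True)) (f (?x False)) \<and>
    induces2 L S (f (?x True)) (f (?x False)) (hs True) (hs False) g"
  proof (rule primitive2_transfer[OF M i f g x _ x_ne gx1])
    show "?x b \<notin> ?i ` S" for b using not_x by blast
    show "?i g = ?x True \<squnion>\<^bsub>?M\<^esub> ?x False" using ig[of True] by simp
    show "?i a \<ominus>\<^bsub>?M\<^esub> ?x b \<in> ?i ` S" if "irr a" "a \<sqsubset> g" for a b using diff[OF that] .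
    show "?i a \<sqsubseteq>\<^bsub>?M\<^esub> ?x b \<longleftrightarrow> a \<sqsubseteq> hs b" if "irr a" for a b using ax[OF that, of b] by simp
  qed
  then show ?thesis by (auto simp: hs_def)
qed

end

lemma existentially_closed_imp_realizes_signatures:
  fixes L :: "'a cbs_sig"
  assumes L: "cbs L" and inf: "infinite (UNIV :: 'b set)" and u: "inj_on (u :: 'a \<Rightarrow> 'b) (carrier L)"
    and ec: "existentially_closed TYPE('b) L"
  shows "realizes_signatures L"
  unfolding realizes_signatures_def
proof (intro allI impI conjI)
  fix S assume S: "finite S" "sub_cbs S L"
  interpret cbs_with_sub L S by (rule cbs_with_subI) fact+
  \<comment> \<open>The fact stays polymorphic in the type of the finite extension; it is used at
    \<open>'a option set\<close> and at \<open>('a + bool) set\<close>.\<close>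
  note ext = existentially_closed_extends[OF L inf u ec S]
  show "\<exists>x. primitive1 L S x \<and> induces1 L S x h G" if "signature1 (restrict_to L S) h G" for h G
    using that by (rule extension_realizes_signature1) (rule ext)
  show "\<exists>x1 x2. primitive2 L S x1 x2 \<and> induces2 L S x1 x2 h1 h2 g"
    if "signature2 (restrict_to L S) h1 h2 g" for h1 h2 g
    using that by (rule extension_realizes_signature2) (rule ext)
qed

theorem theorem3p22:
  fixes L :: "'a cbs_sig"
  assumes "cbs L"
    and "infinite (UNIV :: 'b set)"
    and "\<exists>f :: 'a \<Rightarrow> 'b. inj_on f (carrier L)"
  shows "existentially_closed TYPE('b) L \<longleftrightarrow>
    (\<forall>S. finite S \<longrightarrow> sub_cbs S L \<longrightarrow>
      (\<forall>h G. signature1 (restrict_to L S) h G \<longrightarrow>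
         (\<exists>x. primitive1 L S x \<and> induces1 L S x h G)) \<and>
      (\<forall>h1 h2 g. signature2 (restrict_to L S) h1 h2 g \<longrightarrow>
         (\<exists>x1 x2. primitive2 L S x1 x2 \<and> induces2 L S x1 x2 h1 h2 g)))"
proof -
  obtain u :: "'a \<Rightarrow> 'b" where "inj_on u (carrier L)" using assms(3) by blast
  then have "existentially_closed TYPE('b) L \<longleftrightarrow> realizes_signatures L"
    using existentially_closed_imp_realizes_signatures[OF assms(1,2)]
      realizes_signatures_imp_existentially_closed[OF assms(1)] by blast
  then show ?thesis by (simp only: realizes_signatures_def)
qed

end
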